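(* Let $p\in(0,1]$. For all $k\in\mathbb N=\{1,2,\dots\}$ and all $c\in\mathbb R$, $$N^{(k)}_{p,n}\left(\left\lfloor\frac n2\big(\mathsf t^{(k)}_{p,n}+c\big)\right\rfloor\right)\ \longrightarrow\ \mathcal P\left(\frac{k^{k-2}e^{-kpc}e^{-k(\psi(1/p)+\gamma_E)}}{k!}\right)\quad\text{in distribution as } n\to\infty,$$ where $\mathcal P(\lambda)$ denotes a Poisson distribution with expectation $\lambda>0$. Additionally, each positive moment of $N^{(k)}_{p,n}\big(\lfloor n(\mathsf t^{(k)}_{p,n}+c)/2\rfloor\big)$ converges to the corresponding moment of this Poisson distribution.
   Context: Discrete $p$-frozen model. Fix $p\in(0,1]$. For an integer $n\ge 2$ the random (multi)graph process $(F_{p,n}(m))_{m\in\mathbb Z_+}$ on vertex set $\{1,\dots,n\}$ is defined recursively. All its connected components are either trees (number of edges = number of vertices minus one) or unicycles (number of edges = number of vertices); vertices of unicycles are called frozen. $F_{p,n}(0)$ has $n$ isolated non-frozen vertices. At step $m\ge 1$, given $F_{p,n}(m-1)$, one of the $n(n-1)/2$ possible edges is selected uniformly at random, independently of the past (the same edge may be selected several times), and: (i) if it connects two vertices of trees of $F_{p,n}(m-1)$ (possibly the same tree), it is added; if two different trees are involved this produces a new tree (non-frozen), otherwise it produces a unicycle whose vertices become frozen (if the selected edge is already present in the tree, it is added as a parallel edge, creating a cycle of length two); (ii) if it connects two vertices of unicycles (possibly the same), it is discarded; (iii) if it connects a tree and a unicycle, it is added with probability $p$ (the tree is glued to the unicycle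 and all its vertices become frozen) and discarded with probability $1-p$. Notation: $N^{(k)}_{p,n}(m)$ is the number of tree components with exactly $k$ vertices in $F_{p,n}(m)$; $$\mathsf t^{(k)}_{p,n}=\frac{\ln n}{kp}+\frac{k-1}{kp}\ln\Big(\frac{\ln n}{kp}\Big)$$ (for fixed $c$, $\mathsf t^{(k)}_{p,n}+c\ge0$ for $n$ large); $\gamma_E$ is Euler's constant and $\psi(x)=\Gamma'(x)/\Gamma(x)$, $x>0$, is the digamma function. *)

theory Defs
  imports "HOL-Probability.Probability"
begin

text \<open>
  A multigraph on the vertex set \<open>{1..n}\<close> is represented by its multiset of edges, an edge being
  a two-element set of vertices, so that parallel edges are possible but loops are not.
\<close>

type_synonym multigraph = "nat set multiset"

definition component :: "multigraph \<Rightarrow> nat \<Rightarrow> nat set" where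
  "component G v = {(x, y). {x, y} \<in># G}\<^sup>* `` {v}"

definition components :: "nat \<Rightarrow> multigraph \<Rightarrow> nat set set" where
  "components n G = component G ` {1..n}"

definition num_edges :: "multigraph \<Rightarrow> nat set \<Rightarrow> nat" where
  "num_edges G C = size (filter_mset (\<lambda>e. e \<subseteq> C) G)"

text \<open>The next two predicates are only meant for connected components \<open>C\<close> of \<open>G\<close>.\<close>

definition is_tree :: "multigraph \<Rightarrow> nat set \<Rightarrow> bool" where
  "is_tree G C \<longleftrightarrow> num_edges G C + 1 = card C"

definition is_unicycle :: "multigraph \<Rightarrow> nat set \<Rightarrow> bool" where
  "is_unicycle G C \<longleftrightarrow> num_edges G C = card C"

definition possible_edges :: "nat \<Rightarrow> nat set set" where
  "possible_edges n = {e. e \<subseteq> {1..n} \<and> card e = 2}"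

text \<open>
  Outcome of one step once the edge \<open>e\<close> has been selected. Freezing needs no separate bookkeeping:
  adding an edge inside a tree, or between a tree and a unicycle, makes the resulting component a
  unicycle in the sense of \<open>is_unicycle\<close>.
\<close>

definition add_edge_step :: "real \<Rightarrow> multigraph \<Rightarrow> nat set \<Rightarrow> multigraph pmf" where
  "add_edge_step p G e =
    (if \<forall>v\<in>e. is_tree G (component G v) then return_pmf (add_mset e G)
     else if \<forall>v\<in>e. is_unicycle G (component G v) then return_pmf G
     else map_pmf (\<lambda>b. if b then add_mset e G else G) (bernoulli_pmf p))"

text \<open>
  The process is a Markov chain; \<open>frozen_graph p n m\<close> is the law of its state at time \<open>m\<close>.
  It is meaningful for \<open>n \<ge> 2\<close>, where \<open>possible_edges n\<close> is nonempty.
\<close>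

primrec frozen_graph :: "real \<Rightarrow> nat \<Rightarrow> nat \<Rightarrow> multigraph pmf" where
  "frozen_graph p n 0 = return_pmf {#}"
| "frozen_graph p n (Suc m) =
    bind_pmf (frozen_graph p n m) (\<lambda>G.
      bind_pmf (pmf_of_set (possible_edges n)) (\<lambda>e. add_edge_step p G e))"

definition tree_count :: "nat \<Rightarrow> nat \<Rightarrow> multigraph \<Rightarrow> nat" where
  "tree_count n k G = card {C \<in> components n G. is_tree G C \<and> card C = k}"

definition num_trees :: "real \<Rightarrow> nat \<Rightarrow> nat \<Rightarrow> nat \<Rightarrow> nat pmf" where
  "num_trees p n k m = map_pmf (tree_count n k) (frozen_graph p n m)"

definition crit_time :: "real \<Rightarrow> nat \<Rightarrow> nat \<Rightarrow> real" where
  "crit_time p n k = ln (real n) / (real k * p)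
     + (real k - 1) / (real k * p) * ln (ln (real n) / (real k * p))"

text \<open>The conversion by \<open>nat\<close> truncates at 0, which matters for finitely many \<open>n\<close> only.\<close>

definition num_steps :: "real \<Rightarrow> nat \<Rightarrow> nat \<Rightarrow> real \<Rightarrow> nat" where
  "num_steps p n k c = nat \<lfloor>real n / 2 * (crit_time p n k + c)\<rfloor>"

definition limit_rate :: "real \<Rightarrow> nat \<Rightarrow> real \<Rightarrow> real" where
  "limit_rate p k c =
     real k powi (int k - 2) * exp (- (real k * p * c))
       * exp (- (real k * (Digamma (1 / p) + euler_mascheroni))) / fact k"

end

theory Submission
  imports Defs "HOL-Complex_Analysis.Complex_Analysis" "HOL-Real_Asymp.Real_Asymp"
begin

text \<open>
  The edges of a tree component can be taken out of the process: if \<open>A\<close> is a forest on a vertex set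
  that \<open>H\<close> avoids, then the probability of the state \<open>A + H\<close> at time \<open>m\<close> is an explicit factor times
  the probability of \<open>H\<close> at time \<open>m - size A\<close>, because a step that inserts an edge of \<open>A\<close> does not
  influence the rest and a vertex of \<open>A\<close> behaves towards the rest like an isolated vertex. With
  Cayley's formula, all factorial moments of the number of trees of size \<open>k\<close> thereby reduce to
  factorial moments of the number of isolated vertices at a slightly earlier time.

  Conversely, the same identity expresses the mean number of trees of each size by isolated vertices,
  so the fractions of isolated and of frozen vertices follow the solution of an ordinary
  differential equation up to any fixed multiple of \<open>n\<close> steps. From there on the
  unfrozen part is subcritical and decays exponentially, which gives sub- and supersolutions for the
  mixed moments of isolated vertices at all later times. With \<open>\<tau> x\<close> the time at
  which a fraction \<open>x\<close> of the vertices is frozen, \<open>p \<tau> x + ln (1 - x)\<close> tends to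
  \<open>- (\<psi> (1/p) + \<gamma>)\<close> as \<open>x\<close> tends to 1, which is where this constant comes from. Finally,
  convergence of all factorial moments to powers of the rate gives convergence to the Poisson law
  (Bonferroni inequalities).
\<close>

section \<open>Components of a multigraph\<close>

text \<open>The drift of the isolated vertices contains the unfrozen mass, which is not a function
  of them. It is recovered from the isolated fraction as a truncated tree series, with two errors:
  tree counts fluctuate, and trees beyond the truncation level are left out. The slope of the full
  series is infinite at the critical time, so a Gronwall argument would bring in constants that grow
  with the level. What helps is that the series has nonnegative coefficients: it is increasing, the
  drift is dissipative, and the mean square distance to the fluid limit only accumulates the errors,
  with a constant independent of the level. Errors that are small merely on average over time are
  then good enough, and nothing better is proved for the mass in large trees. Since the isolated
  fraction tends to zero, late times require relative precision. The estimates there are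
  multiplicative, propagating moments by a factor per step, and the relative error left over
  vanishes when the multiple of \<open>n\<close> at which they start tends to infinity after
  \<open>n\<close>.\<close>

lemma component_refl [simp, intro]: "v \<in> component G v"
  by (simp add: component_def)

lemma adj_sym: "sym {(x, y). {x, y} \<in># G}"
  by (auto simp: sym_def insert_commute)

lemma component_eq_iff: "component G v = component G w \<longleftrightarrow> w \<in> component G v"
proof
  assume "component G v = component G w" then show "w \<in> component G v" by auto
next
  let ?R = "{(x, y). {x, y} \<in># G}"
  assume "w \<in> component G v"
  then have vw: "(v, w) \<in> ?R\<^sup>*" by (simp add: component_def)
  then have wv: "(w, v) \<in> ?R\<^sup>*" using sym_rtrancl[OF adj_sym[of G]] by (auto simp: sym_def)
  show "component G v = component G w"
    unfolding component_def using vw wv by (auto intro: rtrancl_trans)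
qed

lemma component_memD: "w \<in> component G v \<Longrightarrow> component G w = component G v"
  by (metis component_eq_iff)

lemma component_sym: "w \<in> component G v \<longleftrightarrow> v \<in> component G w"
  by (metis component_eq_iff component_refl)

lemma component_disjoint: "component G v \<noteq> component G w \<Longrightarrow> component G v \<inter> component G w = {}"
  by (metis component_memD disjoint_iff)

lemma component_step: "{x, y} \<in># G \<Longrightarrow> component G x = component G y"
  unfolding component_eq_iff unfolding component_def by auto

text \<open>Upper bounds for components are obtained by exhibiting a set closed under edges, so that
  no induction over paths is needed afterwards.\<close>

lemma component_least:
  assumes "v \<in> S" and "\<And>x y. x \<in> S \<Longrightarrow> {x, y} \<in># G \<Longrightarrow> y \<in> S"
  shows "component G v \<subseteq> S"
proof
  fix w assume "w \<in> component G v"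
  then have "(v, w) \<in> {(x, y). {x, y} \<in># G}\<^sup>*" by (simp add: component_def)
  then show "w \<in> S" by (induction rule: rtrancl_induct) (use assms in auto)
qed

lemma component_mono:
  assumes "G \<subseteq># H" shows "component G v \<subseteq> component H v"
proof (rule component_least)
  fix x y assume "x \<in> component H v" "{x, y} \<in># G"
  then show "y \<in> component H v"
    using mset_subset_eqD[OF assms] component_step component_eq_iff by metis
qed auto

lemma component_empty [simp]: "component {#} v = {v}"
  using component_least[of v "{v}" "{#}"] by auto

lemma component_untouched:
  assumes "\<And>e. e \<in># H \<Longrightarrow> e \<inter> V = {}" "v \<in> V" shows "component H v = {v}"
  using component_least[of v "{v}" H] assms by blast

text \<open>Size two also excludes the empty edge, which \<open>num_edges\<close> would count in
  every component.\<close>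

definition loopless :: "multigraph \<Rightarrow> bool" where
  "loopless G \<longleftrightarrow> (\<forall>e\<in>#G. card e = 2)"

lemma loopless_simps [simp]: "loopless {#}" "loopless (add_mset e G) \<longleftrightarrow> card e = 2 \<and> loopless G"
  "loopless (G + H) \<longleftrightarrow> loopless G \<and> loopless H"
  by (auto simp: loopless_def)

lemma edge_subset_component:
  assumes "e \<in># G" "card e = 2" "e \<inter> component G v \<noteq> {}" shows "e \<subseteq> component G v"
proof -
  obtain x y where e: "e = {x, y}" using assms(2) by (meson card_2_iff)
  with component_step[of x y G] assms show ?thesis
    by (metis component_eq_iff component_memD component_refl component_sym disjoint_iff insert_iff singletonD subsetI)
qed

lemma finite_component:
  assumes "loopless G" shows "finite (component G v)"
proof (rule finite_subset)
  show "component G v \<subseteq> insert v (\<Union>(set_mset G))"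
    by (rule component_least) auto
  have "finite e" if "e \<in># G" for e
    using assms that by (auto simp: loopless_def intro: card_ge_0_finite)
  then show "finite (insert v (\<Union> (set_mset G)))" by simp
qed

lemma component_add_edge:
  "component (add_mset {x, y} G) v =
     (if v \<in> component G x \<union> component G y then component G x \<union> component G y else component G v)"
  (is "?C' v = _")
proof -
  have step: "?C' x = ?C' y" by (rule component_step) simp
  have mono: "component G w \<subseteq> ?C' w" for w by (rule component_mono) simp
  show ?thesis
  proof (cases "v \<in> component G x \<union> component G y")
    case True
    have "?C' v = ?C' x" using True mono step by (metis Un_iff component_memD subsetD)
    moreover have "component G x \<union> component G y \<subseteq> ?C' x" using mono step by auto
    moreover have "?C' v \<subseteq> component G x \<union> component G y"
    proof (rule component_least)
      fix a b assume "a \<in> component G x \<union> component G y" "{a, b} \<in># add_mset {x, y} G"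
      then show "b \<in> component G x \<union> component G y"
        by (auto simp: doubleton_eq_iff dest: component_step) (metis component_eq_iff component_memD component_step)+
    qed (use True in auto)
    ultimately show ?thesis using True by auto
  next
    case False
    have "?C' v \<subseteq> component G v"
    proof (rule component_least)
      fix a b assume a: "a \<in> component G v" "{a, b} \<in># add_mset {x, y} G"
      have "a \<noteq> x" "a \<noteq> y" using a(1) False by (auto simp: component_sym)
      with a(2) have "{a, b} \<in># G" by (auto simp: doubleton_eq_iff)
      with a(1) show "b \<in> component G v" by (metis component_eq_iff component_memD component_step)
    qed auto
    with mono False show ?thesis by auto
  qed
qed

lemma num_edges_empty [simp]: "num_edges {#} C = 0"
  by (simp add: num_edges_def)

lemma num_edges_add_mset [simp]:
  "num_edges (add_mset e G) C = num_edges G C + (if e \<subseteq> C then 1 else 0)"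
  by (simp add: num_edges_def)

text \<open>A nonempty edge inside the union meets one of the two components and hence lies within
  it; disjointness prevents counting an edge twice.\<close>

lemma num_edges_Un:
  assumes "loopless G" "component G x \<inter> component G y = {}"
  shows "num_edges G (component G x \<union> component G y) =
         num_edges G (component G x) + num_edges G (component G y)"
proof -
  have "filter_mset (\<lambda>e. e \<subseteq> component G x \<union> component G y) G =
     filter_mset (\<lambda>e. e \<subseteq> component G x \<or> e \<subseteq> component G y) G"
  proof (rule filter_mset_cong)
    fix e assume "e \<in># G"
    then have "card e = 2" using assms by (auto simp: loopless_def)
    then have "e \<noteq> {}" by auto
    then show "(e \<subseteq> component G x \<union> component G y) = (e \<subseteq> component G x \<or> e \<subseteq> component G y)"
      using edge_subset_component[OF \<open>e \<in># G\<close> \<open>card e = 2\<close>] by blast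
  qed auto
  also have "\<dots> = filter_mset (\<lambda>e. e \<subseteq> component G x) G + filter_mset (\<lambda>e. e \<subseteq> component G y) G"
  proof (rule multiset_eqI)
    fix e
    show "count (filter_mset (\<lambda>e. e \<subseteq> component G x \<or> e \<subseteq> component G y) G) e =
      count (filter_mset (\<lambda>e. e \<subseteq> component G x) G + filter_mset (\<lambda>e. e \<subseteq> component G y) G) e"
    proof (cases "e \<in># G \<and> e \<subseteq> component G x \<and> e \<subseteq> component G y")
      case True
      then have "e = {}" using assms(2) by auto
      then show ?thesis using True assms(1) by (auto simp: loopless_def)
    next
      case False
      then show ?thesis by (auto simp: not_in_iff)
    qed
  qed
  finally show ?thesis by (simp add: num_edges_def)
qed

section \<open>Effect of one new edge on trees and unicycles\<close>

abbreviation in_tree :: "multigraph \<Rightarrow> nat \<Rightarrow> bool" where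
  "in_tree G v \<equiv> is_tree G (component G v)"

abbreviation in_unicycle :: "multigraph \<Rightarrow> nat \<Rightarrow> bool" where
  "in_unicycle G v \<equiv> is_unicycle G (component G v)"

lemma not_tree_and_unicycle: "is_tree G C \<Longrightarrow> is_unicycle G C \<Longrightarrow> False"
  by (simp add: is_tree_def is_unicycle_def)

lemma add_edge_same:
  assumes "y \<in> component G x"
  shows "component (add_mset {x, y} G) v = component G v"
    and "num_edges (add_mset {x, y} G) (component G v) =
           num_edges G (component G v) + (if v \<in> component G x then 1 else 0)"
proof -
  have xy: "component G y = component G x" using assms by (rule component_memD)
  show "component (add_mset {x, y} G) v = component G v"
    by (simp add: component_add_edge xy component_memD)
  have "{x, y} \<subseteq> component G v \<longleftrightarrow> v \<in> component G x"
    using xy by (auto simp: component_sym)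
  then show "num_edges (add_mset {x, y} G) (component G v) =
           num_edges G (component G v) + (if v \<in> component G x then 1 else 0)"
    by simp
qed

lemma add_edge_other:
  assumes "v \<notin> component G x" "v \<notin> component G y"
  shows "component (add_mset {x, y} G) v = component G v"
    and "num_edges (add_mset {x, y} G) (component G v) = num_edges G (component G v)"
proof -
  show "component (add_mset {x, y} G) v = component G v"
    using assms by (simp add: component_add_edge)
  show "num_edges (add_mset {x, y} G) (component G v) = num_edges G (component G v)"
    using assms by (auto simp: component_sym)
qed

lemma add_edge_join:
  assumes "loopless G" "y \<notin> component G x" "v \<in> component G x \<union> component G y"
  shows "component (add_mset {x, y} G) v = component G x \<union> component G y"
    and "num_edges (add_mset {x, y} G) (component G x \<union> component G y) =
           num_edges G (component G x) + num_edges G (component G y) + 1"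
    and "card (component G x \<union> component G y) = card (component G x) + card (component G y)"
proof -
  have disj: "component G x \<inter> component G y = {}"
    using assms(2) component_disjoint[of G x y] component_eq_iff[of G x y] by auto
  show "component (add_mset {x, y} G) v = component G x \<union> component G y"
    using assms by (simp add: component_add_edge)
  show "num_edges (add_mset {x, y} G) (component G x \<union> component G y) =
           num_edges G (component G x) + num_edges G (component G y) + 1"
    using num_edges_Un[OF assms(1) disj] by auto
  show "card (component G x \<union> component G y) = card (component G x) + card (component G y)"
    using disj assms(1) by (intro card_Un_disjoint) (auto simp: finite_component)
qed

lemma in_tree_add_edge_other:
  "v \<notin> component G x \<Longrightarrow> v \<notin> component G y \<Longrightarrow> in_tree (add_mset {x, y} G) v = in_tree G v"
  "v \<notin> component G x \<Longrightarrow> v \<notin> component G y \<Longrightarrow> in_unicycle (add_mset {x, y} G) v = in_unicycle G v"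
  unfolding is_tree_def is_unicycle_def using add_edge_other[of v G x y] by presburger+

lemma in_tree_cong: "w \<in> component G v \<Longrightarrow> in_tree G w = in_tree G v"
  "w \<in> component G v \<Longrightarrow> in_unicycle G w = in_unicycle G v"
  by (simp_all add: component_memD)

lemma in_tree_add_edge_same:
  assumes "y \<in> component G x" "in_tree G x" "v \<in> component G x"
  shows "\<not> in_tree (add_mset {x, y} G) v" "in_unicycle (add_mset {x, y} G) v"
  using assms add_edge_same[OF assms(1), of v] component_memD[OF assms(3)]
  by (simp_all only: is_tree_def is_unicycle_def) auto

lemma in_tree_add_edge_join:
  assumes "loopless G" "y \<notin> component G x" "v \<in> component G x \<union> component G y"
    and "in_tree G x"
  shows "in_tree G y \<Longrightarrow> in_tree (add_mset {x, y} G) v"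
    and "in_unicycle G y \<Longrightarrow> in_unicycle (add_mset {x, y} G) v"
  using assms add_edge_join[OF assms(1-3)]
  by (simp_all only: is_tree_def is_unicycle_def)

text \<open>Joining two components adds their sizes, and adds one to the sum of their edge counts.
  Trees are thus the components with the fewest possible edges, which is what allows a tree to be
  split again when an edge is taken out.\<close>

lemma card_component_le:
  assumes "loopless G" shows "card (component G v) \<le> num_edges G (component G v) + 1"
  using assms
proof (induction G arbitrary: v)
  case empty
  then show ?case by simp
next
  case (add e G)
  from add.prems have lG: "loopless G" and "card e = 2" by auto
  then obtain x y where e: "e = {x, y}" by (meson card_2_iff)
  consider "y \<in> component G x" | "y \<notin> component G x" "v \<in> component G x \<union> component G y"
    | "v \<notin> component G x" "v \<notin> component G y" by auto
  then show ?case
  proof cases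
    case 1
    then show ?thesis unfolding e add_edge_same[OF 1] using add.IH[OF lG, of v] by auto
  next
    case 2
    show ?thesis unfolding e add_edge_join[OF lG 2]
      using add.IH[OF lG, of x] add.IH[OF lG, of y] by simp
  next
    case 3
    then show ?thesis unfolding e add_edge_other[OF 3] using add.IH[OF lG, of v] by simp
  qed
qed

text \<open>All natural numbers are quantified over: a vertex off all edges is a one-vertex tree, so
  no vertex set has to be carried along.\<close>

definition forest :: "multigraph \<Rightarrow> bool" where
  "forest G \<longleftrightarrow> loopless G \<and> (\<forall>v. in_tree G v)"

lemma forest_empty [simp]: "forest {#}"
  by (simp add: forest_def is_tree_def)

text \<open>For the forward direction, each of the two joined parts has at least its size minus one
  edges, and the count for the joined tree leaves no slack, so both parts are trees. An edge inside
  a component would be one too many.\<close>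

lemma forest_add_edge_iff:
  assumes "x \<noteq> y"
  shows "forest (add_mset {x, y} G) \<longleftrightarrow> forest G \<and> y \<notin> component G x"
proof
  assume F: "forest (add_mset {x, y} G)"
  then have lG: "loopless G" and T: "\<And>v. in_tree (add_mset {x, y} G) v" by (auto simp: forest_def)
  have ny: "y \<notin> component G x"
  proof
    assume y: "y \<in> component G x"
    show False
      using T[of x] add_edge_same[OF y, of x] card_component_le[OF lG, of x]
      unfolding is_tree_def by simp
  qed
  have "in_tree G v" for v
  proof (cases "v \<in> component G x \<union> component G y")
    case True
    have "in_tree G x \<and> in_tree G y"
      using T[of v] add_edge_join[OF lG ny True] card_component_le[OF lG, of x]
        card_component_le[OF lG, of y] unfolding is_tree_def by simp
    then show ?thesis using True by (auto simp: component_memD)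
  next
    case False
    then show ?thesis using T[of v] in_tree_add_edge_other[of v G x y] by auto
  qed
  with lG ny show "forest G \<and> y \<notin> component G x" by (auto simp: forest_def)
next
  assume A: "forest G \<and> y \<notin> component G x"
  then have lG: "loopless G" and T: "\<And>v. in_tree G v" by (auto simp: forest_def)
  have "in_tree (add_mset {x, y} G) v" for v
    using in_tree_add_edge_join(1)[OF lG, of y x v] in_tree_add_edge_other[of v G x y] A T by blast
  then show "forest (add_mset {x, y} G)" using lG assms by (auto simp: forest_def)
qed

lemma forest_remove_edge:
  assumes "forest (add_mset e G)" shows "forest G"
proof -
  have "card e = 2" using assms by (auto simp: forest_def)
  then obtain x y where "e = {x, y}" "x \<noteq> y" by (meson card_2_iff)
  with assms show ?thesis by (simp add: forest_add_edge_iff)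
qed

lemma forest_simple:
  assumes "forest (add_mset e G)" shows "e \<notin># G"
proof
  assume e: "e \<in># G"
  have "card e = 2" using assms by (auto simp: forest_def)
  then obtain x y where xy: "e = {x, y}" "x \<noteq> y" by (meson card_2_iff)
  with assms have "y \<notin> component G x" by (simp add: forest_add_edge_iff)
  moreover have "component G x = component G y" using e xy component_step by auto
  ultimately show False by auto
qed

lemma forest_card_edges:
  assumes "forest G" shows "card (set_mset G) = size G"
  using assms
proof (induction G)
  case (add e G)
  then show ?case using forest_simple[of e G] forest_remove_edge[of e G] by simp
qed simp

text \<open>Edges within \<open>V\<close> and edges avoiding \<open>V\<close> do not interact. Both
  orders of the sum are provided because the lemma is also applied to the complement of
  \<open>V\<close>, where \<open>A\<close> and \<open>B\<close> exchange roles.\<close>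

lemma component_union_disjoint:
  assumes "v \<in> V" "\<And>e. e \<in># A \<Longrightarrow> e \<subseteq> V" "\<And>e. e \<in># B \<Longrightarrow> e \<inter> V = {}" "loopless B"
  shows "component (A + B) v = component A v" "component (B + A) v = component A v"
    and "component A v \<subseteq> V"
    and "num_edges (A + B) (component A v) = num_edges A (component A v)"
    and "num_edges (B + A) (component A v) = num_edges A (component A v)"
proof -
  show V: "component A v \<subseteq> V" by (rule component_least) (use assms in auto)
  have "component (A + B) v \<subseteq> component A v"
  proof (rule component_least)
    fix x y assume x: "x \<in> component A v" "{x, y} \<in># A + B"
    then have "{x, y} \<notin># B" using V assms(3) by blast
    then have "{x, y} \<in># A" using x by auto
    then show "y \<in> component A v" using x(1) by (metis component_eq_iff component_memD component_step)
  qed auto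
  with component_mono[of A "A + B" v] show 1: "component (A + B) v = component A v" by auto
  then show "component (B + A) v = component A v" by (simp add: add.commute)
  have "filter_mset (\<lambda>e. e \<subseteq> component A v) B = {#}"
  proof -
    have "\<not> e \<subseteq> component A v" if "e \<in># B" for e
    proof
      assume "e \<subseteq> component A v"
      then have "e = {}" using V assms(3)[OF that] by auto
      then show False using that assms(4) by (auto simp: loopless_def)
    qed
    then show ?thesis by (auto simp: filter_mset_eq_conv)
  qed
  then show "num_edges (A + B) (component A v) = num_edges A (component A v)"
    "num_edges (B + A) (component A v) = num_edges A (component A v)"
    by (auto simp: num_edges_def)
qed

section \<open>States that the process can visit\<close>

definition valid :: "nat \<Rightarrow> multigraph \<Rightarrow> bool" where
  "valid n G \<longleftrightarrow> set_mset G \<subseteq> possible_edges n \<and> (\<forall>v. in_tree G v \<or> in_unicycle G v)"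

lemma valid_loopless: "valid n G \<Longrightarrow> loopless G"
  by (auto simp: valid_def loopless_def possible_edges_def)

lemma valid_not_in_tree: "valid n G \<Longrightarrow> \<not> in_tree G v \<longleftrightarrow> in_unicycle G v"
  by (auto simp: valid_def dest: not_tree_and_unicycle)

lemma valid_empty: "valid n {#}"
  using forest_empty by (auto simp: valid_def forest_def)

lemma valid_add_edge:
  assumes "valid n G" "{x, y} \<in> possible_edges n" "in_tree G x"
  shows "valid n (add_mset {x, y} G)"
proof -
  have lG: "loopless G" using assms valid_loopless by blast
  have "in_tree (add_mset {x, y} G) v \<or> in_unicycle (add_mset {x, y} G) v" for v
    using in_tree_add_edge_join[OF lG, of y x v] in_tree_add_edge_other[of v G x y]
      in_tree_add_edge_same[of y G x v] assms(1,3) unfolding valid_def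
    by (metis UnCI UnE component_memD)
  then show ?thesis using assms by (auto simp: valid_def)
qed

lemma component_subset_range:
  assumes "set_mset G \<subseteq> possible_edges n" "v \<in> {1..n}" shows "component G v \<subseteq> {1..n}"
  by (rule component_least) (use assms in \<open>auto simp: possible_edges_def\<close>)

section \<open>One step of the process\<close>

lemma finite_possible_edges [simp]: "finite (possible_edges n)"
  by (rule finite_subset[of _ "Pow {1..n}"]) (auto simp: possible_edges_def)

lemma card_possible_edges: "card (possible_edges n) = n choose 2"
  using n_subsets[of "{1..n}" 2] by (simp add: possible_edges_def)

locale frozen_process =
  fixes p :: real and n :: nat
  assumes p_pos: "0 < p" and p_le_1: "p \<le> 1" and n_ge_2: "n \<ge> 2"
begin

abbreviation edges :: "nat set set" where "edges \<equiv> possible_edges n"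

definition N :: real where "N = real (card edges)"

lemma N_eq: "N = real n * (real n - 1) / 2"
  using n_ge_2 by (simp add: N_def card_possible_edges choose_two real_of_nat_div of_nat_diff)

lemma N_pos: "N > 0"
  using n_ge_2 by (simp add: N_eq)

lemma edges_nonempty: "edges \<noteq> {}"
  using N_pos by (auto simp: N_def)

definition accept :: "multigraph \<Rightarrow> nat set \<Rightarrow> real" where
  "accept G e = (if \<forall>v\<in>e. in_tree G v then 1 else if \<forall>v\<in>e. in_unicycle G v then 0 else p)"

lemma accept_nonneg: "0 \<le> accept G e" and accept_le_1: "accept G e \<le> 1"
  using p_pos p_le_1 by (auto simp: accept_def)

text \<open>\<open>gen \<Phi> G / N\<close> is the expected increment of \<open>\<Phi>\<close> in
  one step from \<open>G\<close>. Leaving out the factor \<open>1 / N\<close> keeps the drifts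
  computed below polynomial in vertex counts.\<close>

definition gen :: "(multigraph \<Rightarrow> real) \<Rightarrow> multigraph \<Rightarrow> real" where
  "gen \<Phi> G = (\<Sum>e\<in>edges. accept G e * (\<Phi> (add_mset e G) - \<Phi> G))"

abbreviation law :: "nat \<Rightarrow> multigraph pmf" where "law m \<equiv> frozen_graph p n m"

definition E :: "nat \<Rightarrow> (multigraph \<Rightarrow> real) \<Rightarrow> real" where
  "E m \<Phi> = measure_pmf.expectation (law m) \<Phi>"

lemma finite_add_edge_step: "finite (set_pmf (add_edge_step p G e))"
  by (auto simp: add_edge_step_def intro: finite_subset[OF subset_UNIV])

lemma set_add_edge_step:
  assumes "H \<in> set_pmf (add_edge_step p G e)"
  shows "H = G \<or> H = add_mset e G \<and> \<not> (\<forall>v\<in>e. in_unicycle G v) \<or> H = add_mset e G \<and> (\<forall>v\<in>e. in_tree G v)"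
  using assms by (auto simp: add_edge_step_def split: if_splits)

lemma expectation_add_edge_step:
  "measure_pmf.expectation (add_edge_step p G e) \<Phi> = \<Phi> G + accept G e * (\<Phi> (add_mset e G) - \<Phi> G)"
  using p_pos p_le_1 by (simp add: add_edge_step_def accept_def algebra_simps)

lemma finite_law: "finite (set_pmf (law m))"
  by (induction m) (simp_all add: set_bind_pmf set_pmf_of_set edges_nonempty finite_add_edge_step)

lemma E_sum: "E m \<Phi> = (\<Sum>G\<in>set_pmf (law m). pmf (law m) G * \<Phi> G)"
  by (simp add: E_def integral_measure_pmf[OF finite_law])

lemma E_sum_superset:
  assumes "finite A" "set_pmf (law m) \<subseteq> A"
  shows "E m \<Phi> = (\<Sum>G\<in>A. pmf (law m) G * \<Phi> G)"
  unfolding E_sum by (rule sum.mono_neutral_left) (use assms in \<open>auto simp: set_pmf_iff\<close>)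

lemma E_add: "E m (\<lambda>G. f G + g G) = E m f + E m g"
  by (simp add: E_sum algebra_simps sum.distrib)

lemma E_diff: "E m (\<lambda>G. f G - g G) = E m f - E m g"
  by (simp add: E_sum algebra_simps sum_subtractf)

lemma E_cmult: "E m (\<lambda>G. c * f G) = c * E m f"
  by (simp add: E_sum sum_distrib_left mult_ac)

lemma E_divide: "E m (\<lambda>G. f G / c) = E m f / c"
  using E_cmult[of m "1 / c" f] by simp

lemma E_const [simp]: "E m (\<lambda>G. c) = c"
  by (simp add: E_def)

lemma E_setsum: "E m (\<lambda>G. \<Sum>i\<in>I. f i G) = (\<Sum>i\<in>I. E m (f i))"
  by (simp add: E_sum sum_distrib_left) (rule sum.swap)

lemma E_0 [simp]: "E 0 \<Phi> = \<Phi> {#}"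
  by (simp add: E_def)

lemma E_Suc: "E (Suc m) \<Phi> = E m (\<lambda>G. \<Phi> G + gen \<Phi> G / N)"
proof -
  have "measure_pmf.expectation (bind_pmf (pmf_of_set edges) (add_edge_step p G)) \<Phi> = \<Phi> G + gen \<Phi> G / N" for G
  proof -
    have "measure_pmf.expectation (bind_pmf (pmf_of_set edges) (add_edge_step p G)) \<Phi> =
      (\<Sum>e\<in>edges. \<Phi> G + accept G e * (\<Phi> (add_mset e G) - \<Phi> G)) / N"
      by (subst pmf_expectation_bind[of edges])
        (simp_all add: finite_add_edge_step edges_nonempty set_pmf_of_set expectation_add_edge_step N_def
           sum_divide_distrib)
    also have "\<dots> = \<Phi> G + gen \<Phi> G / N"
      using N_pos edges_nonempty by (simp add: gen_def sum.distrib N_def add_divide_distrib)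
    finally show ?thesis .
  qed
  moreover have "E (Suc m) \<Phi> = (\<Sum>G\<in>set_pmf (law m). pmf (law m) G *
      measure_pmf.expectation (bind_pmf (pmf_of_set edges) (add_edge_step p G)) \<Phi>)"
    unfolding E_def
    by (simp, subst pmf_expectation_bind[OF finite_law])
       (auto simp: set_bind_pmf set_pmf_of_set edges_nonempty finite_add_edge_step)
  ultimately show ?thesis by (simp add: E_sum)
qed

lemma E_point: "E m (\<lambda>G. of_bool (G = X) * f G) = pmf (law m) X * f X"
proof -
  have "E m (\<lambda>G. of_bool (G = X) * f G) = (\<Sum>G\<in>insert X (set_pmf (law m)). pmf (law m) G * (of_bool (G = X) * f G))"
    by (rule E_sum_superset) (auto simp: finite_law)
  also have "\<dots> = (\<Sum>G\<in>insert X (set_pmf (law m)). if G = X then pmf (law m) X * f X else 0)"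
    by (rule sum.cong) auto
  finally show ?thesis by (simp add: finite_law)
qed

text \<open>Forward equation: when \<open>e\<close> is selected, \<open>G\<close> arises from itself
  by rejection or from \<open>G - {#e#}\<close> by insertion, and as a multiset it has no other
  predecessor.\<close>

lemma pmf_Suc:
  "pmf (law (Suc m)) G = (\<Sum>e\<in>edges.
     (if e \<in># G then pmf (law m) (G - {#e#}) * accept (G - {#e#}) e else 0)
     + pmf (law m) G * (1 - accept G e)) / N"
proof -
  have "pmf (law (Suc m)) G = E (Suc m) (\<lambda>H. of_bool (H = G))"
    using E_point[of "Suc m" G "\<lambda>_. 1"] by simp
  also have "\<dots> = E m (\<lambda>H. of_bool (H = G)) + E m (gen (\<lambda>H. of_bool (H = G))) / N"
    unfolding E_Suc by (simp add: E_add E_divide)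
  also have "E m (gen (\<lambda>H. of_bool (H = G))) = (\<Sum>e\<in>edges.
    E m (\<lambda>H. accept H e * of_bool (add_mset e H = G)) - E m (\<lambda>H. of_bool (H = G) * accept H e))"
    unfolding gen_def by (simp add: E_setsum E_diff algebra_simps)
  also have "\<dots> = (\<Sum>e\<in>edges. (if e \<in># G then pmf (law m) (G - {#e#}) * accept (G - {#e#}) e else 0)
     - pmf (law m) G * accept G e)"
  proof (intro sum.cong refl arg_cong2[of _ _ _ _ minus])
    fix e assume "e \<in> edges"
    show "E m (\<lambda>H. accept H e * of_bool (add_mset e H = G)) =
       (if e \<in># G then pmf (law m) (G - {#e#}) * accept (G - {#e#}) e else 0)"
    proof (cases "e \<in># G")
      case True
      then have "(add_mset e H = G) = (H = G - {#e#})" for H by auto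
      then show ?thesis using True E_point[of m "G - {#e#}" "\<lambda>H. accept H e"] by (simp add: mult.commute)
    next
      case False
      then have "(add_mset e H = G) = False" for H by auto
      then show ?thesis using False by simp
    qed
    show "E m (\<lambda>H. of_bool (H = G) * accept H e) = pmf (law m) G * accept G e" by (rule E_point)
  qed
  also have "E m (\<lambda>H. of_bool (H = G)) = pmf (law m) G"
    using E_point[of m G "\<lambda>_. 1"] by simp
  finally have 1: "pmf (law (Suc m)) G = pmf (law m) G + (\<Sum>e\<in>edges.
     (if e \<in># G then pmf (law m) (G - {#e#}) * accept (G - {#e#}) e else 0) - pmf (law m) G * accept G e) / N" .
  have 2: "pmf (law m) G = (\<Sum>e\<in>edges. pmf (law m) G) / N" using N_pos edges_nonempty by (simp add: N_def)
  show ?thesis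
    unfolding 1 by (subst 2) (simp only: add_divide_distrib[symmetric] sum.distrib[symmetric], simp add: algebra_simps)
qed

lemma valid_law: "G \<in> set_pmf (law m) \<Longrightarrow> valid n G"
proof (induction m arbitrary: G)
  case 0
  then show ?case by (simp add: valid_empty)
next
  case (Suc m)
  then obtain H e where H: "H \<in> set_pmf (law m)" "e \<in> edges" "G \<in> set_pmf (add_edge_step p H e)"
    by (auto simp: set_bind_pmf set_pmf_of_set edges_nonempty)
  have vH: "valid n H" using Suc.IH H by blast
  obtain x y where e: "e = {x, y}" using H(2) by (auto simp: possible_edges_def card_2_iff)
  have "valid n (add_mset e H)" if "in_tree H x \<or> in_tree H y"
    using that valid_add_edge[OF vH, of x y] valid_add_edge[OF vH, of y x] H(2) e by (auto simp: insert_commute)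
  moreover have "(\<forall>v\<in>e. in_tree H v) \<or> \<not> (\<forall>v\<in>e. in_unicycle H v) \<Longrightarrow> in_tree H x \<or> in_tree H y"
    using e valid_not_in_tree[OF vH] by blast
  ultimately show ?case using set_add_edge_step[OF H(3)] vH by blast
qed

lemma size_law: "G \<in> set_pmf (law m) \<Longrightarrow> size G \<le> m"
proof (induction m arbitrary: G)
  case (Suc m)
  then obtain H e where H: "H \<in> set_pmf (law m)" "G \<in> set_pmf (add_edge_step p H e)"
    by (auto simp: set_bind_pmf set_pmf_of_set edges_nonempty)
  then show ?case using set_add_edge_step[OF H(2)] Suc.IH[OF H(1)] by auto
qed simp

declare frozen_graph.simps(2) [simp del]

lemma E_mono:
  assumes "\<And>G. valid n G \<Longrightarrow> f G \<le> g G" shows "E m f \<le> E m g"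
  unfolding E_sum by (intro sum_mono mult_left_mono) (use assms valid_law in auto)

lemma E_cong:
  assumes "\<And>G. valid n G \<Longrightarrow> f G = g G" shows "E m f = E m g"
  unfolding E_sum by (intro sum.cong) (use assms valid_law in auto)

lemma E_nonneg: "(\<And>G. valid n G \<Longrightarrow> 0 \<le> f G) \<Longrightarrow> 0 \<le> E m f"
  using E_mono[of "\<lambda>_. 0" f m] by simp

lemma accept_valid:
  assumes "valid n G"
  shows "accept G e = (if \<forall>v\<in>e. in_tree G v then 1 else if \<forall>v\<in>e. \<not> in_tree G v then 0 else p)"
  by (simp add: accept_def valid_not_in_tree[OF assms, symmetric])

subsection \<open>Removing a forest from the graph\<close>

lemma status_union:
  assumes "\<And>e. e \<in># A \<Longrightarrow> e \<subseteq> V" "\<And>e. e \<in># B \<Longrightarrow> e \<inter> V = {}" "loopless A" "loopless B"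
  shows "v \<in> V \<Longrightarrow> in_tree (A + B) v = in_tree A v"
    "v \<notin> V \<Longrightarrow> in_tree (A + B) v = in_tree B v"
    "v \<in> V \<Longrightarrow> in_unicycle (A + B) v = in_unicycle A v"
    "v \<notin> V \<Longrightarrow> in_unicycle (A + B) v = in_unicycle B v"
proof -
  have 2: "v \<in> - V \<Longrightarrow> component (A + B) v = component B v \<and>
     num_edges (A + B) (component B v) = num_edges B (component B v)"
    using component_union_disjoint[of v "- V" B A] assms by blast
  have 1: "v \<in> V \<Longrightarrow> component (A + B) v = component A v \<and>
     num_edges (A + B) (component A v) = num_edges A (component A v)"
    using component_union_disjoint[of v V A B] assms by blast
  show "v \<in> V \<Longrightarrow> in_tree (A + B) v = in_tree A v"
    "v \<notin> V \<Longrightarrow> in_tree (A + B) v = in_tree B v"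
    "v \<in> V \<Longrightarrow> in_unicycle (A + B) v = in_unicycle A v"
    "v \<notin> V \<Longrightarrow> in_unicycle (A + B) v = in_unicycle B v"
    using 1 2 by (simp_all add: is_tree_def is_unicycle_def)
qed

text \<open>Vertices of \<open>V\<close> lie in trees of both graphs, of \<open>A + H\<close>
  because \<open>A\<close> is a forest and of \<open>H\<close> because they are isolated there.
  Every endpoint therefore has the same status in both.\<close>

lemma accept_forest_union:
  assumes "forest A" "\<And>e. e \<in># A \<Longrightarrow> e \<subseteq> V" "\<And>e. e \<in># H \<Longrightarrow> e \<inter> V = {}" "loopless H"
  shows "accept (A + H) e = accept H e"
proof -
  have lA: "loopless A" using assms(1) by (simp add: forest_def)
  note st = status_union[OF assms(2,3) lA assms(4)]
  have iso: "in_tree H v" if "v \<in> V" for v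
  proof -
    have "num_edges H {v} = 0"
      using assms(3,4) that unfolding num_edges_def loopless_def
      by (auto simp: filter_mset_eq_conv) (metis Int_absorb1 card.empty card_insert_le card_mono disjoint_insert(2) finite.emptyI finite_insert inf_bot_left insert_Diff le_iff_inf nat.simps(3) numeral_2_eq_2 subset_singletonD)
    then show ?thesis using component_untouched[OF assms(3) that] by (simp add: is_tree_def)
  qed
  have T: "in_tree (A + H) v = in_tree H v" for v
    using st iso assms(1) by (cases "v \<in> V") (auto simp: forest_def)
  have U: "in_unicycle (A + H) v = in_unicycle H v" for v
    using st(4) T iso not_tree_and_unicycle by (cases "v \<in> V") blast+
  show ?thesis by (simp add: accept_def T U)
qed

text \<open>The binomial factor counts the assignments of the edges of \<open>A\<close> to steps; all of them contribute
  the same.\<close>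

lemma pmf_forest_union:
  assumes "forest A" "\<And>e. e \<in># A \<Longrightarrow> e \<subseteq> V" "V \<subseteq> {1..n}"
    and "\<And>e. e \<in># H \<Longrightarrow> e \<inter> V = {}" "loopless H"
  shows "pmf (law m) (A + H) =
    real (m choose size A) * fact (size A) / N ^ size A * pmf (law (m - size A)) H"
  using assms
proof (induction m arbitrary: A H)
  case 0
  then show ?case by (cases "A = {#}") (auto simp: nonempty_has_size)
next
  case (Suc m)
  define b where "b = size A"
  have ne: "e \<noteq> {}" if "e \<in># A + H" for e
    using that Suc.prems(1,5) by (auto simp: forest_def loopless_def)
  have disj: "e \<notin># H" if "e \<in># A" for e
    using that Suc.prems(2)[of e] Suc.prems(4)[of e] ne[of e] by auto
  have A_edges: "set_mset A \<subseteq> edges"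
    using Suc.prems(1-3) by (auto simp: possible_edges_def forest_def loopless_def)
  let ?w = "\<lambda>m b. real (m choose b) * fact b / N ^ b"
  let ?R = "\<lambda>m H e. (if e \<in># H then pmf (law m) (H - {#e#}) * accept (H - {#e#}) e else 0)
     + pmf (law m) H * (1 - accept H e)"
  have summand: "(if e \<in># A + H then pmf (law m) (A + H - {#e#}) * accept (A + H - {#e#}) e else 0)
     + pmf (law m) (A + H) * (1 - accept (A + H) e) =
     (if e \<in># A then ?w m (b - 1) * pmf (law (m - (b - 1))) H else 0) + ?w m b * ?R (m - b) H e"
     if "e \<in> edges" for e
  proof -
    have acc: "accept (A + H) e = accept H e" by (rule accept_forest_union[OF Suc.prems(1,2,4,5)])
    have p: "pmf (law m) (A + H) = ?w m b * pmf (law (m - b)) H"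
      using Suc.IH[OF Suc.prems] by (simp add: b_def)
    consider "e \<in># A" | "e \<notin># A" "e \<in># H" | "e \<notin># A" "e \<notin># H" by auto
    then show ?thesis
    proof cases
      case 1
      \<comment> \<open>A last edge taken from \<open>A\<close>: before its insertion both endpoints
        lie in trees of \<open>A' + H\<close>, so acceptance is certain.\<close>
      define A' where "A' = A - {#e#}"
      have A: "A = add_mset e A'" using 1 by (simp add: A'_def)
      have f: "forest A'" using Suc.prems(1) A forest_remove_edge by auto
      have 2: "A + H - {#e#} = A' + H" by (simp add: A)
      have "accept (A' + H) e = 1"
      proof -
        have "in_tree (A' + H) v" if "v \<in> e" for v
          using status_union(1)[of A' V H v] that f Suc.prems A by (auto simp: forest_def)
        then show ?thesis by (simp add: accept_def)
      qed
      moreover have "pmf (law m) (A' + H) = ?w m (b - 1) * pmf (law (m - (b - 1))) H"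
        using Suc.IH[OF f _ Suc.prems(3-5)] Suc.prems(2) by (simp add: A b_def)
      ultimately show ?thesis using 1 disj[OF 1] by (simp add: 2 p acc)
    next
      case 2
      have "A + H - {#e#} = A + (H - {#e#})" using 2 by simp
      moreover have "accept (A + (H - {#e#})) e = accept (H - {#e#}) e"
        by (rule accept_forest_union[OF Suc.prems(1,2)])
          (use Suc.prems(4,5) in \<open>auto dest: in_diffD simp: loopless_def\<close>)
      moreover have "pmf (law m) (A + (H - {#e#})) = ?w m b * pmf (law (m - b)) (H - {#e#})"
        unfolding b_def by (rule Suc.IH[OF Suc.prems(1-3)])
          (use Suc.prems(4,5) in \<open>auto dest: in_diffD simp: loopless_def\<close>)
      ultimately show ?thesis using 2
        by (simp add: p acc algebra_simps add_divide_distrib diff_divide_distrib)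
    next
      case 3
      then show ?thesis by (simp add: p acc)
    qed
  qed
  have "pmf (law (Suc m)) (A + H) = (\<Sum>e\<in>edges.
     (if e \<in># A then ?w m (b - 1) * pmf (law (m - (b - 1))) H else 0) + ?w m b * ?R (m - b) H e) / N"
    unfolding pmf_Suc by (subst sum.cong[OF refl summand]) auto
  also have "(\<Sum>e\<in>edges.
     (if e \<in># A then ?w m (b - 1) * pmf (law (m - (b - 1))) H else 0) + ?w m b * ?R (m - b) H e) =
     (\<Sum>e\<in>edges. if e \<in># A then ?w m (b - 1) * pmf (law (m - (b - 1))) H else 0)
     + ?w m b * (\<Sum>e\<in>edges. ?R (m - b) H e)"
    by (subst sum.distrib) (simp only: sum_distrib_left)
  also have "(\<Sum>e\<in>edges. if e \<in># A then ?w m (b - 1) * pmf (law (m - (b - 1))) H else 0) =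
     (\<Sum>e\<in>set_mset A. ?w m (b - 1) * pmf (law (m - (b - 1))) H)"
    using A_edges by (intro sum.mono_neutral_cong_right) auto
  also have "((\<Sum>e\<in>set_mset A. ?w m (b - 1) * pmf (law (m - (b - 1))) H)
      + ?w m b * (\<Sum>e\<in>edges. ?R (m - b) H e)) / N = real b * ?w m (b - 1) / N * pmf (law (m - (b - 1))) H + ?w m b * pmf (law (Suc (m - b))) H"
    by (simp add: pmf_Suc forest_card_edges[OF Suc.prems(1), folded b_def] add_divide_distrib)
  \<comment> \<open>Pascal's rule for \<open>m choose b\<close>. The times
    \<open>m - (b - 1)\<close> and \<open>Suc (m - b)\<close> agree only for positive
    \<open>b \<le> m\<close>; if \<open>b > m\<close>, the second coefficient is zero.\<close>
  also have "\<dots> = ?w (Suc m) b * pmf (law (Suc m - b)) H"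
  proof (cases b)
    case 0
    then show ?thesis by simp
  next
    case (Suc c)
    have 1: "real b * ?w m (b - 1) / N = real (m choose c) * fact b / N ^ b"
      using Suc N_pos by (simp add: mult_ac)
    show ?thesis
    proof (cases "b \<le> m")
      case True
      then have e: "m - (b - 1) = Suc m - b" "Suc (m - b) = Suc m - b" using Suc by auto
      show ?thesis unfolding e 1 using Suc by (simp add: algebra_simps add_divide_distrib)
    next
      case False
      have z: "m choose b = 0" "m choose Suc c = 0" using False Suc by simp_all
      have e: "m - (b - 1) = Suc m - b" using Suc by auto
      show ?thesis unfolding e 1 unfolding Suc binomial_Suc_Suc z(2) by simp
    qed
  qed
  finally show ?case by (simp add: b_def)
qed

end

section \<open>Cayley's formula\<close>

definition forests :: "nat set \<Rightarrow> nat \<Rightarrow> multigraph set" where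
  "forests V j = {A. forest A \<and> (\<forall>e\<in>#A. e \<subseteq> V) \<and> size A = j}"

definition spanning_trees :: "nat set \<Rightarrow> multigraph set" where
  "spanning_trees V = {A. forest A \<and> (\<forall>e\<in>#A. e \<subseteq> V) \<and> (\<forall>v\<in>V. component A v = V)}"

definition comps :: "nat set \<Rightarrow> multigraph \<Rightarrow> nat set set" where
  "comps V A = component A ` V"

text \<open>The number of ways to choose a root in each component. Counting rooted rather than plain
  forests makes the edge-by-edge recursion close, as in Pitman's proof of Cayley's formula.\<close>

definition weight :: "nat set \<Rightarrow> multigraph \<Rightarrow> real" where
  "weight V A = (\<Prod>C\<in>comps V A. real (card C))"

lemma finite_forests:
  assumes "finite V" shows "finite (forests V j)"
proof (rule finite_subset)
  show "forests V j \<subseteq> multisets_of_size (Pow V) j"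
    by (auto simp: forests_def multisets_of_size_def)
  show "finite (multisets_of_size (Pow V) j)"
    using assms by (intro finite_multisets_of_size) auto
qed

lemma comps_add_edge:
  assumes "x \<in> V" "y \<in> V" "y \<notin> component A x"
  shows "comps V (add_mset {x, y} A) =
    insert (component A x \<union> component A y) (comps V A - {component A x, component A y})"
proof -
  have eq: "component (add_mset {x, y} A) v = (if component A v = component A x \<or> component A v = component A y
     then component A x \<union> component A y else component A v)" for v
    by (metis component_add_edge UnE UnI1 UnI2 component_memD component_refl)
  show ?thesis using assms unfolding comps_def eq by (auto simp: image_iff)
qed

lemma comp_Un_notin:
  assumes "y \<notin> component A x" shows "component A x \<union> component A y \<notin> comps V A"
proof
  assume "component A x \<union> component A y \<in> comps V A"
  then obtain v where v: "component A x \<union> component A y = component A v" by (auto simp: comps_def)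
  then have "x \<in> component A v" "y \<in> component A v" by auto
  then show False using assms by (metis component_memD component_refl)
qed

lemma card_comps:
  assumes "finite V" "forest A" "\<And>e. e \<in># A \<Longrightarrow> e \<subseteq> V"
  shows "card (comps V A) + size A = card V"
  using assms(2,3)
proof (induction A)
  case empty
  then show ?case by (simp add: comps_def card_image)
next
  case (add e A)
  have "card e = 2" using add.prems(1) by (simp add: forest_def)
  then obtain x y where e: "e = {x, y}" "x \<noteq> y" by (meson card_2_iff)
  have f: "forest A" "y \<notin> component A x" using add.prems(1) e by (auto simp: forest_add_edge_iff)
  have V: "x \<in> V" "y \<in> V" using add.prems(2)[of e] e by auto
  have fin: "finite (comps V A)" using assms(1) by (simp add: comps_def)
  have ne: "component A x \<noteq> component A y" using f(2) by auto
  have sub: "{component A x, component A y} \<subseteq> comps V A" using V by (auto simp: comps_def)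
  have "card {component A x, component A y} \<le> card (comps V A)" by (rule card_mono[OF fin sub])
  then have "2 \<le> card (comps V A)" using ne by simp
  moreover have "card (comps V A - {component A x, component A y}) = card (comps V A) - 2"
    using card_Diff_subset[OF _ sub] ne by simp
  moreover have "card (comps V (add_mset e A)) = Suc (card (comps V A - {component A x, component A y}))"
    unfolding e comps_add_edge[OF V f(2)]
    using fin comp_Un_notin[OF f(2)] by (subst card_insert_disjoint) simp_all
  ultimately have "card (comps V (add_mset e A)) + 1 = card (comps V A)" by linarith
  moreover have "card (comps V A) + size A = card V"
    using add.IH[OF f(1)] add.prems(2) by simp
  ultimately show ?case by simp
qed

text \<open>Joining parts of sizes \<open>a\<close> and \<open>b\<close> replaces the factor
  \<open>a * b\<close> by \<open>a + b\<close>. The additive form lets the two endpoints of the edge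
  contribute separately.\<close>

lemma weight_add_edge:
  assumes "finite V" "x \<in> V" "y \<in> V" "forest A" "y \<notin> component A x"
  shows "weight V (add_mset {x, y} A) = weight V A * (1 / card (component A x) + 1 / card (component A y))"
proof -
  let ?X = "component A x" and ?Y = "component A y"
  have l: "loopless A" using assms(4) by (simp add: forest_def)
  have fin: "finite (comps V A)" using assms(1) by (simp add: comps_def)
  have ne: "?X \<noteq> ?Y" using assms(5) by auto
  have sub: "{?X, ?Y} \<subseteq> comps V A" using assms by (auto simp: comps_def)
  have pos: "card ?X > 0" "card ?Y > 0" using finite_component[OF l] by (auto simp: card_gt_0_iff)
  have "weight V A = (\<Prod>C\<in>comps V A - {?X, ?Y}. real (card C)) * (\<Prod>C\<in>{?X, ?Y}. real (card C))"
    unfolding weight_def by (rule prod.subset_diff[OF sub fin])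
  also have "(\<Prod>C\<in>{?X, ?Y}. real (card C)) = real (card ?X) * card ?Y" using ne by simp
  finally have w: "weight V A = (\<Prod>C\<in>comps V A - {?X, ?Y}. real (card C)) * (real (card ?X) * card ?Y)" .
  have "weight V (add_mset {x, y} A) = real (card (?X \<union> ?Y)) * (\<Prod>C\<in>comps V A - {?X, ?Y}. real (card C))"
    unfolding weight_def comps_add_edge[OF assms(2,3,5)]
    using fin comp_Un_notin[OF assms(5)] by (subst prod.insert) auto
  also have "card (?X \<union> ?Y) = card ?X + card ?Y"
    using add_edge_join(3)[OF l assms(5), of x] by simp
  finally show ?thesis using w pos by (simp add: field_simps)
qed

lemma sum_inverse_card_comps:
  assumes "finite V" "forest A" "\<And>e. e \<in># A \<Longrightarrow> e \<subseteq> V"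
  shows "(\<Sum>y\<in>V. 1 / real (card (component A y))) = real (card (comps V A))"
proof -
  have l: "loopless A" using assms(2) by (simp add: forest_def)
  have sub: "component A v \<subseteq> V" if "v \<in> V" for v
    by (rule component_least) (use that assms(3) in auto)
  have "(\<Sum>y\<in>V. 1 / real (card (component A y))) = (\<Sum>C\<in>comps V A. \<Sum>y\<in>{y\<in>V. component A y = C}. 1 / real (card (component A y)))"
    unfolding comps_def by (rule sum.image_gen[OF assms(1)])
  also have "\<dots> = (\<Sum>C\<in>comps V A. 1)"
  proof (rule sum.cong)
    fix C assume "C \<in> comps V A"
    then obtain v where v: "v \<in> V" "C = component A v" by (auto simp: comps_def)
    have "{y\<in>V. component A y = C} = C" using sub[OF v(1)] v(2) by (auto simp: component_eq_iff component_memD)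
    moreover have "card C > 0" using finite_component[OF l] v by (auto simp: card_gt_0_iff)
    moreover have "(\<Sum>y\<in>{y\<in>V. component A y = C}. 1 / real (card (component A y))) =
       (\<Sum>y\<in>{y\<in>V. component A y = C}. 1 / real (card C))" by (rule sum.cong) auto
    ultimately show "(\<Sum>y\<in>{y\<in>V. component A y = C}. 1 / real (card (component A y))) = 1" by simp
  qed auto
  finally show ?thesis by simp
qed

text \<open>Sums over edges are evaluated vertex by vertex through this identity, here for rooted
  forests and later for drifts.\<close>

lemma sum_unordered_pairs:
  fixes f :: "'a \<Rightarrow> 'a \<Rightarrow> real"
  assumes "finite V"
  shows "(\<Sum>e | e \<subseteq> V \<and> card e = 2. \<Sum>x\<in>e. \<Sum>y\<in>e - {x}. f x y) = (\<Sum>x\<in>V. \<Sum>y\<in>V - {x}. f x y)"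
proof -
  let ?P = "{e. e \<subseteq> V \<and> card e = 2}"
  have finP: "finite ?P" using assms by simp
  have fin: "finite e" if "e \<in> ?P" for e using that assms by (auto dest: finite_subset)
  have "(\<Sum>e\<in>?P. \<Sum>x\<in>e. \<Sum>y\<in>e - {x}. f x y) =
    (\<Sum>e\<in>?P. \<Sum>(x, y)\<in>(SIGMA x:e. e - {x}). f x y)"
    by (intro sum.cong refl sum.Sigma) (use fin in blast)+
  also have "\<dots> = (\<Sum>(e, x, y)\<in>(SIGMA e:?P. SIGMA x:e. e - {x}). f x y)"
    by (rule sum.Sigma[OF finP]) (use fin in blast)
  also have "\<dots> = (\<Sum>(x, y)\<in>(SIGMA x:V. V - {x}). f x y)"
  proof (rule sum.reindex_bij_witness[of _ "\<lambda>(x, y). ({x, y}, x, y)" "\<lambda>(e, x, y). (x, y)"])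
    fix a assume "a \<in> (SIGMA e:?P. SIGMA x:e. e - {x})"
    then obtain e x y where a: "a = (e, x, y)" "e \<subseteq> V" "card e = 2" "x \<in> e" "y \<in> e" "y \<noteq> x"
      by (cases a) auto
    have "{x, y} = e" using a by (intro card_subset_eq card_ge_0_finite) auto
    then show "(case case a of (e, x, y) \<Rightarrow> (x, y) of (x, y) \<Rightarrow> ({x, y}, x, y)) = a"
      and "(case a of (e, x, y) \<Rightarrow> (x, y)) \<in> (SIGMA x:V. V - {x})"
      and "(case case a of (e, x, y) \<Rightarrow> (x, y) of (x, y) \<Rightarrow> f x y) = (case a of (e, x, y) \<Rightarrow> f x y)"
      using a by auto
  next
    fix b assume "b \<in> (SIGMA x:V. V - {x})"
    then obtain x y where b: "b = (x, y)" "x \<in> V" "y \<in> V" "y \<noteq> x" by (cases b) auto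
    then have "card {x, y} = 2" by simp
    with b show "(case b of (x, y) \<Rightarrow> ({x, y}, x, y)) \<in> (SIGMA e:?P. SIGMA x:e. e - {x})"
      and "(case case b of (x, y) \<Rightarrow> ({x, y}, x, y) of (e, x, y) \<Rightarrow> (x, y)) = b"
      by auto
  qed
  also have "\<dots> = (\<Sum>x\<in>V. \<Sum>y\<in>V - {x}. f x y)"
    using assms by (intro sum.Sigma[symmetric]) auto
  finally show ?thesis .
qed

text \<open>Over ordered pairs, a vertex \<open>y\<close> contributes
  \<open>1 / card (component A y)\<close> once for each \<open>x\<close> outside of its component.
  The reciprocals of the component sizes add up to the number of components,
  \<open>card V - j\<close>, so the total depends on \<open>A\<close> through its weight
  only.\<close>

lemma weight_extensions:
  assumes "finite V" "A \<in> forests V j"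
  shows "(\<Sum>e | e \<subseteq> V \<and> card e = 2 \<and> forest (add_mset e A). weight V (add_mset e A)) =
     weight V A * real (card V) * (real (card V) - real j - 1)"
proof -
  have A: "forest A" "\<And>e. e \<in># A \<Longrightarrow> e \<subseteq> V" "size A = j" using assms(2) by (auto simp: forests_def)
  have l: "loopless A" using A by (simp add: forest_def)
  have sub: "component A v \<subseteq> V" if "v \<in> V" for v
    by (rule component_least) (use that A in auto)
  let ?f = "\<lambda>x y. if y \<in> component A x then 0 else weight V A / real (card (component A y))"
  have "(\<Sum>e | e \<subseteq> V \<and> card e = 2 \<and> forest (add_mset e A). weight V (add_mset e A)) =
    (\<Sum>e | e \<subseteq> V \<and> card e = 2. if forest (add_mset e A) then weight V (add_mset e A) else 0)"
    using assms(1) by (subst sum.inter_filter[symmetric]) (auto intro!: sum.cong)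
  also have "\<dots> = (\<Sum>e | e \<subseteq> V \<and> card e = 2. \<Sum>x\<in>e. \<Sum>y\<in>e - {x}. ?f x y)"
  proof (rule sum.cong)
    fix e assume "e \<in> {e. e \<subseteq> V \<and> card e = 2}"
    then obtain x y where e: "e = {x, y}" "x \<noteq> y" "x \<in> V" "y \<in> V" by (auto simp: card_2_iff)
    have d: "{x, y} - {x} = {y}" "{x, y} - {y} = {x}" using e by auto
    show "(if forest (add_mset e A) then weight V (add_mset e A) else 0) = (\<Sum>x\<in>e. \<Sum>y\<in>e - {x}. ?f x y)"
      using e A(1) weight_add_edge[OF assms(1) e(3,4) A(1)] component_sym[of x A y]
      by (auto simp: forest_add_edge_iff d algebra_simps)
  qed simp
  also have "\<dots> = (\<Sum>x\<in>V. \<Sum>y\<in>V - {x}. ?f x y)" by (rule sum_unordered_pairs[OF assms(1)])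
  also have "\<dots> = (\<Sum>x\<in>V. \<Sum>y\<in>V. ?f x y)"
    using assms(1) by (intro sum.cong sum.mono_neutral_left) auto
  also have "\<dots> = (\<Sum>y\<in>V. \<Sum>x\<in>V. ?f x y)" by (rule sum.swap)
  also have "\<dots> = (\<Sum>y\<in>V. weight V A * (real (card V) * (1 / card (component A y)) - 1))"
  proof (rule sum.cong)
    fix y assume y: "y \<in> V"
    have fc: "finite (component A y)" by (rule finite_component[OF l])
    have pos: "card (component A y) > 0" using fc by (auto simp: card_gt_0_iff)
    have "(\<Sum>x\<in>V. ?f x y) = (\<Sum>x\<in>V - component A y. weight V A / real (card (component A y)))"
      using assms(1) by (intro sum.mono_neutral_cong_right) (auto simp: component_sym)
    also have "\<dots> = (real (card V) - card (component A y)) * (weight V A / real (card (component A y)))"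
      using sub[OF y] fc assms(1) by (simp add: card_Diff_subset of_nat_diff card_mono)
    finally show "(\<Sum>x\<in>V. ?f x y) = weight V A * (real (card V) * (1 / card (component A y)) - 1)"
      using pos by (simp add: field_simps)
  qed simp
  also have "\<dots> = weight V A * (real (card V) * (\<Sum>y\<in>V. 1 / card (component A y)) - card V)"
    by (simp only: sum_distrib_left[symmetric] sum_subtractf) simp
  also have "(\<Sum>y\<in>V. 1 / real (card (component A y))) = real (card V) - j"
    using sum_inverse_card_comps[OF assms(1) A(1,2)] card_comps[OF assms(1) A(1,2)] A(3) by simp
  finally show ?thesis by (simp add: algebra_simps)
qed

text \<open>Double counting of pairs of a forest with \<open>j + 1\<close> edges and one of its
  edges. The edges of a forest are distinct, so each forest occurs \<open>Suc j\<close>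
  times.\<close>

lemma sum_weight_Suc:
  assumes "finite V"
  shows "real (Suc j) * (\<Sum>A\<in>forests V (Suc j). weight V A) =
     real (card V) * (real (card V) - real j - 1) * (\<Sum>A\<in>forests V j. weight V A)"
proof -
  let ?P = "\<lambda>A. {e. e \<subseteq> V \<and> card e = 2 \<and> forest (add_mset e A)}"
  have finP: "finite (?P A)" for A using assms by simp
  have rem: "A - {#e#} \<in> forests V j" "e \<subseteq> V" "card e = 2" if A: "A \<in> forests V (Suc j)" "e \<in># A" for A e
  proof -
    have "forest (add_mset e (A - {#e#}))" using A by (simp add: forests_def)
    then have "forest (A - {#e#})" "card e = 2" using forest_remove_edge by (auto simp: forest_def)
    then show "A - {#e#} \<in> forests V j" "e \<subseteq> V" "card e = 2"
      using A by (auto simp: forests_def size_Diff_singleton dest: in_diffD)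
  qed
  have ext: "add_mset e A \<in> forests V (Suc j)" if "A \<in> forests V j" "e \<in> ?P A" for A e
    using that by (auto simp: forests_def)
  have "real (Suc j) * (\<Sum>A\<in>forests V (Suc j). weight V A) =
     (\<Sum>A\<in>forests V (Suc j). \<Sum>e\<in>set_mset A. weight V A)"
    unfolding sum_distrib_left by (rule sum.cong) (auto simp: forests_def forest_card_edges)
  also have "\<dots> = (\<Sum>(A, e)\<in>(SIGMA A:forests V (Suc j). set_mset A). weight V A)"
    using assms by (intro sum.Sigma) (auto simp: finite_forests)
  also have "\<dots> = (\<Sum>(A, e)\<in>(SIGMA A:forests V j. ?P A). weight V (add_mset e A))"
  proof (rule sum.reindex_bij_witness[of _ "\<lambda>(A, e). (add_mset e A, e)" "\<lambda>(A, e). (A - {#e#}, e)"])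
    fix a assume "a \<in> (SIGMA A:forests V (Suc j). set_mset A)"
    then obtain A e where a: "a = (A, e)" "A \<in> forests V (Suc j)" "e \<in># A" by (cases a) auto
    show "(case a of (A, e) \<Rightarrow> (A - {#e#}, e)) \<in> (SIGMA A:forests V j. ?P A)"
      using rem[OF a(2,3)] a by (auto simp: forests_def)
    show "(case case a of (A, e) \<Rightarrow> (A - {#e#}, e) of (A, e) \<Rightarrow> (add_mset e A, e)) = a"
      and "(case case a of (A, e) \<Rightarrow> (A - {#e#}, e) of (A, e) \<Rightarrow> weight V (add_mset e A)) = (case a of (A, e) \<Rightarrow> weight V A)"
      using a by simp_all
  next
    fix b assume "b \<in> (SIGMA A:forests V j. ?P A)"
    then obtain A e where b: "b = (A, e)" "A \<in> forests V j" "e \<in> ?P A" by (cases b) auto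
    show "(case b of (A, e) \<Rightarrow> (add_mset e A, e)) \<in> (SIGMA A:forests V (Suc j). set_mset A)"
      using ext[OF b(2,3)] b by simp
    show "(case case b of (A, e) \<Rightarrow> (add_mset e A, e) of (A, e) \<Rightarrow> (A - {#e#}, e)) = b"
      using b by simp
  qed
  also have "\<dots> = (\<Sum>A\<in>forests V j. \<Sum>e\<in>?P A. weight V (add_mset e A))"
    using assms finP by (intro sum.Sigma[symmetric]) (auto simp: finite_forests)
  also have "\<dots> = (\<Sum>A\<in>forests V j. weight V A * real (card V) * (real (card V) - real j - 1))"
    by (rule sum.cong) (simp_all add: weight_extensions[OF assms])
  also have "\<dots> = real (card V) * (real (card V) - real j - 1) * (\<Sum>A\<in>forests V j. weight V A)"
    unfolding sum_distrib_left by (rule sum.cong) (simp_all add: mult_ac)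
  finally show ?thesis .
qed

lemma sum_weight:
  assumes "finite V" "V \<noteq> {}"
  shows "(\<Sum>A\<in>forests V j. weight V A) = real (card V) ^ j * real ((card V - 1) choose j)"
proof (induction j)
  case 0
  have "forests V 0 = {{#}}" by (auto simp: forests_def)
  moreover have "weight V {#} = 1" unfolding weight_def comps_def by (auto intro!: prod.neutral)
  ultimately show ?case by simp
next
  case (Suc j)
  have k: "card V \<ge> 1" using assms by (simp add: Suc_leI card_gt_0_iff)
  have key: "real (Suc j) * real ((card V - 1) choose Suc j) = (real (card V) - real j - 1) * real ((card V - 1) choose j)"
  proof (cases "j \<le> card V - 1")
    case True
    have "Suc j * ((card V - 1) choose Suc j) = (card V - 1 - j) * ((card V - 1) choose j)"
      by (metis binomial_absorb_comp binomial_absorption mult.commute)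
    then have "real (Suc j) * real ((card V - 1) choose Suc j) = real (card V - 1 - j) * real ((card V - 1) choose j)"
      by (metis of_nat_mult)
    then show ?thesis using True k by (simp add: of_nat_diff)
  next
    case False
    then have z: "(card V - 1) choose Suc j = 0" "(card V - 1) choose j = 0" by auto
    show ?thesis unfolding z by simp
  qed
  have "real (Suc j) * (\<Sum>A\<in>forests V (Suc j). weight V A) =
     real (card V) ^ Suc j * ((real (card V) - real j - 1) * real ((card V - 1) choose j))"
    unfolding sum_weight_Suc[OF assms(1)] Suc by (simp add: mult_ac)
  also have "\<dots> = real (Suc j) * (real (card V) ^ Suc j * real ((card V - 1) choose Suc j))"
    unfolding key[symmetric] by (simp only: mult_ac)
  finally show ?case by (metis mult_left_cancel of_nat_neq_0)
qed

text \<open>A forest with \<open>j\<close> edges on \<open>V\<close> has \<open>card V - j\<close>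
  components, so connectedness is a matter of size alone.\<close>

lemma spanning_trees_eq:
  assumes "finite V" "V \<noteq> {}"
  shows "spanning_trees V = forests V (card V - 1)"
proof -
  have k: "card V \<ge> 1" using assms by (simp add: Suc_leI card_gt_0_iff)
  have "(\<forall>v\<in>V. component A v = V) \<longleftrightarrow> size A = card V - 1" if A: "forest A" "\<forall>e\<in>#A. e \<subseteq> V" for A
  proof -
    have c: "card (comps V A) + size A = card V" using card_comps[OF assms(1) A(1)] A(2) by blast
    have "(\<forall>v\<in>V. component A v = V) \<longleftrightarrow> comps V A = {V}" using assms(2) by (auto simp: comps_def)
    also have "\<dots> \<longleftrightarrow> card (comps V A) = 1"
    proof
      assume "card (comps V A) = 1"
      then obtain C where C: "comps V A = {C}" by (meson card_1_singletonE)
      have "V \<subseteq> C" using C by (auto simp: comps_def)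
      moreover have "C \<subseteq> V"
      proof -
        obtain v where v: "v \<in> V" using assms by auto
        then have "C = component A v" using C by (auto simp: comps_def)
        moreover have "component A v \<subseteq> V" by (rule component_least) (use A v in auto)
        ultimately show ?thesis by simp
      qed
      ultimately show "comps V A = {V}" using C by simp
    qed simp
    also have "\<dots> \<longleftrightarrow> size A = card V - 1" using c k by linarith
    finally show ?thesis .
  qed
  then show ?thesis by (auto simp: spanning_trees_def forests_def)
qed

theorem Cayley:
  assumes "finite V" "V \<noteq> {}"
  shows "real (card (spanning_trees V)) * real (card V) = real (card V) ^ (card V - 1)"
proof -
  have "weight V A = real (card V)" if "A \<in> spanning_trees V" for A
  proof -
    have "comps V A = {V}" using that assms by (auto simp: spanning_trees_def comps_def)
    then show ?thesis by (simp add: weight_def)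
  qed
  then have "(\<Sum>A\<in>spanning_trees V. weight V A) = real (card (spanning_trees V)) * real (card V)" by simp
  then show ?thesis using sum_weight[OF assms, of "card V - 1"] by (simp add: spanning_trees_eq[OF assms])
qed

section \<open>Marking a tree component\<close>

text \<open>This is \<open>k ^ (k - 2)\<close>, written as a quotient to avoid the truncated
  exponent at \<open>k = 1\<close>.\<close>

definition tree_number :: "nat \<Rightarrow> real" where
  "tree_number k = real k ^ (k - 1) / real k"

lemma card_spanning_trees:
  assumes "finite V" "card V = k" "k \<ge> 1" shows "real (card (spanning_trees V)) = tree_number k"
proof -
  have "V \<noteq> {}" using assms by auto
  from Cayley[OF assms(1) this] show ?thesis using assms by (simp add: tree_number_def field_simps)
qed

lemma num_edges_singleton:
  assumes "loopless G" shows "num_edges G {v} = 0"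
proof -
  have "\<not> e \<subseteq> {v}" if "e \<in># G" for e
    using that assms card_mono[of "{v}" e] by (auto simp: loopless_def)
  then have "filter_mset (\<lambda>e. e \<subseteq> {v}) G = {#}" by (simp add: filter_mset_eq_conv)
  then show ?thesis by (simp add: num_edges_def)
qed

lemma in_tree_isolated: "loopless G \<Longrightarrow> component G v = {v} \<Longrightarrow> in_tree G v"
  by (simp add: is_tree_def num_edges_singleton)

lemma edges_avoid_isolated:
  assumes "loopless H" "component H v = {v}" "e \<in># H" shows "v \<notin> e"
proof
  assume "v \<in> e"
  have c: "card e = 2" using assms by (auto simp: loopless_def)
  have "e \<subseteq> {v}" using edge_subset_component[OF assms(3) c, of v] \<open>v \<in> e\<close> assms(2) by auto
  then show False using c card_mono[of "{v}" e] by simp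
qed

definition edges_in :: "nat set \<Rightarrow> multigraph \<Rightarrow> multigraph" where
  "edges_in C G = filter_mset (\<lambda>e. e \<subseteq> C) G"

definition edges_off :: "nat set \<Rightarrow> multigraph \<Rightarrow> multigraph" where
  "edges_off C G = filter_mset (\<lambda>e. \<not> e \<subseteq> C) G"

lemma in_plus_off: "edges_in C G + edges_off C G = G"
  by (simp add: edges_in_def edges_off_def)

lemma edges_off_avoid:
  assumes "loopless G" "e \<in># edges_off (component G v) G" shows "e \<inter> component G v = {}"
  using assms edge_subset_component[of e G v] by (auto simp: edges_off_def loopless_def)

lemma loopless_edges_in_off: "loopless G \<Longrightarrow> loopless (edges_in C G)" "loopless G \<Longrightarrow> loopless (edges_off C G)"
  by (auto simp: loopless_def edges_in_def edges_off_def)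

lemma edges_in_spanning_tree:
  assumes "loopless G" "in_tree G v"
  shows "edges_in (component G v) G \<in> spanning_trees (component G v)"
proof -
  let ?C = "component G v" and ?A = "edges_in (component G v) G" and ?B = "edges_off (component G v) G"
  have A: "e \<subseteq> ?C" if "e \<in># ?A" for e using that by (simp add: edges_in_def)
  have lA: "loopless ?A" and lB: "loopless ?B" using assms(1) by (simp_all add: loopless_edges_in_off)
  have c: "component ?A w = ?C" "num_edges ?A ?C = num_edges G ?C" if "w \<in> ?C" for w
  proof -
    have "component G w = component ?A w" "num_edges G (component ?A w) = num_edges ?A (component ?A w)"
      using component_union_disjoint[OF that, of ?A ?B] A edges_off_avoid[OF assms(1)] lB
      unfolding in_plus_off by auto
    then show "component ?A w = ?C" "num_edges ?A ?C = num_edges G ?C"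
      using component_memD[OF that] by simp_all
  qed
  have "in_tree ?A w" for w
  proof (cases "w \<in> ?C")
    case True
    then show ?thesis using c assms(2) by (simp add: is_tree_def)
  next
    case False
    then have "component ?A w = {w}" using A by (intro component_untouched[of _ "- ?C"]) auto
    then show ?thesis by (rule in_tree_isolated[OF lA])
  qed
  then show ?thesis using lA A c by (auto simp: spanning_trees_def forest_def)
qed

lemma spanning_treesD:
  assumes "A \<in> spanning_trees C"
  shows "forest A" "loopless A" "\<And>e. e \<in># A \<Longrightarrow> e \<subseteq> C" "\<And>v. v \<in> C \<Longrightarrow> component A v = C"
  using assms by (auto simp: spanning_trees_def forest_def)

context frozen_process
begin

definition isolated :: "multigraph \<Rightarrow> nat set" where
  "isolated G = {v \<in> {1..n}. component G v = {v}}"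

definition ktrees :: "nat \<Rightarrow> multigraph \<Rightarrow> nat set set" where
  "ktrees k G = {C \<in> components n G. is_tree G C \<and> card C = k}"

lemma finite_ktrees [simp]: "finite (ktrees k G)" and finite_isolated [simp]: "finite (isolated G)"
  by (simp_all add: ktrees_def components_def isolated_def)

lemma tree_count_eq: "tree_count n k G = card (ktrees k G)"
  by (simp add: tree_count_def ktrees_def)

text \<open>A finite superset of the support, described without the dynamics: bijections between
  states can be checked without deciding which states have positive probability.\<close>

definition graphs :: "nat \<Rightarrow> multigraph set" where
  "graphs m = {G. set_mset G \<subseteq> edges \<and> size G \<le> m}"

lemma finite_graphs: "finite (graphs m)"
proof -
  have "graphs m = (\<Union>j\<le>m. multisets_of_size edges j)" by (auto simp: graphs_def multisets_of_size_def)
  then show ?thesis by (simp add: finite_multisets_of_size)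
qed

lemma law_graphs: "set_pmf (law m) \<subseteq> graphs m"
  using valid_law size_law by (auto simp: graphs_def valid_def)

lemma graphs_loopless: "G \<in> graphs m \<Longrightarrow> loopless G"
  by (auto simp: graphs_def loopless_def possible_edges_def)

lemma ktreesE:
  assumes "C \<in> ktrees k G"
  obtains v where "v \<in> {1..n}" "C = component G v" "in_tree G v" "card C = k"
  using assms by (auto simp: ktrees_def components_def)

lemma edges_off_facts:
  assumes "G \<in> graphs m" "C \<in> ktrees k G"
  shows "edges_off C G \<in> graphs (m - (k - 1))" "C \<subseteq> isolated (edges_off C G)" "edges_in C G \<in> spanning_trees C"
    "k - 1 \<le> m"
proof -
  from assms(2) obtain v where v: "v \<in> {1..n}" "C = component G v" "in_tree G v" "card C = k" by (rule ktreesE)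
  have l: "loopless G" using assms(1) by (rule graphs_loopless)
  show "edges_in C G \<in> spanning_trees C" unfolding v(2) by (rule edges_in_spanning_tree[OF l v(3)])
  have "size (edges_in C G) = k - 1"
    using v(2-4) by (simp add: is_tree_def num_edges_def edges_in_def)
  moreover have "size (edges_in C G) + size (edges_off C G) = size G" by (metis in_plus_off size_union)
  ultimately show "edges_off C G \<in> graphs (m - (k - 1))" "k - 1 \<le> m"
    using assms(1) by (auto simp: graphs_def edges_off_def)
  have "C \<subseteq> {1..n}" unfolding v(2) using assms(1) v(1) by (intro component_subset_range) (auto simp: graphs_def)
  moreover have "component (edges_off C G) w = {w}" if "w \<in> C" for w
    using component_untouched[of "edges_off C G" C w] edges_off_avoid[OF l] that unfolding v(2) by blast
  ultimately show "C \<subseteq> isolated (edges_off C G)" by (auto simp: isolated_def)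
qed

lemma plant_tree_facts:
  assumes "H \<in> graphs (m - (k - 1))" "C \<subseteq> isolated H" "card C = k" "k \<ge> 1" "A \<in> spanning_trees C" "k - 1 \<le> m"
  shows "A + H \<in> graphs m" "C \<in> ktrees k (A + H)" "edges_off C (A + H) = H" "edges_in C (A + H) = A"
    "pmf (law m) (A + H) = real (m choose (k - 1)) * fact (k - 1) / N ^ (k - 1) * pmf (law (m - (k - 1))) H"
proof -
  note A = spanning_treesD[OF assms(5)]
  have lH: "loopless H" using assms(1) by (rule graphs_loopless)
  have Cn: "C \<subseteq> {1..n}" using assms(2) by (auto simp: isolated_def)
  have finC: "finite C" "C \<noteq> {}" using assms(3,4) by (auto intro: card_ge_0_finite)
  have sA: "size A = k - 1" using assms(5) spanning_trees_eq[OF finC] assms(3) by (simp add: forests_def)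
  have HC: "e \<inter> C = {}" if "e \<in># H" for e
    using edges_avoid_isolated[OF lH _ that] assms(2) by (auto simp: isolated_def)
  show "A + H \<in> graphs m"
  proof -
    have "e \<in> edges" if "e \<in># A" for e
      using A(2) A(3)[OF that] Cn that by (auto simp: possible_edges_def loopless_def)
    then show ?thesis using assms(1,6) sA by (auto simp: graphs_def)
  qed
  obtain v where v: "v \<in> C" using finC by auto
  have c: "component (A + H) v = C" "num_edges (A + H) C = num_edges A C"
    using component_union_disjoint[OF v, of A H] A(3,4) HC lH v by auto
  have "is_tree A C" using A(1) A(4)[OF v] by (metis forest_def)
  then have "is_tree (A + H) C" using c by (simp add: is_tree_def)
  then show "C \<in> ktrees k (A + H)" using v c Cn assms(3) by (auto simp: ktrees_def components_def)
  have "\<not> e \<subseteq> C" if "e \<in># H" for e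
  proof
    assume "e \<subseteq> C"
    then have "e = {}" using HC[OF that] by auto
    then show False using that lH by (auto simp: loopless_def)
  qed
  then show "edges_off C (A + H) = H" "edges_in C (A + H) = A"
  proof -
    assume n: "\<And>e. e \<in># H \<Longrightarrow> \<not> e \<subseteq> C"
    have "filter_mset (\<lambda>e. \<not> e \<subseteq> C) H = H" "filter_mset (\<lambda>e. e \<subseteq> C) H = {#}"
      "filter_mset (\<lambda>e. \<not> e \<subseteq> C) A = {#}" "filter_mset (\<lambda>e. e \<subseteq> C) A = A"
      using n A(3) by (auto simp: filter_mset_eq_conv)
    then show "edges_off C (A + H) = H" "edges_in C (A + H) = A"
      by (simp_all add: edges_off_def edges_in_def)
  qed
  show "pmf (law m) (A + H) = real (m choose (k - 1)) * fact (k - 1) / N ^ (k - 1) * pmf (law (m - (k - 1))) H"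
    using pmf_forest_union[OF A(1) A(3) Cn HC lH, of m] by (simp add: sA)
qed

text \<open>Assignments of the \<open>k - 1\<close> edges of a tree to steps, the probability that
  these steps select them, and the number of trees on \<open>k\<close> given vertices.\<close>

definition mark_rate :: "nat \<Rightarrow> nat \<Rightarrow> real" where
  "mark_rate k m = real (m choose (k - 1)) * fact (k - 1) / N ^ (k - 1) * tree_number k"

text \<open>Cutting out a tree is a bijection: \<open>(G, C)\<close> corresponds to
  \<open>(H, C, A)\<close> with \<open>H\<close> the rest, \<open>C\<close> a set of
  \<open>k\<close> isolated vertices of \<open>H\<close> and \<open>A\<close> a tree on
  \<open>C\<close>. The two probabilities differ by a factor that depends on none of
  \<open>H\<close>, \<open>C\<close>, \<open>A\<close>, so the sum over \<open>A\<close> gives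
  \<open>tree_number k\<close> and the sum over \<open>C\<close> the binomial coefficient.\<close>

lemma E_mark_tree:
  assumes "k \<ge> 1"
  shows "E m (\<lambda>G. \<Sum>C\<in>ktrees k G. \<Psi> (edges_off C G)) =
    mark_rate k m * E (m - (k - 1)) (\<lambda>H. real (card (isolated H) choose k) * \<Psi> H)"
proof (cases "k - 1 \<le> m")
  case False
  \<comment> \<open>With fewer than \<open>k - 1\<close> steps there is no such tree, and
    \<open>mark_rate\<close> vanishes through its binomial coefficient.\<close>
  have "ktrees k G = {}" if "G \<in> graphs m" for G using edges_off_facts(4)[OF that] False by auto
  then have "E m (\<lambda>G. \<Sum>C\<in>ktrees k G. \<Psi> (edges_off C G)) = 0"
    by (subst E_sum_superset[OF finite_graphs law_graphs]) simp
  then show ?thesis using False by (simp add: mark_rate_def)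
next
  case True
  let ?b = "k - 1"
  let ?S = "\<lambda>H. {C. C \<subseteq> isolated H \<and> card C = k}"
  let ?w = "real (m choose ?b) * fact ?b / N ^ ?b"
  have finS: "finite (?S H)" for H by simp
  have finT: "finite (spanning_trees C)" if "C \<in> ?S H" for C H
  proof -
    have "finite C" "C \<noteq> {}" using that assms by (auto intro: card_ge_0_finite)
    then show ?thesis by (simp add: spanning_trees_eq finite_forests)
  qed
  have "E m (\<lambda>G. \<Sum>C\<in>ktrees k G. \<Psi> (edges_off C G)) =
     (\<Sum>G\<in>graphs m. \<Sum>C\<in>ktrees k G. pmf (law m) G * \<Psi> (edges_off C G))"
    by (subst E_sum_superset[OF finite_graphs law_graphs]) (simp add: sum_distrib_left)
  also have "\<dots> = (\<Sum>(G, C)\<in>(SIGMA G:graphs m. ktrees k G). pmf (law m) G * \<Psi> (edges_off C G))"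
    by (rule sum.Sigma) (auto simp: finite_graphs)
  also have "\<dots> = (\<Sum>(H, C, A)\<in>(SIGMA H:graphs (m - ?b). SIGMA C:?S H. spanning_trees C).
      ?w * pmf (law (m - ?b)) H * \<Psi> H)"
  proof (rule sum.reindex_bij_witness[of _ "\<lambda>(H, C, A). (A + H, C)" "\<lambda>(G, C). (edges_off C G, C, edges_in C G)"])
    fix a assume "a \<in> (SIGMA G:graphs m. ktrees k G)"
    then obtain G C where a: "a = (G, C)" "G \<in> graphs m" "C \<in> ktrees k G" by (cases a) auto
    note o = edges_off_facts[OF a(2,3)]
    have "card C = k" using a(3) by (simp add: ktrees_def)
    note pl = plant_tree_facts[OF o(1,2) this assms o(3,4)]
    show "(case case a of (G, C) \<Rightarrow> (edges_off C G, C, edges_in C G) of (H, C, A) \<Rightarrow> (A + H, C)) = a"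
      by (simp add: a in_plus_off)
    show "(case a of (G, C) \<Rightarrow> (edges_off C G, C, edges_in C G)) \<in> (SIGMA H:graphs (m - ?b). SIGMA C:?S H. spanning_trees C)"
      using o \<open>card C = k\<close> by (simp add: a)
    show "(case case a of (G, C) \<Rightarrow> (edges_off C G, C, edges_in C G) of (H, C, A) \<Rightarrow> ?w * pmf (law (m - ?b)) H * \<Psi> H) =
       (case a of (G, C) \<Rightarrow> pmf (law m) G * \<Psi> (edges_off C G))"
      using pl(5) by (simp add: a in_plus_off)
  next
    fix b assume "b \<in> (SIGMA H:graphs (m - ?b). SIGMA C:?S H. spanning_trees C)"
    then obtain H C A where b: "b = (H, C, A)" "H \<in> graphs (m - ?b)" "C \<subseteq> isolated H" "card C = k" "A \<in> spanning_trees C"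
      by (cases b) auto
    note pl = plant_tree_facts[OF b(2,3,4) assms b(5) True]
    show "(case case b of (H, C, A) \<Rightarrow> (A + H, C) of (G, C) \<Rightarrow> (edges_off C G, C, edges_in C G)) = b"
      using pl by (simp add: b)
    show "(case b of (H, C, A) \<Rightarrow> (A + H, C)) \<in> (SIGMA G:graphs m. ktrees k G)"
      using pl by (simp add: b)
  qed
  also have "\<dots> = (\<Sum>H\<in>graphs (m - ?b). \<Sum>(C, A)\<in>(SIGMA C:?S H. spanning_trees C). ?w * pmf (law (m - ?b)) H * \<Psi> H)"
    by (rule sum.Sigma[symmetric]) (use finS finT finite_graphs in blast)+
  also have "\<dots> = (\<Sum>H\<in>graphs (m - ?b). \<Sum>C\<in>?S H. \<Sum>A\<in>spanning_trees C. ?w * pmf (law (m - ?b)) H * \<Psi> H)"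
    by (intro sum.cong refl sum.Sigma[symmetric]) (use finS finT in blast)+
  also have "\<dots> = (\<Sum>H\<in>graphs (m - ?b). mark_rate k m * (pmf (law (m - ?b)) H * (real (card (isolated H) choose k) * \<Psi> H)))"
  proof (rule sum.cong)
    fix H assume "H \<in> graphs (m - ?b)"
    have T: "real (card (spanning_trees C)) = tree_number k" if "C \<in> ?S H" for C
      using that assms by (intro card_spanning_trees) (auto intro: finite_subset)
    have "(\<Sum>C\<in>?S H. \<Sum>A\<in>spanning_trees C. ?w * pmf (law (m - ?b)) H * \<Psi> H) =
       (\<Sum>C\<in>?S H. tree_number k * (?w * pmf (law (m - ?b)) H * \<Psi> H))"
      by (rule sum.cong) (auto simp: T)
    also have "\<dots> = real (card (isolated H) choose k) * (tree_number k * (?w * pmf (law (m - ?b)) H * \<Psi> H))"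
      by (simp add: n_subsets)
    finally show "(\<Sum>C\<in>?S H. \<Sum>A\<in>spanning_trees C. ?w * pmf (law (m - ?b)) H * \<Psi> H) =
       mark_rate k m * (pmf (law (m - ?b)) H * (real (card (isolated H) choose k) * \<Psi> H))"
      by (simp add: mark_rate_def)
  qed simp
  finally show ?thesis
    by (simp add: E_sum_superset[OF finite_graphs law_graphs] sum_distrib_left)
qed

text \<open>The bound \<open>k \<ge> 2\<close> separates the trees that are counted from the
  isolated vertices: the vertices released by the cut were not isolated before, and they form no new
  trees of size \<open>k\<close>.\<close>

lemma ktrees_isolated_edges_off:
  assumes "G \<in> graphs m" "C \<in> ktrees k G" "k \<ge> 2"
  shows "ktrees k (edges_off C G) = ktrees k G - {C}" "isolated (edges_off C G) = isolated G \<union> C"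
    "isolated G \<inter> C = {}"
proof -
  from assms(2) obtain v where v: "v \<in> {1..n}" "C = component G v" "in_tree G v" "card C = k" by (rule ktreesE)
  have l: "loopless G" using assms(1) by (rule graphs_loopless)
  have Cn: "C \<subseteq> {1..n}" using edges_off_facts(2)[OF assms(1,2)] by (auto simp: isolated_def)
  have in_C: "component (edges_off C G) w = {w}" if "w \<in> C" for w
    using edges_off_facts(2)[OF assms(1,2)] that by (auto simp: isolated_def)
  have out_C: "component (edges_off C G) w = component G w \<and>
     num_edges (edges_off C G) (component G w) = num_edges G (component G w)" if "w \<notin> C" for w
  proof -
    have "w \<in> - C" using that by simp
    note cu = component_union_disjoint[OF this, of "edges_off C G" "edges_in C G"]
    have a: "\<And>e. e \<in># edges_off C G \<Longrightarrow> e \<subseteq> - C" using edges_off_avoid[OF l] v(2) by blast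
    have b: "\<And>e. e \<in># edges_in C G \<Longrightarrow> e \<inter> - C = {}" by (auto simp: edges_in_def)
    have lo: "loopless (edges_in C G)" using l by (simp add: loopless_edges_in_off)
    show ?thesis using cu(2,5)[OF a b lo] by (simp add: in_plus_off)
  qed
  have CG: "component G w = C" if "w \<in> C" for w using that v(2) component_memD by auto
  have notC: "component G w \<noteq> C" if "w \<notin> C" for w using that by auto
  show "isolated G \<inter> C = {}"
    using CG assms(3) v(4) by (auto simp: isolated_def)
  show "isolated (edges_off C G) = isolated G \<union> C"
  proof (intro set_eqI)
    fix w
    show "w \<in> isolated (edges_off C G) \<longleftrightarrow> w \<in> isolated G \<union> C"
    proof (cases "w \<in> C")
      case True
      then show ?thesis using in_C Cn by (auto simp: isolated_def)
    next
      case False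
      then show ?thesis using out_C by (simp add: isolated_def)
    qed
  qed
  show "ktrees k (edges_off C G) = ktrees k G - {C}"
  proof (intro equalityI subsetI)
    fix D assume "D \<in> ktrees k (edges_off C G)"
    then obtain w where w: "w \<in> {1..n}" "D = component (edges_off C G) w" "in_tree (edges_off C G) w" "card D = k"
      by (rule ktreesE)
    have "w \<notin> C" using in_C w assms(3) by auto
    then show "D \<in> ktrees k G - {C}" using w out_C notC by (auto simp: ktrees_def components_def is_tree_def)
  next
    fix D assume D: "D \<in> ktrees k G - {C}"
    then have "D \<in> ktrees k G" by simp
    then obtain w where w: "w \<in> {1..n}" "D = component G w" "in_tree G w" "card D = k" by (rule ktreesE)
    have "w \<notin> C" using D w CG by auto
    then show "D \<in> ktrees k (edges_off C G)" using w out_C[of w]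
      by (auto simp: ktrees_def components_def is_tree_def intro!: image_eqI[of _ _ w])
  qed
qed

abbreviation niso :: "multigraph \<Rightarrow> nat" where "niso G \<equiv> card (isolated G)"

text \<open>One of the \<open>Suc r\<close> selected trees is marked and cut out. This leaves
  \<open>r\<close> of them, and the released vertices join the \<open>l\<close> chosen ones in a set
  of \<open>k + l\<close> isolated vertices, which can be split again in
  \<open>(k + l) choose k\<close> ways.\<close>

lemma E_choose_Suc:
  assumes "k \<ge> 2"
  shows "real (Suc r) * E m (\<lambda>G. real (tree_count n k G choose Suc r) * real (niso G choose l)) =
    mark_rate k m * real ((k + l) choose k) *
      E (m - (k - 1)) (\<lambda>G. real (tree_count n k G choose r) * real (niso G choose (k + l)))"
proof -
  \<comment> \<open>Subtracting \<open>k\<close> undoes the gain from the cut: the vertices of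
    \<open>C\<close> are isolated in \<open>edges_off C G\<close> but not in
    \<open>G\<close>.\<close>
  let ?\<Psi> = "\<lambda>H. real (tree_count n k H choose r) * real ((niso H - k) choose l)"
  have "(\<Sum>C\<in>ktrees k G. ?\<Psi> (edges_off C G)) =
     real (Suc r) * (real (tree_count n k G choose Suc r) * real (niso G choose l))"
    if G: "G \<in> graphs m" for G
  proof -
    have "?\<Psi> (edges_off C G) = real ((tree_count n k G - 1) choose r) * real (niso G choose l)" if C: "C \<in> ktrees k G" for C
    proof -
      have "finite C" "card C = k" using C assms by (auto simp: ktrees_def intro: card_ge_0_finite)
      then show ?thesis using ktrees_isolated_edges_off[OF G C assms] C
        by (simp add: tree_count_eq card_Un_disjoint)
    qed
    then have "(\<Sum>C\<in>ktrees k G. ?\<Psi> (edges_off C G)) =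
       real (tree_count n k G) * (real ((tree_count n k G - 1) choose r) * real (niso G choose l))"
      by (simp add: tree_count_eq)
    also have "real (tree_count n k G) * real ((tree_count n k G - 1) choose r) = real (Suc r) * real (tree_count n k G choose Suc r)"
      using binomial_absorption[of r "tree_count n k G"] by (metis of_nat_mult)
    then have "real (tree_count n k G) * (real ((tree_count n k G - 1) choose r) * real (niso G choose l)) =
       real (Suc r) * (real (tree_count n k G choose Suc r) * real (niso G choose l))"
      by (simp only: mult.assoc[symmetric])
    finally show ?thesis .
  qed
  then have "real (Suc r) * E m (\<lambda>G. real (tree_count n k G choose Suc r) * real (niso G choose l)) =
     E m (\<lambda>G. \<Sum>C\<in>ktrees k G. ?\<Psi> (edges_off C G))"
    by (simp add: E_sum_superset[OF finite_graphs law_graphs] sum_distrib_left mult_ac)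
  also have "\<dots> = mark_rate k m * E (m - (k - 1)) (\<lambda>H. real (niso H choose k) * ?\<Psi> H)"
    using assms by (intro E_mark_tree) simp
  also have "(\<lambda>H. real (niso H choose k) * ?\<Psi> H) =
    (\<lambda>H. real ((k + l) choose k) * (real (tree_count n k H choose r) * real (niso H choose (k + l))))"
  proof
    fix H
    have "(niso H choose k) * ((niso H - k) choose l) = ((k + l) choose k) * (niso H choose (k + l))"
    proof (cases "k + l \<le> niso H")
      case True
      then show ?thesis using choose_mult[of k "k + l" "niso H"] by (simp add: mult.commute)
    next
      case False
      then have "(niso H choose k) * ((niso H - k) choose l) = 0" "niso H choose (k + l) = 0"
        by (cases "niso H < k"; simp)+
      then show ?thesis by (metis mult_0_right)
    qed
    then have "real (niso H choose k) * real ((niso H - k) choose l) = real ((k + l) choose k) * real (niso H choose (k + l))"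
      by (metis of_nat_mult)
    then show "real (niso H choose k) * ?\<Psi> H =
      real ((k + l) choose k) * (real (tree_count n k H choose r) * real (niso H choose (k + l)))"
      by (simp add: mult_ac)
  qed
  finally show ?thesis by (simp add: E_cmult)
qed

text \<open>Each cut goes back \<open>k - 1\<close> steps, hence the shifted times in the product,
  and the constants accumulate to a multinomial coefficient over \<open>fact r\<close>. The
  parameter \<open>l\<close> carries the induction; with \<open>r = 1\<close> and
  \<open>l = k\<close> it also supplies the mixed moment for the variance bound.\<close>

lemma E_choose_tree_count:
  assumes "k \<ge> 2"
  shows "E m (\<lambda>G. real (tree_count n k G choose r) * real (niso G choose l)) =
    (\<Prod>j<r. mark_rate k (m - j * (k - 1))) * (fact (r * k + l) / (fact l * fact k ^ r * fact r)) *
      E (m - r * (k - 1)) (\<lambda>G. real (niso G choose (r * k + l)))"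
proof (induction r arbitrary: m l)
  case 0
  then show ?case by simp
next
  case (Suc r)
  have b: "real ((k + l) choose k) = fact (k + l) / (fact k * fact l)"
    using binomial_fact[of k "k + l", where 'a = real] by simp
  have e: "m - (k - 1) - j * (k - 1) = m - Suc j * (k - 1)" for j by simp
  have "E m (\<lambda>G. real (tree_count n k G choose Suc r) * real (niso G choose l)) =
    mark_rate k m * real ((k + l) choose k) *
      E (m - (k - 1)) (\<lambda>G. real (tree_count n k G choose r) * real (niso G choose (k + l))) / real (Suc r)"
    using E_choose_Suc[OF assms, of r m l] by (simp add: field_simps del: of_nat_Suc)
  also have "E (m - (k - 1)) (\<lambda>G. real (tree_count n k G choose r) * real (niso G choose (k + l))) =
    (\<Prod>j<r. mark_rate k (m - Suc j * (k - 1))) * (fact (r * k + (k + l)) / (fact (k + l) * fact k ^ r * fact r)) *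
      E (m - Suc r * (k - 1)) (\<lambda>G. real (niso G choose (r * k + (k + l))))"
    unfolding Suc e ..
  also have "r * k + (k + l) = Suc r * k + l" by simp
  also have "mark_rate k m * real ((k + l) choose k) *
     ((\<Prod>j<r. mark_rate k (m - Suc j * (k - 1))) * (fact (Suc r * k + l) / (fact (k + l) * fact k ^ r * fact r)) *
      E (m - Suc r * (k - 1)) (\<lambda>G. real (niso G choose (Suc r * k + l)))) / real (Suc r) =
     (mark_rate k m * (\<Prod>j<r. mark_rate k (m - Suc j * (k - 1)))) * (fact (Suc r * k + l) / (fact l * fact k ^ Suc r * fact (Suc r))) *
      E (m - Suc r * (k - 1)) (\<lambda>G. real (niso G choose (Suc r * k + l)))"
    unfolding b by (simp add: field_simps del: of_nat_Suc)
  also have "mark_rate k m * (\<Prod>j<r. mark_rate k (m - Suc j * (k - 1))) = (\<Prod>j<Suc r. mark_rate k (m - j * (k - 1)))"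
    by (simp add: prod.lessThan_Suc_shift del: prod.lessThan_Suc)
  finally show ?case .
qed

end

section \<open>Drifts\<close>

context frozen_process
begin

definition unfrozen :: "multigraph \<Rightarrow> nat set" where
  "unfrozen G = {v \<in> {1..n}. in_tree G v}"

abbreviation nunf :: "multigraph \<Rightarrow> nat" where "nunf G \<equiv> card (unfrozen G)"

lemma finite_unfrozen [simp]: "finite (unfrozen G)"
  by (simp add: unfrozen_def)

lemma nunf_le: "nunf G \<le> n"
proof -
  have "unfrozen G \<subseteq> {1..n}" by (auto simp: unfrozen_def)
  then show ?thesis using card_mono[of "{1..n}" "unfrozen G"] by simp
qed

lemma isolated_subset_unfrozen: "valid n G \<Longrightarrow> isolated G \<subseteq> unfrozen G"
  using in_tree_isolated valid_loopless by (auto simp: isolated_def unfrozen_def)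

lemma niso_le_nunf: "valid n G \<Longrightarrow> niso G \<le> nunf G"
  by (simp add: card_mono isolated_subset_unfrozen)

lemma edgesE:
  assumes "e \<in> edges" obtains x y where "e = {x, y}" "x \<noteq> y" "x \<in> {1..n}" "y \<in> {1..n}"
  using assms that by (auto simp: possible_edges_def card_2_iff)

lemma accept_pair:
  assumes "valid n G" "x \<in> {1..n}" "y \<in> {1..n}"
  shows "accept G {x, y} = (if x \<in> unfrozen G \<and> y \<in> unfrozen G then 1
     else if x \<notin> unfrozen G \<and> y \<notin> unfrozen G then 0 else p)"
  using assms(2,3) by (auto simp: accept_valid[OF assms(1)] unfrozen_def)

text \<open>Total acceptance probability of the edges meeting a set of \<open>w\<close> unfrozen
  vertices when \<open>u\<close> are unfrozen in all. The edges with both ends unfrozen number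
  \<open>w * (u - w) + w * (w - 1) / 2\<close>, which is the first part of the formula; each edge to
  a frozen vertex counts \<open>p\<close>.\<close>

definition hit_weight :: "nat \<Rightarrow> nat \<Rightarrow> real" where
  "hit_weight w u = real w * real u - real w * (real w + 1) / 2 + p * real w * (real n - real u)"

lemma sum_accept_hitting:
  assumes "valid n G" "W \<subseteq> unfrozen G"
  shows "(\<Sum>e\<in>edges. accept G e * of_bool (e \<inter> W \<noteq> {})) = hit_weight (card W) (nunf G)"
proof -
  let ?U = "unfrozen G"
  \<comment> \<open>An edge with both ends in \<open>W\<close> is met from either end, so each end
    carries one half.\<close>
  let ?f = "\<lambda>x y. if x \<in> W then (if y \<in> W then 1/2 else if y \<in> ?U then 1 else p) else 0"
  have Un: "?U \<subseteq> {1..n}" by (auto simp: unfrozen_def)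
  have finW: "finite W" by (rule finite_subset[OF assms(2)]) simp
  have "(\<Sum>e\<in>edges. accept G e * of_bool (e \<inter> W \<noteq> {})) = (\<Sum>e\<in>edges. \<Sum>x\<in>e. \<Sum>y\<in>e - {x}. ?f x y)"
  proof (rule sum.cong)
    fix e assume "e \<in> edges"
    then obtain x y where e: "e = {x, y}" "x \<noteq> y" "x \<in> {1..n}" "y \<in> {1..n}" by (rule edgesE)
    have d: "{x, y} - {x} = {y}" "{x, y} - {y} = {x}" using e by auto
    have "(\<Sum>x\<in>e. \<Sum>y\<in>e - {x}. ?f x y) = ?f x y + ?f y x" using e(1,2) by (simp add: d)
    moreover have "accept G e * of_bool (e \<inter> W \<noteq> {}) = ?f x y + ?f y x"
      using accept_pair[OF assms(1) e(3,4)] assms(2) unfolding e(1) by auto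
    ultimately show "accept G e * of_bool (e \<inter> W \<noteq> {}) = (\<Sum>x\<in>e. \<Sum>y\<in>e - {x}. ?f x y)" by simp
  qed simp
  also have "\<dots> = (\<Sum>x\<in>{1..n}. \<Sum>y\<in>{1..n} - {x}. ?f x y)"
    unfolding possible_edges_def by (rule sum_unordered_pairs) simp
  also have "\<dots> = (\<Sum>x\<in>W. \<Sum>y\<in>{1..n} - {x}. ?f x y)"
    using assms(2) Un by (intro sum.mono_neutral_right) auto
  also have "\<dots> = (\<Sum>x\<in>W. real (nunf G) - (real (card W) + 1) / 2 + p * (real n - real (nunf G)))"
  proof (rule sum.cong)
    fix x assume x: "x \<in> W"
    have split: "{1..n} - {x} = (W - {x}) \<union> (?U - W) \<union> ({1..n} - ?U)" using x assms(2) Un by auto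
    have "(\<Sum>y\<in>{1..n} - {x}. ?f x y) = (\<Sum>y\<in>W - {x}. ?f x y) + (\<Sum>y\<in>?U - W. ?f x y) + (\<Sum>y\<in>{1..n} - ?U. ?f x y)"
      unfolding split using finW assms(2) by (subst sum.union_disjoint, auto)+
    also have "(\<Sum>y\<in>W - {x}. ?f x y) = (\<Sum>y\<in>W - {x}. 1/2)" using x by (intro sum.cong) auto
    also have "(\<Sum>y\<in>?U - W. ?f x y) = (\<Sum>y\<in>?U - W. 1)" using x by (intro sum.cong) auto
    also have "(\<Sum>y\<in>{1..n} - ?U. ?f x y) = (\<Sum>y\<in>{1..n} - ?U. p)"
      using x assms(2) by (intro sum.cong) auto
    also have "(\<Sum>y\<in>W - {x}. 1/2) = (real (card W) - 1) / (2::real)"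
    proof -
      have "card W \<ge> 1" using x finW by (auto simp: Suc_le_eq card_gt_0_iff)
      then show ?thesis using x finW by (simp add: of_nat_diff)
    qed
    also have "(\<Sum>y\<in>?U - W. (1::real)) = real (nunf G) - real (card W)"
      using assms(2) finW by (simp add: card_Diff_subset of_nat_diff card_mono)
    also have "(\<Sum>y\<in>{1..n} - ?U. p) = p * (real n - real (nunf G))"
      using Un nunf_le[of G] by (simp add: card_Diff_subset of_nat_diff)
    finally show "(\<Sum>y\<in>{1..n} - {x}. ?f x y) =
       real (nunf G) - (real (card W) + 1) / 2 + p * (real n - real (nunf G))" by (simp add: field_simps)
  qed simp
  also have "\<dots> = hit_weight (card W) (nunf G)"
    by (simp add: hit_weight_def field_simps)
  finally show ?thesis .
qed

lemma isolated_add_edge: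
  assumes "x \<noteq> y" shows "isolated (add_mset {x, y} G) = isolated G - {x, y}"
proof (rule set_eqI)
  fix v
  consider "v \<in> {x, y}" | "v \<notin> {x, y}" "v \<in> component G x \<union> component G y"
    | "v \<notin> component G x" "v \<notin> component G y" by auto
  then show "v \<in> isolated (add_mset {x, y} G) \<longleftrightarrow> v \<in> isolated G - {x, y}"
  proof cases
    case 1
    then have "v \<in> component G x \<union> component G y" by blast
    then have "component (add_mset {x, y} G) v = component G x \<union> component G y"
      using component_add_edge[of x y G v] by presburger
    then have "x \<in> component (add_mset {x, y} G) v" "y \<in> component (add_mset {x, y} G) v" by simp_all
    then have "component (add_mset {x, y} G) v \<noteq> {v}" using assms by (metis singletonD)
    then show ?thesis using 1 by (auto simp: isolated_def)
  next
    case 2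
    then have "component (add_mset {x, y} G) v = component G x \<union> component G y"
      using component_add_edge[of x y G v] by presburger
    then have "x \<in> component (add_mset {x, y} G) v" by simp
    then have "component (add_mset {x, y} G) v \<noteq> {v}" using 2(1) by (metis insertCI singletonD)
    moreover have "x \<in> component G v \<or> y \<in> component G v" using 2(2) component_sym by blast
    then have "component G v \<noteq> {v}" using 2(1) by (metis insertCI singletonD)
    ultimately show ?thesis by (auto simp: isolated_def)
  next
    case 3
    then have "v \<notin> {x, y}" by auto
    then show ?thesis using add_edge_other(1)[OF 3] by (auto simp: isolated_def)
  qed
qed

lemma unfrozen_component:
  "valid n G \<Longrightarrow> v \<in> unfrozen G \<Longrightarrow> w \<in> component G v \<Longrightarrow> w \<in> unfrozen G"
  using component_subset_range[of G n v] in_tree_cong(1)[of w G v] by (auto simp: unfrozen_def valid_def)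

lemma unfrozen_add_edge_aux:
  assumes "valid n G" "x \<in> unfrozen G"
  shows "unfrozen (add_mset {x, y} G) \<subseteq> unfrozen G"
    and "y \<notin> unfrozen G \<Longrightarrow> y \<in> {1..n} \<Longrightarrow> x \<notin> unfrozen (add_mset {x, y} G)"
proof -
  have l: "loopless G" using assms(1) by (rule valid_loopless)
  have Tx: "in_tree G x" using assms(2) by (simp add: unfrozen_def)
  have froz: "v \<in> component G x \<union> component G y \<Longrightarrow> \<not> in_tree (add_mset {x, y} G) v" if "\<not> in_tree G y" for v
  proof -
    assume v: "v \<in> component G x \<union> component G y"
    have y: "y \<notin> component G x" using that Tx in_tree_cong(1)[of y G x] by auto
    have "in_unicycle G y" using that valid_not_in_tree[OF assms(1), of y] by simp
    then have "in_unicycle (add_mset {x, y} G) v" by (rule in_tree_add_edge_join(2)[OF l y v Tx])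
    then show "\<not> in_tree (add_mset {x, y} G) v" using not_tree_and_unicycle by metis
  qed
  show "unfrozen (add_mset {x, y} G) \<subseteq> unfrozen G"
  proof
    fix v assume v: "v \<in> unfrozen (add_mset {x, y} G)"
    show "v \<in> unfrozen G"
    proof (cases "v \<in> component G x \<union> component G y")
      case True
      then have "in_tree G y" using froz v by (auto simp: unfrozen_def)
      then have "in_tree G v" using True Tx in_tree_cong(1)[of v G x] in_tree_cong(1)[of v G y] by auto
      then show ?thesis using v by (simp add: unfrozen_def)
    next
      case False
      then show ?thesis using v in_tree_add_edge_other(1)[of v G x y] by (auto simp: unfrozen_def)
    qed
  qed
  show "x \<notin> unfrozen (add_mset {x, y} G)" if "y \<notin> unfrozen G" "y \<in> {1..n}"
    using froz[of x] that by (auto simp: unfrozen_def)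
qed

lemma accept_nonzeroE:
  assumes "valid n G" "e \<in> edges" "accept G e \<noteq> 0"
  obtains x y where "e = {x, y}" "x \<noteq> y" "x \<in> {1..n}" "y \<in> {1..n}" "x \<in> unfrozen G"
proof -
  obtain x y where e: "e = {x, y}" "x \<noteq> y" "x \<in> {1..n}" "y \<in> {1..n}" using assms(2) by (rule edgesE)
  show ?thesis
  proof (cases "x \<in> unfrozen G")
    case True
    then show ?thesis using that e by blast
  next
    case False
    then have "y \<in> unfrozen G" using assms(3) accept_pair[OF assms(1) e(3,4)] e(1) by metis
    then show ?thesis using that[of y x] e by (auto simp: insert_commute)
  qed
qed

lemma unfrozen_add_edge:
  assumes "valid n G" "e \<in> edges" "accept G e \<noteq> 0"
  shows "unfrozen (add_mset e G) \<subseteq> unfrozen G"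
  using accept_nonzeroE[OF assms] unfrozen_add_edge_aux(1)[OF assms(1)] by metis

lemma gen_le:
  assumes "valid n G" "\<And>e. e \<in> edges \<Longrightarrow> accept G e \<noteq> 0 \<Longrightarrow> \<Phi> (add_mset e G) - \<Phi> G \<le> g e"
  shows "gen \<Phi> G \<le> (\<Sum>e\<in>edges. accept G e * g e)"
  unfolding gen_def
proof (rule sum_mono)
  fix e assume "e \<in> edges"
  then show "accept G e * (\<Phi> (add_mset e G) - \<Phi> G) \<le> accept G e * g e"
    using assms(2)[of e] accept_nonneg[of G e] by (cases "accept G e = 0") (auto intro: mult_left_mono)
qed

lemma gen_nunf_le: "valid n G \<Longrightarrow> gen (\<lambda>G. real (nunf G)) G \<le> 0"
  using gen_le[of G "\<lambda>G. real (nunf G)" "\<lambda>_. 0"] unfrozen_add_edge by (simp add: card_mono)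

lemma choose_isolated:
  "real (niso G choose l) = (\<Sum>S | S \<subseteq> isolated G \<and> card S = l. 1)"
  by (simp add: n_subsets)

lemma choose_isolated_add_edge:
  assumes "e \<in> edges"
  shows "real (niso (add_mset e G) choose l) = (\<Sum>S | S \<subseteq> isolated G \<and> card S = l. of_bool (e \<inter> S = {}))"
proof -
  obtain x y where e: "e = {x, y}" "x \<noteq> y" using assms by (rule edgesE)
  have "{S. S \<subseteq> isolated (add_mset e G) \<and> card S = l} = {S \<in> {S. S \<subseteq> isolated G \<and> card S = l}. e \<inter> S = {}}"
    unfolding e(1) isolated_add_edge[OF e(2)] by auto
  then show ?thesis unfolding choose_isolated[of "add_mset e G"] by (simp add: of_bool_def sum.If_cases Int_def conj_ac)
qed

text \<open>A set of isolated vertices survives exactly those insertions that avoid it, and the rate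
  of edges hitting it depends only on its size and on the number of unfrozen vertices. The drift is
  therefore an identity.\<close>

lemma gen_choose_isolated:
  assumes "valid n G"
  shows "gen (\<lambda>G. real (niso G choose l)) G = - real (niso G choose l) * hit_weight l (nunf G)"
proof -
  let ?\<S> = "{S. S \<subseteq> isolated G \<and> card S = l}"
  have "gen (\<lambda>G. real (niso G choose l)) G = (\<Sum>e\<in>edges. \<Sum>S\<in>?\<S>. - (accept G e * of_bool (e \<inter> S \<noteq> {})))"
    unfolding gen_def choose_isolated[of G]
  proof (rule sum.cong[OF refl])
    fix e assume e: "e \<in> edges"
    have "(\<Sum>S\<in>?\<S>. of_bool (e \<inter> S = {})) - (\<Sum>S\<in>?\<S>. 1) = (\<Sum>S\<in>?\<S>. - of_bool (e \<inter> S \<noteq> {}) :: real)"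
      unfolding sum_subtractf[symmetric] by (rule sum.cong) auto
    then show "accept G e * (real (niso (add_mset e G) choose l) - (\<Sum>S\<in>?\<S>. 1)) =
      (\<Sum>S\<in>?\<S>. - (accept G e * of_bool (e \<inter> S \<noteq> {})))"
      by (simp only: choose_isolated_add_edge[OF e] sum_distrib_left mult_minus_right)
  qed
  also have "\<dots> = (\<Sum>S\<in>?\<S>. - (\<Sum>e\<in>edges. accept G e * of_bool (e \<inter> S \<noteq> {})))"
    by (subst sum.swap) (simp add: sum_negf)
  also have "\<dots> = (\<Sum>S\<in>?\<S>. - hit_weight l (nunf G))"
  proof (rule sum.cong[OF refl])
    fix S assume "S \<in> ?\<S>"
    then show "- (\<Sum>e\<in>edges. accept G e * of_bool (e \<inter> S \<noteq> {})) = - hit_weight l (nunf G)"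
      using sum_accept_hitting[OF assms, of S] isolated_subset_unfrozen[OF assms] by auto
  qed
  finally show ?thesis by (simp add: n_subsets)
qed

text \<open>The quantity counts pairs of a set \<open>S\<close> of \<open>l\<close> isolated
  vertices and an unfrozen vertex \<open>w\<close> outside of \<open>S\<close>. A pair is lost for
  certain when an edge hits \<open>S\<close> or joins \<open>w\<close> itself to a frozen vertex.
  That \<open>w\<close> may also freeze through the rest of its tree or by a cycle only increases
  the loss, hence an inequality.\<close>

lemma gen_choose_isolated_unfrozen:
  assumes "valid n G"
  shows "gen (\<lambda>G. real (niso G choose l) * (real (nunf G) - real l)) G \<le>
    - (hit_weight l (nunf G) + p * (real n - real (nunf G))) * (real (niso G choose l) * (real (nunf G) - real l))"
proof -
  let ?\<S> = "\<lambda>G. {S. S \<subseteq> isolated G \<and> card S = l}"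
  let ?U = "unfrozen G"
  let ?kill = "\<lambda>e S w. e \<inter> S \<noteq> {} \<or> w \<in> e \<and> \<not> e \<subseteq> ?U"
  have rep: "real (niso H choose l) * (real (nunf H) - real l) = (\<Sum>S\<in>?\<S> H. real (card (unfrozen H - S)))" if "valid n H" for H
  proof -
    have "real (card (unfrozen H - S)) = real (nunf H) - real l" if "S \<in> ?\<S> H" for S
    proof -
      have "S \<subseteq> unfrozen H" "card S = l" using that isolated_subset_unfrozen[OF \<open>valid n H\<close>] by auto
      moreover have "finite S" by (rule finite_subset[OF calculation(1)]) simp
      moreover have "card S \<le> nunf H" by (rule card_mono[OF _ calculation(1)]) simp
      ultimately show ?thesis by (simp add: card_Diff_subset of_nat_diff)
    qed
    then show ?thesis by (simp add: n_subsets)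
  qed
  have "gen (\<lambda>G. real (niso G choose l) * (real (nunf G) - real l)) G \<le>
     (\<Sum>e\<in>edges. accept G e * (\<Sum>S\<in>?\<S> G. \<Sum>w\<in>?U - S. - of_bool (?kill e S w)))"
  proof (rule gen_le[OF assms])
    fix e assume e: "e \<in> edges" "accept G e \<noteq> 0"
    obtain x y where xy: "e = {x, y}" "x \<noteq> y" "x \<in> {1..n}" "y \<in> {1..n}" "x \<in> unfrozen G"
      using accept_nonzeroE[OF assms e] .
    have vG': "valid n (add_mset e G)"
      using valid_add_edge[OF assms, of x y] e xy by (simp add: unfrozen_def)
    have sub: "?\<S> (add_mset e G) = {S \<in> ?\<S> G. e \<inter> S = {}}"
      unfolding xy(1) isolated_add_edge[OF xy(2)] by auto
    have "(\<Sum>S\<in>?\<S> (add_mset e G). real (card (unfrozen (add_mset e G) - S))) =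
      (\<Sum>S\<in>?\<S> G. if e \<inter> S = {} then real (card (unfrozen (add_mset e G) - S)) else 0)"
      unfolding sub by (rule sum.inter_filter) simp
    also have "\<dots> \<le> (\<Sum>S\<in>?\<S> G. \<Sum>w\<in>?U - S. of_bool (\<not> ?kill e S w))"
    proof (rule sum_mono)
      fix S assume "S \<in> ?\<S> G"
      show "(if e \<inter> S = {} then real (card (unfrozen (add_mset e G) - S)) else 0) \<le> (\<Sum>w\<in>?U - S. of_bool (\<not> ?kill e S w))"
      proof (cases "e \<inter> S = {}")
        case True
        have "unfrozen (add_mset e G) - S \<subseteq> {w \<in> ?U - S. \<not> ?kill e S w}"
          using unfrozen_add_edge_aux[OF assms xy(5), of y] xy True by auto
        then have "card (unfrozen (add_mset e G) - S) \<le> card {w \<in> ?U - S. \<not> ?kill e S w}"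
          by (intro card_mono) auto
        also have "real (card {w \<in> ?U - S. \<not> ?kill e S w}) = (\<Sum>w\<in>?U - S. of_bool (\<not> ?kill e S w))"
          by (simp add: of_bool_def sum.If_cases Int_def conj_ac)
        finally show ?thesis using True by simp
      next
        case False
        then show ?thesis by (auto intro: sum_nonneg)
      qed
    qed
    finally have "real (niso (add_mset e G) choose l) * (real (nunf (add_mset e G)) - real l) \<le>
       (\<Sum>S\<in>?\<S> G. \<Sum>w\<in>?U - S. of_bool (\<not> ?kill e S w))" unfolding rep[OF vG'] .
    moreover have "(\<Sum>S\<in>?\<S> G. \<Sum>w\<in>?U - S. of_bool (\<not> ?kill e S w)) - real (niso G choose l) * (real (nunf G) - real l)
       = (\<Sum>S\<in>?\<S> G. \<Sum>w\<in>?U - S. - of_bool (?kill e S w))"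
    proof -
      have "real (niso G choose l) * (real (nunf G) - real l) = (\<Sum>S\<in>?\<S> G. \<Sum>w\<in>?U - S. 1)"
        unfolding rep[OF assms] by simp
      then show ?thesis by (simp only: of_bool_not_iff sum_subtractf sum_negf)
    qed
    ultimately show "real (niso (add_mset e G) choose l) * (real (nunf (add_mset e G)) - real l) -
       real (niso G choose l) * (real (nunf G) - real l) \<le> (\<Sum>S\<in>?\<S> G. \<Sum>w\<in>?U - S. - of_bool (?kill e S w))"
      by linarith
  qed
  also have "\<dots> = (\<Sum>S\<in>?\<S> G. \<Sum>w\<in>?U - S. - (\<Sum>e\<in>edges. accept G e * of_bool (?kill e S w)))"
  proof -
    have "(\<Sum>e\<in>edges. accept G e * (\<Sum>S\<in>?\<S> G. \<Sum>w\<in>?U - S. - of_bool (?kill e S w))) =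
      (\<Sum>e\<in>edges. \<Sum>S\<in>?\<S> G. \<Sum>w\<in>?U - S. - (accept G e * of_bool (?kill e S w)))"
      by (simp add: sum_distrib_left)
    also have "\<dots> = (\<Sum>S\<in>?\<S> G. \<Sum>e\<in>edges. \<Sum>w\<in>?U - S. - (accept G e * of_bool (?kill e S w)))"
      by (rule sum.swap)
    also have "\<dots> = (\<Sum>S\<in>?\<S> G. \<Sum>w\<in>?U - S. \<Sum>e\<in>edges. - (accept G e * of_bool (?kill e S w)))"
      by (rule sum.cong[OF refl]) (rule sum.swap)
    finally show ?thesis by (simp add: sum_negf)
  qed
  also have "\<dots> \<le> (\<Sum>S\<in>?\<S> G. \<Sum>w\<in>?U - S. - (hit_weight l (nunf G) + p * (real n - real (nunf G))))"
  proof (intro sum_mono le_imp_neg_le)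
    fix S w assume S: "S \<in> ?\<S> G" and w: "w \<in> ?U - S"
    have SU: "S \<subseteq> ?U" using S isolated_subset_unfrozen[OF assms] by auto
    have Un: "?U \<subseteq> {1..n}" by (auto simp: unfrozen_def)
    have "(\<Sum>e\<in>edges. accept G e * of_bool (e \<inter> S \<noteq> {})) = hit_weight l (nunf G)"
      using sum_accept_hitting[OF assms SU] S by simp
    moreover have "(\<Sum>e\<in>edges. accept G e * of_bool (w \<in> e \<and> \<not> e \<subseteq> ?U)) \<ge> p * (real n - real (nunf G))"
    proof -
      \<comment> \<open>Each frozen vertex \<open>z\<close> provides one edge \<open>{w, z}\<close>,
        accepted with probability \<open>p\<close>.\<close>
      let ?Z = "(\<lambda>z. {w, z}) ` ({1..n} - ?U)"
      have inj: "inj_on (\<lambda>z. {w, z}) ({1..n} - ?U)" using w by (auto simp: inj_on_def doubleton_eq_iff)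
      have Z: "?Z \<subseteq> edges"
      proof (rule image_subsetI)
        fix z assume z: "z \<in> {1..n} - ?U"
        then have "card {w, z} = 2" using w by (metis DiffD1 DiffD2 card_2_iff)
        then show "{w, z} \<in> edges" using z w Un by (auto simp: possible_edges_def)
      qed
      have "p * (real n - real (nunf G)) = (\<Sum>z\<in>{1..n} - ?U. p)"
        using Un nunf_le[of G] by (simp add: card_Diff_subset of_nat_diff)
      also have "\<dots> = (\<Sum>e\<in>?Z. p)" by (subst sum.reindex[OF inj]) simp
      also have "\<dots> \<le> (\<Sum>e\<in>?Z. accept G e * of_bool (w \<in> e \<and> \<not> e \<subseteq> ?U))"
        using accept_pair[OF assms] w Un by (intro sum_mono) auto
      also have "\<dots> \<le> (\<Sum>e\<in>edges. accept G e * of_bool (w \<in> e \<and> \<not> e \<subseteq> ?U))"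
        using Z accept_nonneg by (intro sum_mono2) auto
      finally show ?thesis .
    qed
    moreover have "(\<Sum>e\<in>edges. accept G e * of_bool (?kill e S w)) =
      (\<Sum>e\<in>edges. accept G e * of_bool (e \<inter> S \<noteq> {})) + (\<Sum>e\<in>edges. accept G e * of_bool (w \<in> e \<and> \<not> e \<subseteq> ?U))"
      unfolding sum.distrib[symmetric]
    proof (rule sum.cong)
      fix e assume "e \<in> edges"
      then obtain x y where e: "e = {x, y}" by (rule edgesE)
      \<comment> \<open>An edge with one end in \<open>S\<close> and the other end \<open>w\<close>
        has both ends unfrozen, so the two causes of loss never coincide.\<close>
      have "\<not> (e \<inter> S \<noteq> {} \<and> w \<in> e \<and> \<not> e \<subseteq> ?U)" using SU w e by auto
      then show "accept G e * of_bool (?kill e S w) =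
         accept G e * of_bool (e \<inter> S \<noteq> {}) + accept G e * of_bool (w \<in> e \<and> \<not> e \<subseteq> ?U)" by auto
    qed simp
    ultimately show "hit_weight l (nunf G) + p * (real n - real (nunf G)) \<le> (\<Sum>e\<in>edges. accept G e * of_bool (?kill e S w))"
      by linarith
  qed
  also have "\<dots> = - (hit_weight l (nunf G) + p * (real n - real (nunf G))) * (\<Sum>S\<in>?\<S> G. real (card (?U - S)))"
    by (simp add: sum_distrib_left sum_distrib_right mult.commute)
  finally show ?thesis unfolding rep[OF assms] .
qed

end

section \<open>The tree function\<close>

text \<open>The \<open>n\<close>-th finite difference annihilates polynomials of degree below
  \<open>n\<close>; the induction takes one difference, which lowers the degree of
  \<open>k ^ j\<close>.\<close>

lemma finite_difference_power:
  fixes j n :: nat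
  assumes "j < n"
  shows "(\<Sum>k\<le>n. (- 1) ^ k * of_nat (n choose k) * of_nat k ^ j :: 'a :: comm_ring_1) = 0"
  using assms
proof (induction n arbitrary: j)
  case 0
  then show ?case by simp
next
  case (Suc n)
  let ?c = "\<lambda>n k. (- 1) ^ k * of_nat (n choose k) :: 'a"
  have 1: "(\<Sum>k\<le>Suc n. ?c (Suc n) k * f k) = (\<Sum>k\<le>n. ?c n k * (f k - f (Suc k)))" for f :: "nat \<Rightarrow> 'a"
  proof -
    have "(\<Sum>k\<le>n. ?c n k * f k) = (\<Sum>k\<le>Suc n. ?c n k * f k)" by (simp add: binomial_eq_0)
    also have "\<dots> = f 0 + (\<Sum>k\<le>n. ?c n (Suc k) * f (Suc k))" by (subst sum.atMost_Suc_shift) simp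
    finally have 2: "(\<Sum>k\<le>n. ?c n k * f k) = f 0 + (\<Sum>k\<le>n. ?c n (Suc k) * f (Suc k))" .
    have "(\<Sum>k\<le>Suc n. ?c (Suc n) k * f k) = f 0 + (\<Sum>k\<le>n. ?c (Suc n) (Suc k) * f (Suc k))"
      by (subst sum.atMost_Suc_shift) simp
    also have "(\<Sum>k\<le>n. ?c (Suc n) (Suc k) * f (Suc k)) =
       (\<Sum>k\<le>n. ?c n (Suc k) * f (Suc k)) - (\<Sum>k\<le>n. ?c n k * f (Suc k))"
      unfolding sum_subtractf[symmetric] by (rule sum.cong) (simp_all add: algebra_simps)
    finally show ?thesis using 2 by (simp add: right_diff_distrib sum_subtractf)
  qed
  have pow: "(of_nat (Suc k) :: 'a) ^ j = (\<Sum>i<j. of_nat (j choose i) * of_nat k ^ i) + of_nat k ^ j" for k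
  proof -
    have "(of_nat (Suc k) :: 'a) ^ j = (of_nat k + 1) ^ j" by (simp add: add.commute)
    also have "\<dots> = (\<Sum>i\<le>j. of_nat (j choose i) * of_nat k ^ i)" by (subst binomial_ring) simp
    also have "{..j} = insert j {..<j}" by auto
    finally show ?thesis by (simp add: add.commute)
  qed
  have "(\<Sum>k\<le>Suc n. ?c (Suc n) k * of_nat k ^ j) = (\<Sum>k\<le>n. ?c n k * (- (\<Sum>i<j. of_nat (j choose i) * of_nat k ^ i)))"
    unfolding 1 pow by simp
  also have "\<dots> = (\<Sum>k\<le>n. \<Sum>i<j. - of_nat (j choose i) * (?c n k * of_nat k ^ i))"
    by (simp add: sum_distrib_left sum_negf mult_ac)
  also have "\<dots> = (\<Sum>i<j. - of_nat (j choose i) * (\<Sum>k\<le>n. ?c n k * of_nat k ^ i))"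
    by (subst sum.swap) (simp only: sum_distrib_left)
  also have "\<dots> = 0" using Suc by (intro sum.neutral) auto
  finally show ?case .
qed

text \<open>Coefficients of the tree function, the generating function of rooted labelled trees,
  which inverts \<open>x * exp (- x)\<close>.\<close>

definition tree_coeff :: "nat \<Rightarrow> real" where
  "tree_coeff k = (if k = 0 then 0 else real k ^ (k - 1) / fact k)"

lemma tree_coeff_nonneg: "tree_coeff k \<ge> 0"
  by (simp add: tree_coeff_def)

lemma tree_coeff_le: "tree_coeff k \<le> exp 1 ^ k"
proof (cases "k = 0")
  case False
  have s: "(\<lambda>m. inverse (fact m) *\<^sub>R real k ^ m) sums exp (real k)" by (rule exp_converges)
  have "real k ^ k / fact k = (\<Sum>m\<in>{k}. inverse (fact m) *\<^sub>R real k ^ m)" by (simp add: field_simps)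
  also have "\<dots> \<le> exp (real k)"
    using sum_le_suminf[of "\<lambda>m. inverse (fact m) *\<^sub>R real k ^ m" "{k}"] s by (simp add: sums_iff)
  also have "exp (real k) = exp 1 ^ k" using exp_of_nat_mult[of k "1::real"] by simp
  finally have 1: "real k ^ k / fact k \<le> exp 1 ^ k" .
  have "real k ^ (k - 1) \<le> real k ^ k" using False by (intro power_increasing) auto
  then have "tree_coeff k \<le> real k ^ k / fact k" using False by (simp add: tree_coeff_def divide_right_mono)
  with 1 show ?thesis by linarith
qed (simp add: tree_coeff_def)

abbreviation tree_fps :: "complex fps" where "tree_fps \<equiv> Abs_fps (\<lambda>k. of_real (tree_coeff k))"

text \<open>Lagrange inversion by hand: up to sign and division by \<open>fact m\<close>, the
  coefficient of order \<open>m\<close> is the \<open>m\<close>-th finite difference of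
  \<open>i ^ (m - 1)\<close> at zero, which vanishes for \<open>m \<ge> 2\<close>.\<close>

lemma tree_fps_compose: "fps_compose tree_fps (fps_X * fps_exp (- 1)) = fps_X"
proof (rule fps_ext)
  fix m
  have nth: "((fps_X * fps_exp (- 1)) ^ i :: complex fps) $ m = (if m < i then 0 else (- of_nat i) ^ (m - i) / fact (m - i))" for i
    by (simp add: power_mult_distrib fps_exp_power_mult fps_X_power_mult_nth)
  have "fps_compose tree_fps (fps_X * fps_exp (- 1)) $ m =
     (\<Sum>i=0..m. of_real (tree_coeff i) * ((- of_nat i) ^ (m - i) / fact (m - i)))"
    unfolding fps_compose_nth nth by (rule sum.cong) auto
  also have "\<dots> = fps_X $ m"
  proof (cases "m < 2")
    case True
    then have "m = 0 \<or> m = 1" by auto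
    then show ?thesis by (auto simp: tree_coeff_def)
  next
    case False
    have "fact m * (of_real (tree_coeff i) * ((- of_nat i) ^ (m - i) / fact (m - i))) =
       (- 1) ^ m * ((- 1) ^ i * of_nat (m choose i) * of_nat i ^ (m - 1) :: complex)" if "i \<le> m" for i
    proof (cases "i = 0")
      case True
      then show ?thesis using False by (simp add: tree_coeff_def)
    next
      case i: False
      have "(of_nat (m choose i) :: complex) = fact m / (fact i * fact (m - i))" using binomial_fact[OF that] .
      moreover have "(of_nat i :: complex) ^ (m - 1) = of_nat i ^ (i - 1) * of_nat i ^ (m - i)"
        using that i by (simp add: power_add[symmetric])
      moreover have "(- 1 :: complex) ^ (m - i) = (- 1) ^ m * (- 1) ^ i"
        using that by (simp add: uminus_power_if)
      moreover have "(- of_nat i :: complex) ^ (m - i) = (- 1) ^ (m - i) * of_nat i ^ (m - i)"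
        by (rule power_minus)
      ultimately show ?thesis using i by (simp add: tree_coeff_def)
    qed
    then have "fact m * (\<Sum>i=0..m. of_real (tree_coeff i) * ((- of_nat i) ^ (m - i) / fact (m - i))) =
       (\<Sum>i\<le>m. (- 1) ^ m * ((- 1) ^ i * of_nat (m choose i) * of_nat i ^ (m - 1) :: complex))"
      unfolding sum_distrib_left by (intro sum.cong) auto
    also have "\<dots> = 0" unfolding sum_distrib_left[symmetric] using finite_difference_power[of "m - 1" m] False by simp
    finally show ?thesis using False by simp
  qed
  finally show "fps_compose tree_fps (fps_X * fps_exp (- 1)) $ m = fps_X $ m" .
qed

lemma tree_fps_radius: "fps_conv_radius tree_fps \<ge> ereal (exp (- 1))"
  unfolding fps_conv_radius_def
proof (rule conv_radius_geI_ex')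
  fix r :: real assume r: "0 < r" "ereal r < ereal (exp (- 1))"
  have "summable (\<lambda>k. (exp 1 * r) ^ k)"
  proof (rule summable_geometric)
    have "exp 1 * r < exp 1 * exp (- 1)" using r by simp
    then show "norm (exp 1 * r) < 1" using r by (simp add: exp_minus)
  qed
  then show "summable (\<lambda>k. fps_nth tree_fps k * of_real r ^ k)"
  proof (rule summable_comparison_test')
    fix k assume "k \<ge> (0 :: nat)"
    show "norm (fps_nth tree_fps k * of_real r ^ k) \<le> (exp 1 * r) ^ k"
      using tree_coeff_le[of k] tree_coeff_nonneg[of k] r
      by (simp add: norm_mult norm_power power_mult_distrib mult_right_mono)
  qed
qed

text \<open>The formal identity yields the equation near zero. Analytic continuation extends it to
  the open set \<open>S\<close> of points of the unit disc whose image stays in the disc of radius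
  \<open>exp (- 1)\<close>, where the series is known to converge.\<close>

lemma tree_function_complex:
  assumes "norm (z * exp (- z)) < exp (- 1)" "norm z < 1"
  shows "eval_fps tree_fps (z * exp (- z)) = z"
proof -
  define S where "S = {z :: complex. norm (z * exp (- z)) < exp (- 1)} \<inter> ball 0 1"
  have S_open: "open S" unfolding S_def by (intro open_Int open_Collect_less continuous_intros open_ball)
  \<comment> \<open>For \<open>Re z \<le> 1\<close> the modulus of
    \<open>s * z * exp (- (s * z))\<close> increases in \<open>s\<close> on \<open>[0, 1]\<close>.
    Hence \<open>S\<close> is star-shaped about zero and in particular connected.\<close>
  have star: "of_real s * z \<in> S" if "z \<in> S" "0 \<le> s" "s \<le> 1" for s z
  proof -
    have "s * exp (- (s * Re z)) \<le> 1 * exp (- (1 * Re z))"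
    proof (rule DERIV_nonneg_imp_nondecreasing[OF that(3)])
      fix u assume u: "s \<le> u" "u \<le> 1"
      have "Re z \<le> 1" using that(1) complex_Re_le_cmod[of z] by (simp add: S_def)
      then have "u * Re z \<le> 1" using u that(2) mult_mono[of u 1 "Re z" 1]
        by (cases "Re z \<ge> 0") (auto simp: mult_nonneg_nonpos intro: order_trans[OF _ zero_le_one])
      moreover have "((\<lambda>s. s * exp (- (s * Re z))) has_real_derivative exp (- (u * Re z)) * (1 - u * Re z)) (at u)"
        by (auto intro!: derivative_eq_intros simp: algebra_simps)
      ultimately show "\<exists>y. ((\<lambda>s. s * exp (- (s * Re z))) has_real_derivative y) (at u) \<and> 0 \<le> y"
        by (intro exI conjI) auto
    qed
    then have "norm z * (s * exp (- (s * Re z))) \<le> norm z * exp (- Re z)" by (intro mult_left_mono) auto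
    moreover have "norm z * s \<le> norm z" using that mult_left_mono[of s 1 "norm z"] by simp
    ultimately show ?thesis using that by (simp add: S_def norm_mult mult_ac)
  qed
  have S0: "0 \<in> S" by (simp add: S_def)
  have "starlike S"
    unfolding starlike_def
  proof (intro bexI[OF _ S0] ballI)
    fix w assume w: "w \<in> S"
    show "closed_segment 0 w \<subseteq> S"
      using star[OF w] by (auto simp: closed_segment_def scaleR_conv_of_real)
  qed
  then have S_conn: "connected S" by (rule starlike_imp_connected)
  have r: "norm w < exp (- 1) \<Longrightarrow> w \<in> eball 0 (fps_conv_radius tree_fps)" for w :: complex
  proof -
    assume "norm w < exp (- 1)"
    then have "ereal (norm w) < ereal (exp (- 1))" by simp
    then have "ereal (norm w) < fps_conv_radius tree_fps" using tree_fps_radius by (rule less_le_trans)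
    then show ?thesis by (simp add: eball_def dist_norm)
  qed
  have "(\<lambda>z. eval_fps tree_fps (z * exp (- z)) - z) holomorphic_on S"
  proof (rule holomorphic_on_diff)
    have "(\<lambda>z. z * exp (- z)) ` S \<subseteq> eball 0 (fps_conv_radius tree_fps)" by (auto simp only: S_def intro!: r)
    moreover have "(\<lambda>z::complex. z * exp (- z)) holomorphic_on S" by (intro holomorphic_intros)
    ultimately show "(\<lambda>z. eval_fps tree_fps (z * exp (- z))) holomorphic_on S"
      using holomorphic_on_compose_gen[of "\<lambda>z. z * exp (- z)" S "eval_fps tree_fps" "eball 0 (fps_conv_radius tree_fps)"]
        holomorphic_on_eval_fps[of "eball 0 (fps_conv_radius tree_fps)" tree_fps]
      by (simp add: o_def)
  qed (intro holomorphic_intros)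
  moreover have "\<exists>e>0. \<forall>z\<in>ball 0 e. eval_fps tree_fps (z * exp (- z)) = z"
  proof -
    have rad: "fps_conv_radius tree_fps > 0"
      using tree_fps_radius by (rule less_le_trans[rotated]) simp
    have "(eval_fps tree_fps \<circ> (\<lambda>z. z * exp (- 1 * z))) has_fps_expansion fps_compose tree_fps (fps_X * fps_exp (- 1))"
      by (intro has_fps_expansion_compose fps_expansion_intros eval_fps_has_fps_expansion rad) simp
    then have "(eval_fps tree_fps \<circ> (\<lambda>z. z * exp (- 1 * z))) has_fps_expansion fps_X"
      by (simp only: tree_fps_compose)
    then have "eventually (\<lambda>z. eval_fps tree_fps (z * exp (- z)) = z) (nhds (0 :: complex))"
      by (auto simp: has_fps_expansion_def eq_commute elim!: eventually_mono)
    then show ?thesis by (auto simp: eventually_nhds_metric dist_norm)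
  qed
  then obtain e where e: "e > 0" "\<And>z. z \<in> ball 0 e \<Longrightarrow> eval_fps tree_fps (z * exp (- z)) = z" by blast
  have "(0 :: complex) islimpt (S \<inter> ball 0 e)"
    by (rule interior_limit_point) (use S_open S0 e(1) in \<open>simp add: interior_open open_Int\<close>)
  ultimately have "eval_fps tree_fps (z * exp (- z)) - z = 0"
    using analytic_continuation[OF _ S_open S_conn, of "\<lambda>z. eval_fps tree_fps (z * exp (- z)) - z" "S \<inter> ball 0 e" 0 z]
      e(2) S0 assms by (auto simp: S_def)
  then show ?thesis by simp
qed

lemma x_exp_le: "(x::real) * exp (- x) \<le> exp (- 1)"
proof -
  have "x \<le> exp (x - 1)" using exp_ge_add_one_self[of "x - 1"] by simp
  then have "x * exp (- x) \<le> exp (x - 1) * exp (- x)" by (intro mult_right_mono) auto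
  then show ?thesis by (simp add: exp_add[symmetric])
qed

lemma x_exp_less: "x < 1 \<Longrightarrow> 0 \<le> x \<Longrightarrow> (x::real) * exp (- x) < exp (- 1)"
proof -
  assume x: "x < 1" "0 \<le> x"
  have "x < exp (x - 1)"
  proof (cases "x = 0")
    case False
    then have "x > 0" using x by simp
    then have "ln x < x - 1" using ln_eq_minus_one[of x] ln_le_minus_one[of x] x by linarith
    then show ?thesis using \<open>x > 0\<close> by (metis exp_ln exp_less_cancel_iff)
  qed simp
  then have "x * exp (- x) < exp (x - 1) * exp (- x)" by (intro mult_strict_right_mono) auto
  then show ?thesis by (simp add: exp_add[symmetric])
qed

lemma tree_function_sums_lt:
  assumes "0 \<le> x" "x < 1"
  shows "(\<lambda>k. tree_coeff k * (x * exp (- x)) ^ k) sums x"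
proof -
  let ?y = "x * exp (- x)"
  have y: "?y < exp (- 1)" "?y \<ge> 0" using x_exp_less[OF assms(2,1)] assms by auto
  have e: "of_real x * exp (- of_real x) = (of_real ?y :: complex)" using exp_of_real[of "- x", where 'a = complex] by simp
  have "(\<lambda>k. fps_nth tree_fps k * of_real ?y ^ k) sums eval_fps tree_fps (of_real ?y)"
  proof (rule sums_eval_fps)
    have "norm (of_real ?y :: complex) = ?y" using y(2) by (metis norm_of_real abs_of_nonneg)
    then have "ereal (norm (of_real ?y :: complex)) < ereal (exp (- 1))" using y(1) by (metis less_ereal.simps(1))
    then show "ereal (norm (of_real ?y :: complex)) < fps_conv_radius tree_fps" using tree_fps_radius by (rule less_le_trans)
  qed
  moreover have "eval_fps tree_fps (of_real ?y) = of_real x"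
  proof -
    have "norm (of_real ?y :: complex) = ?y" using y(2) by (metis norm_of_real abs_of_nonneg)
    then have "norm (of_real ?y :: complex) < exp (- 1)" using y(1) by metis
    moreover have "norm (of_real x :: complex) < 1" using assms by simp
    ultimately show ?thesis using tree_function_complex[of "of_real x"] unfolding e by blast
  qed
  ultimately have "(\<lambda>k. complex_of_real (tree_coeff k * ?y ^ k)) sums of_real x" by simp
  then show ?thesis by (subst (asm) sums_of_real_iff)
qed

text \<open>At \<open>x = 1\<close> the argument reaches the boundary \<open>exp (- 1)\<close>, and
  an Abel argument with nonnegative coefficients applies: partial sums at 1 are limits of partial
  sums below 1, and the full sum dominates every \<open>x < 1\<close>. The end point is needed since
  it is attained at the critical time.\<close>

lemma tree_function_sums:
  assumes "0 \<le> x" "x \<le> 1"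
  shows "(\<lambda>k. tree_coeff k * (x * exp (- x)) ^ k) sums x"
proof (cases "x < 1")
  case True
  then show ?thesis using tree_function_sums_lt assms by blast
next
  case False
  let ?f = "\<lambda>x k. tree_coeff k * (x * exp (- x)) ^ k"
  have nn: "0 \<le> x \<Longrightarrow> ?f x k \<ge> 0" for x k by (simp add: tree_coeff_nonneg)
  have part: "(\<Sum>k<K. ?f 1 k) \<le> 1" for K
  proof (rule tendsto_le[of "at_left 1"])
    show "((\<lambda>x. \<Sum>k<K. ?f x k) \<longlongrightarrow> (\<Sum>k<K. ?f 1 k)) (at_left 1)"
      by (intro tendsto_intros)
    have "eventually (\<lambda>x::real. x \<in> {0<..<1}) (at_left 1)" by (rule eventually_at_left_real) simp
    then show "eventually (\<lambda>x. (\<Sum>k<K. ?f x k) \<le> 1) (at_left 1)"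
    proof eventually_elim
      case (elim x)
      then have s: "?f x sums x" by (intro tree_function_sums_lt) auto
      have x0: "0 \<le> x" using elim by simp
      have "(\<Sum>k<K. ?f x k) \<le> suminf (?f x)"
        by (rule sum_le_suminf[OF sums_summable[OF s]]) (use nn[OF x0] in blast)+
      also have "\<dots> = x" by (rule sums_unique[OF s, symmetric])
      finally show ?case using elim by simp
    qed
  qed auto
  have sm: "summable (?f 1)" by (rule summableI_nonneg_bounded[of _ 1]) (use part in \<open>auto simp: tree_coeff_nonneg\<close>)
  have le: "suminf (?f 1) \<le> 1" by (rule suminf_le_const[OF sm part])
  have ge: "x \<le> suminf (?f 1)" if x: "0 < x" "x < 1" for x
  proof -
    have s: "?f x sums x" using x by (intro tree_function_sums_lt) auto
    have "suminf (?f x) \<le> suminf (?f 1)"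
    proof (rule suminf_le)
      show "?f x k \<le> ?f 1 k" for k
        using x x_exp_le[of x] by (intro mult_left_mono power_mono) (auto simp: tree_coeff_nonneg)
      show "summable (?f x)" by (rule sums_summable[OF s])
      show "summable (?f 1)" by (rule sm)
    qed
    then show ?thesis by (simp only: sums_unique[OF s, symmetric])
  qed
  have "1 \<le> suminf (?f 1)" by (rule dense_le_bounded[of 0]) (use ge in auto)
  then have "suminf (?f 1) = 1" using le by simp
  then show ?thesis using sm False assms by (simp add: sums_iff)
qed

section \<open>The fluid limit\<close>

locale fluid =
  fixes p :: real
  assumes p_pos: "0 < p" and p_le_1: "p \<le> 1"
begin

text \<open>The limiting fraction \<open>x\<close> of frozen vertices is reached at time \<open>\<tau> x\<close> (in units of \<open>n / 2\<close> steps).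
  The series solves the linear equation \<open>p x \<tau>' + \<tau> = 1 / (1 - x)\<close>.\<close>

definition \<tau> :: "real \<Rightarrow> real" where "\<tau> x = (\<Sum>j. 1 / (1 + p * real j) * x ^ j)"

definition \<tau>' :: "real \<Rightarrow> real" where "\<tau>' x = (\<Sum>j. diffs (\<lambda>j. 1 / (1 + p * real j)) j * x ^ j)"

definition \<kappa> :: real where "\<kappa> = Digamma (1 / p) + euler_mascheroni"

lemma den_ge: "1 + p * real j \<ge> 1"
  using p_pos by simp

lemma summable_\<tau>:
  assumes "\<bar>x\<bar> < 1" shows "summable (\<lambda>j. 1 / (1 + p * real j) * x ^ j)"
proof (rule summable_comparison_test')
  show "summable (\<lambda>j. \<bar>x\<bar> ^ j)" using assms by (intro summable_geometric) simp
  fix j :: nat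
  have "1 / (1 + p * real j) \<le> 1" using den_ge[of j] by simp
  then show "norm (1 / (1 + p * real j) * x ^ j) \<le> \<bar>x\<bar> ^ j"
    using den_ge[of j] mult_right_mono[of "1 / (1 + p * real j)" 1 "\<bar>x\<bar> ^ j"] by (simp add: abs_mult power_abs)
qed

lemma \<tau>_sums: "\<bar>x\<bar> < 1 \<Longrightarrow> (\<lambda>j. 1 / (1 + p * real j) * x ^ j) sums \<tau> x"
  unfolding \<tau>_def by (intro summable_sums summable_\<tau>)

lemma \<tau>_deriv: "\<bar>x\<bar> < 1 \<Longrightarrow> (\<tau> has_real_derivative \<tau>' x) (at x)"
  unfolding \<tau>_def[abs_def] \<tau>'_def
  by (rule termdiffs_strong'[where K = 1]) (use summable_\<tau> in \<open>simp_all only: real_norm_def\<close>)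

lemma \<tau>'_sums: "\<bar>x\<bar> < 1 \<Longrightarrow> (\<lambda>j. diffs (\<lambda>j. 1 / (1 + p * real j)) j * x ^ j) sums \<tau>' x"
  unfolding \<tau>'_def
  by (intro summable_sums termdiff_converges[where K = 1]) (use summable_\<tau> in \<open>simp_all only: real_norm_def\<close>)

text \<open>Coefficientwise, \<open>1 + p * j\<close> cancels the denominator. The origin of the
  equation: an isolated fraction \<open>v * exp (- (t * v))\<close> that decreases at relative rate
  \<open>p + (1 - p) * v\<close> satisfies \<open>v' * (1 / v - t) = - p * (1 - v)\<close>. With
  \<open>x = 1 - v\<close> as the independent variable this becomes linear in the time
  \<open>t\<close>.\<close>

lemma \<tau>_ode:
  assumes "\<bar>x\<bar> < 1" shows "p * x * \<tau>' x + \<tau> x = 1 / (1 - x)"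
proof -
  let ?c = "\<lambda>j. 1 / (1 + p * real j)"
  have "(\<lambda>j. of_nat j * ?c j * x ^ (j - Suc 0)) sums \<tau>' x"
    using diffs_equiv[of ?c x] \<tau>'_sums[OF assms] by (simp add: sums_iff)
  then have "(\<lambda>j. (p * x) * (of_nat j * ?c j * x ^ (j - Suc 0))) sums (p * x * \<tau>' x)" by (rule sums_mult)
  then have "(\<lambda>j. (p * x) * (of_nat j * ?c j * x ^ (j - Suc 0)) + ?c j * x ^ j) sums (p * x * \<tau>' x + \<tau> x)"
    using \<tau>_sums[OF assms] by (rule sums_add)
  moreover have "(p * x) * (of_nat j * ?c j * x ^ (j - Suc 0)) + ?c j * x ^ j = x ^ j" for j
  proof -
    have "x * (of_nat j * x ^ (j - Suc 0)) = of_nat j * x ^ j" by (cases j) auto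
    moreover have "(p * x) * (of_nat j * ?c j * x ^ (j - Suc 0)) = p * ?c j * (x * (of_nat j * x ^ (j - Suc 0)))"
      by (simp only: mult_ac)
    ultimately have "(p * x) * (of_nat j * ?c j * x ^ (j - Suc 0)) + ?c j * x ^ j = (1 + p * real j) * ?c j * x ^ j"
      by (simp only: algebra_simps mult_1)
    then show ?thesis using den_ge[of j] by simp
  qed
  ultimately have "(\<lambda>j. x ^ j) sums (p * x * \<tau>' x + \<tau> x)" by simp
  then show ?thesis using geometric_sums[of x] assms sums_unique2 by auto
qed

lemma \<tau>'_pos:
  assumes "0 \<le> x" "x < 1" shows "\<tau>' x > 0"
proof -
  let ?d = "\<lambda>j. diffs (\<lambda>j. 1 / (1 + p * real j)) j * x ^ j"
  have pos: "diffs (\<lambda>j. 1 / (1 + p * real j)) j > 0" for j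
    using den_ge[of "Suc j"] by (simp add: diffs_def add_pos_nonneg del: of_nat_Suc)
  have "?d 0 = (\<Sum>j\<in>{0}. ?d j)" by simp
  also have "\<dots> \<le> suminf ?d"
  proof (rule sum_le_suminf)
    show "summable ?d" using \<tau>'_sums[of x] assms by (auto simp: sums_iff)
    show "0 \<le> ?d j" for j using pos[of j] assms by simp
  qed auto
  finally show ?thesis using pos[of 0] by (simp add: \<tau>'_def)
qed

lemma \<tau>_0: "\<tau> 0 = 1"
  unfolding \<tau>_def by (subst suminf_finite[of "{0}"]) auto

lemma \<tau>_strict_mono:
  assumes "0 \<le> a" "a < b" "b < 1" shows "\<tau> a < \<tau> b"
proof (rule DERIV_pos_imp_increasing[OF assms(2)])
  fix x assume "a \<le> x" "x \<le> b"
  then show "\<exists>y. (\<tau> has_real_derivative y) (at x) \<and> 0 < y"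
    using \<tau>_deriv[of x] \<tau>'_pos[of x] assms by (intro exI[of _ "\<tau>' x"]) auto
qed

text \<open>As \<open>\<tau>'\<close> is positive, the differential equation gives
  \<open>\<tau> x \<le> 1 / (1 - x)\<close>: the unfrozen part never becomes supercritical.\<close>

lemma \<tau>_bound:
  assumes "0 \<le> x" "x < 1" shows "(1 - x) * \<tau> x \<le> 1"
proof -
  have "\<tau> x \<le> 1 / (1 - x)" using \<tau>_ode[of x] \<tau>'_pos[OF assms] assms p_pos by (smt (verit) mult_nonneg_nonneg)
  then show ?thesis using assms by (simp add: field_simps)
qed

definition Y :: "real \<Rightarrow> real" where "Y x = (1 - x) * exp (- ((1 - x) * \<tau> x))"

definition Q :: "real \<Rightarrow> real" where "Q x = Y x * (1 - x + p * x)"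

lemma Y_pos: "x < 1 \<Longrightarrow> Y x > 0" by (simp add: Y_def)

lemma Y_deriv:
  assumes "\<bar>x\<bar> < 1" shows "(Y has_real_derivative - (Q x * \<tau>' x)) (at x)"
proof -
  have alg: "(- 1) * e + e * (- ((- 1) * a + b * (1 - x))) * (1 - x) = e * (- 1 + (1 - x) * a - (1 - x) * (1 - x) * b)"
    for e a b :: real by (simp add: algebra_simps)
  have d: "(Y has_real_derivative (- 1) * exp (- ((1 - x) * \<tau> x)) +
     exp (- ((1 - x) * \<tau> x)) * (- ((- 1) * \<tau> x + \<tau>' x * (1 - x))) * (1 - x)) (at x)"
    unfolding Y_def[abs_def] by (auto intro!: derivative_eq_intros \<tau>_deriv assms)
  \<comment> \<open>The differential equation eliminates \<open>\<tau> x\<close>, after which the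
    factor \<open>(1 - x + p * x) * \<tau>' x\<close> splits off.\<close>
  have "(1 - x) * \<tau> x = 1 - (1 - x) * (p * x * \<tau>' x)"
    using \<tau>_ode[OF assms] assms by (auto simp: field_simps)
  then have "- 1 + (1 - x) * \<tau> x - (1 - x) * (1 - x) * \<tau>' x = - ((1 - x) * (1 - x + p * x) * \<tau>' x)"
    by (simp add: algebra_simps)
  then have "exp (- ((1 - x) * \<tau> x)) * (- 1 + (1 - x) * \<tau> x - (1 - x) * (1 - x) * \<tau>' x) = - (Q x * \<tau>' x)"
    by (simp add: Q_def Y_def)
  then have "(- 1) * exp (- ((1 - x) * \<tau> x)) +
     exp (- ((1 - x) * \<tau> x)) * (- ((- 1) * \<tau> x + \<tau>' x * (1 - x))) * (1 - x) = - (Q x * \<tau>' x)"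
    unfolding alg .
  with d show ?thesis by (simp only:)
qed

lemma Y_antimono:
  assumes "0 \<le> a" "a \<le> b" "b < 1" shows "Y b \<le> Y a"
proof (rule DERIV_nonpos_imp_nonincreasing[OF assms(2)])
  fix x assume "a \<le> x" "x \<le> b"
  then have x: "0 \<le> x" "x < 1" using assms by auto
  have "Q x \<ge> 0" unfolding Q_def using x p_pos Y_pos[of x] by (intro mult_nonneg_nonneg) auto
  then show "\<exists>y. (Y has_real_derivative y) (at x) \<and> y \<le> 0"
    using Y_deriv[of x] \<tau>'_pos[OF x] x by (intro exI[of _ "- (Q x * \<tau>' x)"]) auto
qed

lemma Q_antimono:
  assumes "0 \<le> a" "a \<le> b" "b < 1" shows "Q b \<le> Q a"
proof -
  have "(1 - p) * a \<le> (1 - p) * b" using assms p_le_1 by (intro mult_left_mono) auto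
  then have "1 - b + p * b \<le> 1 - a + p * a" by (simp add: algebra_simps)
  moreover have "0 \<le> 1 - b + p * b" using assms p_pos by (simp add: add_nonneg_nonneg)
  ultimately show ?thesis unfolding Q_def using assms Y_antimono[OF assms] Y_pos[of a]
    by (intro mult_mono) auto
qed

text \<open>Cauchy's mean value theorem for \<open>Y\<close> against \<open>\<tau>\<close>, with
  \<open>Q\<close> decreasing. Increments bounded by the rates at both ends are all that the
  discrete comparison uses, so differentiability of the inverse of \<open>\<tau>\<close> never comes
  up.\<close>

lemma Y_increment:
  assumes "0 \<le> a" "a \<le> b" "b < 1"
  shows "(\<tau> b - \<tau> a) * Q b \<le> Y a - Y b" "Y a - Y b \<le> (\<tau> b - \<tau> a) * Q a"
proof -
  have "(\<tau> b - \<tau> a) * Q b \<le> Y a - Y b \<and> Y a - Y b \<le> (\<tau> b - \<tau> a) * Q a"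
  proof (cases "a = b")
    case False
    then have ab: "a < b" using assms by simp
    have "\<exists>c. a < c \<and> c < b \<and> (Y b - Y a) * \<tau>' c = (\<tau> b - \<tau> a) * (- (Q c * \<tau>' c))"
      using assms by (intro GMVT'[OF ab] DERIV_isCont[OF \<tau>_deriv] DERIV_isCont[OF Y_deriv] \<tau>_deriv Y_deriv) auto
    then obtain c where c: "a < c" "c < b" "(Y b - Y a) * \<tau>' c = (\<tau> b - \<tau> a) * (- (Q c * \<tau>' c))" by blast
    have "\<tau>' c > 0" using \<tau>'_pos[of c] c assms by simp
    moreover from c(3) have "(Y a - Y b) * \<tau>' c = ((\<tau> b - \<tau> a) * Q c) * \<tau>' c" by (simp add: algebra_simps)
    ultimately have "Y a - Y b = (\<tau> b - \<tau> a) * Q c" by simp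
    moreover have "Q b \<le> Q c" "Q c \<le> Q a" using Q_antimono[of c b] Q_antimono[of a c] c assms by auto
    moreover have "\<tau> a < \<tau> b" using \<tau>_strict_mono[OF assms(1) ab assms(3)] .
    ultimately show ?thesis by (auto intro: mult_left_mono)
  qed simp
  then show "(\<tau> b - \<tau> a) * Q b \<le> Y a - Y b" "Y a - Y b \<le> (\<tau> b - \<tau> a) * Q a" by auto
qed

text \<open>Coefficient of \<open>x ^ Suc j\<close> in \<open>p - p * \<tau> x - ln (1 - x)\<close>;
  the term of order zero cancels. The harmonic parts of the two series compensate each other and
  leave nonnegative summable terms.\<close>

definition D :: "nat \<Rightarrow> real" where "D j = 1 / real (Suc j) - p / (1 + p * real (Suc j))"

lemma D_nonneg: "D j \<ge> 0"
proof -
  define J where "J = real (Suc j)"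
  have J: "J > 0" "1 + p * J > 0" using p_pos by (simp_all add: J_def add_pos_nonneg)
  then have "p \<le> (1 + p * J) / J" by (simp add: pos_le_divide_eq)
  then have "p / (1 + p * J) \<le> ((1 + p * J) / J) / (1 + p * J)" using J by (intro divide_right_mono) auto
  also have "\<dots> = 1 / J" using J by simp
  finally have "p / (1 + p * real (Suc j)) \<le> 1 / real (Suc j)" unfolding J_def .
  then show ?thesis by (simp add: D_def)
qed

text \<open>The digamma series has the terms \<open>1 / (k + 1) - p / (1 + p * k)\<close>. In
  \<open>D\<close> the second index is advanced by one, and telescoping this shift contributes the
  extra \<open>p\<close>.\<close>

lemma D_sums: "D sums (\<kappa> + p)"
proof -
  have "(\<lambda>k. inverse (of_nat (Suc k)) - inverse (1 / p + of_nat k)) sums \<kappa>"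
    using summable_Digamma[of "1 / p"] p_pos by (simp add: \<kappa>_def Digamma_def summable_sums)
  moreover have "inverse (1 / p + of_nat k) = p / (1 + p * real k)" for k
    using p_pos by (simp add: field_simps)
  ultimately have 1: "(\<lambda>k. 1 / real (Suc k) - p / (1 + p * real k)) sums \<kappa>"
    by (simp add: inverse_eq_divide)
  have "(\<lambda>k. p / (1 + p * real k)) \<longlonglongrightarrow> 0" using p_pos by real_asymp
  then have "(\<lambda>k. p / (1 + p * real k) - p / (1 + p * real (Suc k))) sums (p / (1 + p * real 0) - 0)"
    by (rule telescope_sums')
  then have "(\<lambda>k. (1 / real (Suc k) - p / (1 + p * real k)) + (p / (1 + p * real k) - p / (1 + p * real (Suc k)))) sums (\<kappa> + p)"
    using 1 by (intro sums_add) auto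
  then show ?thesis by (simp add: D_def[abs_def] algebra_simps)
qed

lemma p\<tau>_ln:
  assumes "0 \<le> x" "x < 1"
  shows "(\<lambda>j. D j * x ^ Suc j) sums (p - p * \<tau> x - ln (1 - x))"
proof -
  have "(\<lambda>j. 1 / (1 + p * real (Suc j)) * x ^ Suc j) sums (\<tau> x - 1)"
    using \<tau>_sums[of x] assms by (subst sums_Suc_iff) auto
  then have 1: "(\<lambda>j. p * (1 / (1 + p * real (Suc j)) * x ^ Suc j)) sums (p * (\<tau> x - 1))" by (rule sums_mult)
  have "(\<lambda>j. - (x ^ Suc j / real (Suc j))) sums ln (1 - x)"
  proof -
    have s: "summable (\<lambda>j. x ^ Suc j / real (Suc j))"
    proof (rule summable_comparison_test')
      show "summable (\<lambda>j. x ^ j)" using assms by (intro summable_geometric) auto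
      fix j :: nat
      have "x ^ Suc j / real (Suc j) \<le> x ^ Suc j / 1" using assms by (intro divide_left_mono) auto
      also have "\<dots> \<le> x ^ j" using assms mult_right_mono[of x 1 "x ^ j"] by simp
      finally show "norm (x ^ Suc j / real (Suc j)) \<le> x ^ j" using assms by simp
    qed
    have eqn: "(-1) ^ j * (1 / real (j + 1)) * ((1 - x) - 1) ^ Suc j = - (x ^ Suc j / real (Suc j))" for j
    proof -
      have "(- x) ^ Suc j = - ((- 1) ^ j * x ^ Suc j)" by (subst power_minus) simp
      then have "(- 1) ^ j * (- x) ^ Suc j = - (((- 1) ^ j * (- 1) ^ j) * x ^ Suc j)" by (simp only: mult_ac mult_minus_right)
      also have "\<dots> = - (x ^ Suc j)" by simp
      finally show ?thesis by (simp del: power_Suc)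
    qed
    have "ln (1 - x) = (\<Sum>j. (-1) ^ j * (1 / real (j + 1)) * ((1 - x) - 1) ^ Suc j)"
      by (rule ln_series) (use assms in auto)
    then have "ln (1 - x) = (\<Sum>j. - (x ^ Suc j / real (Suc j)))" by (simp only: eqn)
    then show ?thesis using s summable_minus summable_sums by metis
  qed
  from sums_diff[OF sums_minus[OF this] 1]
  have "(\<lambda>j. - (- (x ^ Suc j / real (Suc j))) - p * (1 / (1 + p * real (Suc j)) * x ^ Suc j)) sums (- ln (1 - x) - p * (\<tau> x - 1))" .
  then show ?thesis by (simp add: D_def algebra_simps)
qed

text \<open>Abel's limit: \<open>D\<close> itself is a summable majorant on \<open>[0, 1]\<close>,
  so the series is continuous up to the end point.\<close>

lemma p\<tau>_ln_limit: "((\<lambda>x. p * \<tau> x + ln (1 - x)) \<longlongrightarrow> - \<kappa>) (at_left 1)"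
proof -
  have "uniform_limit {0..1} (\<lambda>n x. \<Sum>j<n. D j * x ^ Suc j) (\<lambda>x. \<Sum>j. D j * x ^ Suc j) sequentially"
  proof (rule Weierstrass_m_test)
    show "norm (D j * x ^ Suc j) \<le> D j" if "x \<in> {0..1}" for j x
    proof -
      have "\<bar>x ^ Suc j\<bar> \<le> 1" using that by (simp add: power_abs power_le_one del: power_Suc)
      then have "D j * \<bar>x ^ Suc j\<bar> \<le> D j * 1" using D_nonneg by (intro mult_left_mono)
      then show ?thesis using D_nonneg[of j] by (simp add: abs_mult del: power_Suc)
    qed
    show "summable D" using D_sums by (simp add: sums_iff)
  qed
  then have c: "continuous_on {0..1} (\<lambda>x. \<Sum>j. D j * x ^ Suc j)"
    by (rule uniform_limit_theorem[rotated]) (auto intro!: always_eventually continuous_intros)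
  have "((\<lambda>x. \<Sum>j. D j * x ^ Suc j) \<longlongrightarrow> (\<Sum>j. D j * 1 ^ Suc j)) (at 1 within {0..1})"
    using c[unfolded continuous_on_def, rule_format, of 1] by simp
  moreover have "at (1::real) within {0..1} = at_left 1" by (rule at_within_Icc_at_left) simp
  moreover have "(\<Sum>j. D j * 1 ^ Suc j) = \<kappa> + p" using D_sums by (simp add: sums_iff)
  ultimately have "((\<lambda>x. \<Sum>j. D j * x ^ Suc j) \<longlongrightarrow> \<kappa> + p) (at_left 1)" by simp
  moreover have "eventually (\<lambda>x. (\<Sum>j. D j * x ^ Suc j) = p - p * \<tau> x - ln (1 - x)) (at_left 1)"
    using eventually_at_left_real[of 0 1] by (rule eventually_mono) (use p\<tau>_ln in \<open>auto simp: sums_iff\<close>)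
  ultimately have "((\<lambda>x. p - p * \<tau> x - ln (1 - x)) \<longlongrightarrow> \<kappa> + p) (at_left 1)"
    by (blast intro: Lim_transform_eventually)
  from tendsto_diff[OF tendsto_const[of p] this] show ?thesis by (simp add: algebra_simps)
qed

lemma \<tau>_at_top: "filterlim \<tau> at_top (at_left 1)"
proof -
  have "filterlim (\<lambda>x::real. - ln (1 - x)) at_top (at_left 1)" by real_asymp
  then have "filterlim (\<lambda>x. (p * \<tau> x + ln (1 - x)) + (- ln (1 - x))) at_top (at_left 1)"
    by (rule filterlim_tendsto_add_at_top[OF p\<tau>_ln_limit])
  then have "filterlim (\<lambda>x. p * \<tau> x) at_top (at_left 1)" by simp
  from filterlim_tendsto_pos_mult_at_top[OF tendsto_const[of "1 / p"] _ this] p_pos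
  show ?thesis by simp
qed

section \<open>The fluid limit as a function of time\<close>

lemma ex_\<tau>:
  assumes "t \<ge> 1" shows "\<exists>!x. 0 \<le> x \<and> x < 1 \<and> \<tau> x = t"
proof -
  have "eventually (\<lambda>x. \<tau> x \<ge> t \<and> x \<in> {0<..<1}) (at_left 1)"
    using \<tau>_at_top eventually_at_left_real[of 0 1] by (intro eventually_conj) (auto simp: filterlim_at_top)
  then obtain b where b: "\<tau> b \<ge> t" "0 < b" "b < 1"
    using eventually_happens[of _ "at_left (1::real)"] by (auto simp: trivial_limit_at_left_real)
  have "\<exists>x. 0 \<le> x \<and> x \<le> b \<and> \<tau> x = t"
    using b assms \<tau>_0 by (intro IVT) (auto intro!: DERIV_isCont[OF \<tau>_deriv])
  then obtain x where x: "0 \<le> x" "x < 1" "\<tau> x = t" using b by fastforce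
  moreover have "x' = x" if "0 \<le> x'" "x' < 1" "\<tau> x' = t" for x'
    using \<tau>_strict_mono[of x x'] \<tau>_strict_mono[of x' x] that x by (cases x x' rule: linorder_cases) auto
  ultimately show ?thesis by blast
qed

text \<open>In the limit nothing is frozen up to time 1, that is up to \<open>n / 2\<close> steps,
  in accordance with \<open>\<tau> 0 = 1\<close>; from then on \<open>\<tau>\<close> is
  inverted.\<close>

definition frozen_frac :: "real \<Rightarrow> real" where
  "frozen_frac t = (if t \<le> 1 then 0 else THE x. 0 \<le> x \<and> x < 1 \<and> \<tau> x = t)"

lemma frozen_frac_eq:
  assumes "t \<ge> 1" shows "\<tau> (frozen_frac t) = t"
proof (cases "t = 1")
  case True
  then show ?thesis by (simp add: frozen_frac_def \<tau>_0)
next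
  case False
  then show ?thesis using theI'[OF ex_\<tau>[OF assms]] assms by (simp add: frozen_frac_def)
qed

lemma frozen_frac_range: "0 \<le> frozen_frac t" "frozen_frac t < 1"
  using theI'[OF ex_\<tau>[of t]] by (auto simp: frozen_frac_def)

lemma frozen_frac_mono:
  assumes "s \<le> t" shows "frozen_frac s \<le> frozen_frac t"
proof (cases "s \<le> 1")
  case True
  then show ?thesis using frozen_frac_range(1)[of t] by (simp add: frozen_frac_def)
next
  case False
  show ?thesis
  proof (rule ccontr)
    assume "\<not> ?thesis"
    then have "\<tau> (frozen_frac t) < \<tau> (frozen_frac s)"
      using frozen_frac_range by (intro \<tau>_strict_mono) auto
    then show False using False assms by (simp add: frozen_frac_eq)
  qed
qed

lemma frozen_frac_limit: "filterlim frozen_frac (at_left 1) at_top"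
  unfolding filterlim_at
proof
  show "(frozen_frac \<longlongrightarrow> 1) at_top"
  proof (rule order_tendstoI)
    fix a :: real assume a: "a < 1"
    obtain b where b: "a \<le> b" "0 \<le> b" "b < 1" using a that[of "max a 0"] by auto
    have "frozen_frac t > a" if "t > max 1 (\<tau> b)" for t
    proof (rule ccontr)
      assume "\<not> frozen_frac t > a"
      then have "frozen_frac t \<le> b" using b(1) by simp
      then have "\<tau> (frozen_frac t) \<le> \<tau> b"
        using \<tau>_strict_mono[of "frozen_frac t" b] frozen_frac_range(1)[of t] b(3) by (cases "frozen_frac t = b") auto
      then show False using that by (simp add: frozen_frac_eq)
    qed
    then show "eventually (\<lambda>t. a < frozen_frac t) at_top"
      by (rule eventually_mono[OF eventually_gt_at_top])
  next
    fix a :: real assume "1 < a"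
    then show "eventually (\<lambda>t. frozen_frac t < a) at_top"
      using frozen_frac_range(2) by (auto intro!: always_eventually intro: less_trans)
  qed
  show "eventually (\<lambda>t. frozen_frac t \<in> {..<1} \<and> frozen_frac t \<noteq> 1) at_top"
    using frozen_frac_range(2) by (auto intro!: always_eventually simp: less_imp_neq)
qed

definition v :: "real \<Rightarrow> real" where "v t = 1 - frozen_frac t"

definition y :: "real \<Rightarrow> real" where "y t = v t * exp (- (t * v t))"

text \<open>Rate of decrease of \<open>y\<close>: an isolated vertex is hit from unfrozen vertices
  at rate \<open>v t\<close> and effectively from frozen ones at rate
  \<open>p * (1 - v t)\<close>.\<close>

definition q :: "real \<Rightarrow> real" where "q t = y t * (p + (1 - p) * v t)"

lemma v_range: "0 < v t" "v t \<le> 1"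
  using frozen_frac_range[of t] by (auto simp: v_def)

lemma v_antimono: "s \<le> t \<Longrightarrow> v t \<le> v s"
  using frozen_frac_mono by (simp add: v_def)

text \<open>This puts \<open>t * v t\<close> on the branch on which the tree function inverts
  \<open>x * exp (- x)\<close>. Equality holds at the critical time.\<close>

lemma t_v_le:
  assumes "t \<ge> 0" shows "t * v t \<le> 1"
proof (cases "t \<le> 1")
  case True
  then show ?thesis by (simp add: v_def frozen_frac_def)
next
  case False
  then show ?thesis using \<tau>_bound[OF frozen_frac_range, of t] by (simp add: frozen_frac_eq v_def mult.commute)
qed

lemma y_early: "t \<le> 1 \<Longrightarrow> y t = exp (- t)" "t \<le> 1 \<Longrightarrow> q t = exp (- t)"
  by (simp_all add: y_def q_def v_def frozen_frac_def)

lemma y_late: "t \<ge> 1 \<Longrightarrow> y t = Y (frozen_frac t)" "t \<ge> 1 \<Longrightarrow> q t = Q (frozen_frac t)"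
  by (simp_all add: y_def q_def v_def Y_def Q_def frozen_frac_eq algebra_simps)

lemma y_pos: "y t > 0"
  using v_range(1)[of t] by (simp add: y_def)

lemma y_le_1: "t \<ge> 0 \<Longrightarrow> y t \<le> 1"
  unfolding y_def using v_range[of t] mult_mono[of "v t" 1 "exp (- (t * v t))" 1] by simp

lemma q_nonneg: "q t \<ge> 0"
  unfolding q_def using y_pos[of t] v_range(1)[of t] p_pos p_le_1 by (intro mult_nonneg_nonneg add_nonneg_nonneg) auto

lemma q_le_1: "t \<ge> 0 \<Longrightarrow> q t \<le> 1"
proof -
  assume t: "t \<ge> 0"
  have "(1 - p) * v t \<le> (1 - p) * 1" using v_range(2) p_le_1 by (intro mult_left_mono) auto
  then have "p + (1 - p) * v t \<le> 1" by simp
  then show ?thesis unfolding q_def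
    using mult_mono[of "y t" 1 "p + (1 - p) * v t" 1] y_le_1[OF t] y_pos[of t] v_range(1)[of t] p_pos p_le_1 by simp
qed

lemma y_increment:
  assumes "s \<le> t"
  shows "(t - s) * q t \<le> y s - y t \<and> y s - y t \<le> (t - s) * q s"
proof -
  have early: "(t - s) * q t \<le> y s - y t \<and> y s - y t \<le> (t - s) * q s" if "s \<le> t" "t \<le> 1" for s t
  proof -
    have "exp (- t) * (1 + (t - s)) \<le> exp (- t) * exp (t - s)"
      using exp_ge_add_one_self[of "t - s"] by (intro mult_left_mono) auto
    moreover have "exp (- s) * (1 + (s - t)) \<le> exp (- s) * exp (s - t)"
      using exp_ge_add_one_self[of "s - t"] by (intro mult_left_mono) auto
    ultimately show ?thesis using that by (simp add: y_early exp_add[symmetric] algebra_simps)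
  qed
  have late: "(t - s) * q t \<le> y s - y t \<and> y s - y t \<le> (t - s) * q s" if "s \<le> t" "1 \<le> s" for s t
    using Y_increment[of "frozen_frac s" "frozen_frac t"] frozen_frac_range[of s] frozen_frac_range[of t]
      frozen_frac_mono[OF that(1)] that by (simp add: y_late frozen_frac_eq)
  consider "t \<le> 1" | "1 \<le> s" | "s \<le> 1" "1 \<le> t" by linarith
  then show ?thesis
  proof cases
    case 3
    \<comment> \<open>An interval containing time 1 is cut there; monotonicity of \<open>q\<close>
      transfers the rates at its ends to the two pieces.\<close>
    have "q 1 \<le> q s" using 3 by (simp add: y_early)
    have "q t \<le> q 1" using Q_antimono[of 0 "frozen_frac t"] frozen_frac_range[of t] 3
      by (simp add: y_late frozen_frac_def)
    have "(t - 1) * q t + (1 - s) * q t \<le> (t - 1) * q t + (1 - s) * q 1"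
      using \<open>q t \<le> q 1\<close> 3 by (intro add_left_mono mult_left_mono) auto
    moreover have "(t - 1) * q 1 + (1 - s) * q s \<le> (t - 1) * q s + (1 - s) * q s"
      using \<open>q 1 \<le> q s\<close> 3 by (intro add_right_mono mult_left_mono) auto
    moreover have "(t - s) * z = (t - 1) * z + (1 - s) * z" for z by (simp add: algebra_simps)
    ultimately show ?thesis using early[of s 1] late[of 1 t] 3 by (smt (verit))
  qed (use early late assms in auto)
qed

lemma v_limit: "(v \<longlongrightarrow> 0) at_top"
proof -
  have "(frozen_frac \<longlongrightarrow> 1) at_top" using frozen_frac_limit by (simp add: filterlim_at)
  from tendsto_diff[OF tendsto_const[of 1] this] show ?thesis by (simp add: v_def[abs_def])
qed

text \<open>At frozen fraction \<open>x\<close>, \<open>y\<close> is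
  \<open>exp (ln (1 - x) - (1 - x) * \<tau> x)\<close>. The factor \<open>exp (p * t)\<close>
  completes the logarithm to \<open>p * \<tau> x + ln (1 - x)\<close>, and
  \<open>(1 - x) * \<tau> x\<close> vanishes because \<open>\<tau>\<close> diverges only
  logarithmically.\<close>

lemma y_limit: "((\<lambda>t. y t * exp (p * t)) \<longlongrightarrow> exp (- \<kappa>)) at_top"
proof -
  have 1: "((\<lambda>x. (1 - x) * (p * \<tau> x + ln (1 - x))) \<longlongrightarrow> (1 - 1) * (- \<kappa>)) (at_left 1)"
    by (intro tendsto_intros p\<tau>_ln_limit)
  have 2: "((\<lambda>x::real. (1 - x) * ln (1 - x)) \<longlongrightarrow> 0) (at_left 1)" by real_asymp
  from tendsto_diff[OF 1 2] have "((\<lambda>x. (1 - x) * (p * \<tau> x)) \<longlongrightarrow> 0) (at_left 1)" by (simp add: algebra_simps)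
  from tendsto_mult[OF this tendsto_const[of "1 / p"]]
  have 3: "((\<lambda>x. (1 - x) * \<tau> x) \<longlongrightarrow> 0) (at_left 1)" using p_pos by simp
  have "((\<lambda>x. exp (p * \<tau> x + ln (1 - x) - (1 - x) * \<tau> x)) \<longlongrightarrow> exp (- \<kappa> - 0)) (at_left 1)"
    by (intro tendsto_intros p\<tau>_ln_limit 3)
  then have "((\<lambda>t. exp (p * \<tau> (frozen_frac t) + ln (1 - frozen_frac t) - (1 - frozen_frac t) * \<tau> (frozen_frac t))) \<longlongrightarrow> exp (- \<kappa> - 0)) at_top"
    by (rule filterlim_compose[OF _ frozen_frac_limit])
  moreover have "eventually (\<lambda>t. exp (p * \<tau> (frozen_frac t) + ln (1 - frozen_frac t) - (1 - frozen_frac t) * \<tau> (frozen_frac t)) = y t * exp (p * t)) at_top"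
    using eventually_ge_at_top[of 1]
  proof eventually_elim
    case (elim t)
    then show ?case using v_range(1)[of t]
      by (simp add: frozen_frac_eq y_def v_def exp_add exp_diff exp_minus field_simps)
  qed
  ultimately have "((\<lambda>t. y t * exp (p * t)) \<longlongrightarrow> exp (- \<kappa> - 0)) at_top"
    by (rule Lim_transform_eventually)
  then show ?thesis by simp
qed

lemma tree_series:
  assumes "t \<ge> 0"
  shows "(\<lambda>k. tree_coeff k * (t * y t) ^ k) sums (t * v t)"
proof -
  have "t * y t = (t * v t) * exp (- (t * v t))" by (simp add: y_def)
  moreover have "0 \<le> t * v t" using v_range(1)[of t] assms by simp
  ultimately show ?thesis using tree_function_sums[OF _ t_v_le[OF assms]] by (simp only:)
qed

end

section \<open>Large trees carry little mass\<close>

context frozen_process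
begin

definition bigtrees :: "nat \<Rightarrow> multigraph \<Rightarrow> nat set set" where
  "bigtrees K G = {C \<in> components n G. is_tree G C \<and> card C > K}"

definition in_big :: "nat \<Rightarrow> multigraph \<Rightarrow> nat set" where
  "in_big K G = {v \<in> unfrozen G. card (component G v) > K}"

text \<open>Component sizes in \<open>(K / 2, K]\<close>: two trees of size at most \<open>K\<close>
  can merge into one above \<open>K\<close> only if one of them is of this kind.\<close>

definition in_mid :: "nat \<Rightarrow> multigraph \<Rightarrow> nat set" where
  "in_mid K G = {v \<in> unfrozen G. K < 2 * card (component G v) \<and> card (component G v) \<le> K}"

abbreviation nbig :: "nat \<Rightarrow> multigraph \<Rightarrow> nat" where "nbig K G \<equiv> card (in_big K G)"

abbreviation nmid :: "nat \<Rightarrow> multigraph \<Rightarrow> nat" where "nmid K G \<equiv> card (in_mid K G)"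

lemma finite_big_mid [simp]: "finite (in_big K G)" "finite (in_mid K G)" "finite (bigtrees K G)"
  by (simp_all add: in_big_def in_mid_def bigtrees_def components_def)

lemma in_big_mid_subset: "in_big K G \<subseteq> unfrozen G" "in_mid K G \<subseteq> unfrozen G"
  by (auto simp: in_big_def in_mid_def)

lemma bigtreesE:
  assumes "C \<in> bigtrees K G"
  obtains v where "v \<in> unfrozen G" "C = component G v" "card C > K"
  using assms by (auto simp: bigtrees_def components_def unfrozen_def)

lemma bigtreesI: "v \<in> in_big K G \<Longrightarrow> component G v \<in> bigtrees K G"
  by (auto simp: in_big_def unfrozen_def bigtrees_def components_def)

lemma bigtrees_add_edge_other:
  assumes "v \<in> unfrozen (add_mset {x, y} G)" "card (component (add_mset {x, y} G) v) > K"
    "v \<notin> component G x" "v \<notin> component G y"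
  shows "component (add_mset {x, y} G) v \<in> bigtrees K G - {component G x, component G y}"
proof -
  have c: "component (add_mset {x, y} G) v = component G v" using add_edge_other(1)[OF assms(3,4)] .
  have "in_tree G v" using assms(1) in_tree_add_edge_other(1)[OF assms(3,4)] by (simp add: unfrozen_def)
  then have "v \<in> in_big K G" using assms(1,2) c by (simp add: in_big_def unfrozen_def)
  then have "component G v \<in> bigtrees K G" by (rule bigtreesI)
  moreover have "component G v \<noteq> component G x" "component G v \<noteq> component G y" using assms(3,4) by auto
  ultimately show ?thesis unfolding c by blast
qed

text \<open>An edge between vertices of big trees always destroys one, by a merger or by a cycle,
  and the number can increase only if an endpoint lies in \<open>in_mid\<close>. Gluing a big tree
  to a unicycle destroys it as well, which only helps an upper bound.\<close>

lemma card_bigtrees_add_edge: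
  assumes "valid n G" "x \<noteq> y" "x \<in> {1..n}" "y \<in> {1..n}" "x \<in> unfrozen G"
  shows "real (card (bigtrees K (add_mset {x, y} G))) - real (card (bigtrees K G)) \<le>
    - of_bool (x \<in> in_big K G \<and> y \<in> in_big K G) + of_bool (x \<in> in_mid K G \<or> y \<in> in_mid K G)"
proof -
  let ?G' = "add_mset {x, y} G" and ?A = "component G x" and ?B = "component G y"
  let ?T = "bigtrees K G" and ?T' = "bigtrees K (add_mset {x, y} G)"
  have l: "loopless G" using assms(1) by (rule valid_loopless)
  have Tx: "in_tree G x" using assms(5) by (simp add: unfrozen_def)
  have AT: "x \<in> in_big K G \<Longrightarrow> ?A \<in> ?T" and BT: "y \<in> in_big K G \<Longrightarrow> ?B \<in> ?T" by (rule bigtreesI, assumption)+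
  consider "y \<notin> unfrozen G" | "y \<in> unfrozen G" "y \<in> ?A" | "y \<in> unfrozen G" "y \<notin> ?A" by blast
  then show ?thesis
  proof cases
    case 1
    have xx: "x \<notin> unfrozen ?G'" using unfrozen_add_edge_aux(2)[OF assms(1,5) 1 assms(4)] .
    have "?T' \<subseteq> ?T"
    proof
      fix C assume "C \<in> ?T'"
      then obtain w where w: "w \<in> unfrozen ?G'" "C = component ?G' w" "card C > K" by (rule bigtreesE)
      have "w \<notin> ?A \<union> ?B"
      proof
        assume "w \<in> ?A \<union> ?B"
        then have "component ?G' w = ?A \<union> ?B" "component ?G' x = ?A \<union> ?B"
          using component_add_edge[of x y G w] component_add_edge[of x y G x] by auto
        then have "in_tree ?G' x" using w(1) by (simp add: unfrozen_def)
        then show False using xx assms(3) by (simp add: unfrozen_def)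
      qed
      then show "C \<in> ?T" using bigtrees_add_edge_other[OF w(1)] w(2,3) by blast
    qed
    then have "card ?T' \<le> card ?T" by (intro card_mono) auto
    moreover have "y \<notin> in_big K G" using 1 in_big_mid_subset by blast
    ultimately show ?thesis by simp
  next
    case 2
    have "?T' \<subseteq> ?T - {?A, ?B}"
    proof
      fix C assume "C \<in> ?T'"
      then obtain w where w: "w \<in> unfrozen ?G'" "C = component ?G' w" "card C > K" by (rule bigtreesE)
      have "w \<notin> ?A" using in_tree_add_edge_same(1)[OF 2(2) Tx, of w] w(1) by (auto simp: unfrozen_def)
      moreover have "?B = ?A" using 2(2) by (rule component_memD)
      ultimately show "C \<in> ?T - {?A, ?B}" using bigtrees_add_edge_other[OF w(1)] w(2,3) by blast
    qed
    then have sub: "card ?T' \<le> card (?T - {?A, ?B})" by (intro card_mono) auto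
    show ?thesis
    proof (cases "x \<in> in_big K G")
      case True
      have "card (?T - {?A, ?B}) < card ?T" using AT[OF True] by (intro psubset_card_mono) auto
      then show ?thesis using sub by (auto simp: of_bool_def)
    next
      case False
      have "card (?T - {?A, ?B}) \<le> card ?T" by (intro card_mono) auto
      then show ?thesis using sub False by (auto simp: of_bool_def)
    qed
  next
    case 3
    have ne: "?A \<noteq> ?B" using 3(2) by auto
    have sub: "?T' \<subseteq> (?T - {?A, ?B}) \<union> (if card ?A + card ?B > K then {?A \<union> ?B} else {})"
    proof
      fix C assume "C \<in> ?T'"
      then obtain w where w: "w \<in> unfrozen ?G'" "C = component ?G' w" "card C > K" by (rule bigtreesE)
      show "C \<in> (?T - {?A, ?B}) \<union> (if card ?A + card ?B > K then {?A \<union> ?B} else {})"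
      proof (cases "w \<in> ?A \<union> ?B")
        case True
        then have "C = ?A \<union> ?B" "card (?A \<union> ?B) = card ?A + card ?B"
          using add_edge_join(1,3)[OF l 3(2) True] w(2) by auto
        then show ?thesis using w(3) by simp
      next
        case False
        then show ?thesis using bigtrees_add_edge_other[OF w(1)] w(2,3) by blast
      qed
    qed
    have le: "card ?T' \<le> card (?T - {?A, ?B}) + of_bool (card ?A + card ?B > K)"
    proof -
      have "card ?T' \<le> card ((?T - {?A, ?B}) \<union> (if card ?A + card ?B > K then {?A \<union> ?B} else {}))"
        using sub by (intro card_mono) auto
      also have "\<dots> \<le> card (?T - {?A, ?B}) + card (if card ?A + card ?B > K then {?A \<union> ?B} else {})"
        by (rule card_Un_le)
      finally show ?thesis by (auto split: if_splits)
    qed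
    have big_iff: "x \<in> in_big K G \<longleftrightarrow> card ?A > K" "y \<in> in_big K G \<longleftrightarrow> card ?B > K"
      using assms(5) 3(1) by (auto simp: in_big_def)
    have mid_iff: "x \<in> in_mid K G \<longleftrightarrow> K < 2 * card ?A \<and> card ?A \<le> K" "y \<in> in_mid K G \<longleftrightarrow> K < 2 * card ?B \<and> card ?B \<le> K"
      using assms(5) 3(1) by (auto simp: in_mid_def)
    have le0: "card (?T - {?A, ?B}) \<le> card ?T" by (intro card_mono) auto
    consider "card ?A > K" "card ?B > K" | "card ?A > K" "card ?B \<le> K" | "card ?A \<le> K" "card ?B > K"
      | "card ?A \<le> K" "card ?B \<le> K" by linarith
    then show ?thesis
    proof cases
      case 1
      have s: "{?A, ?B} \<subseteq> ?T" using AT BT big_iff 1 by auto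
      have "card {?A, ?B} \<le> card ?T" using s by (intro card_mono) auto
      moreover have "card (?T - {?A, ?B}) = card ?T - 2" using card_Diff_subset[OF _ s] ne by simp
      ultimately have "card ?T' + 1 \<le> card ?T" using le ne 1 by (simp add: of_bool_def split: if_splits)
      then have "real (card ?T') + 1 \<le> real (card ?T)" by linarith
      then show ?thesis using 1 by (simp add: big_iff mid_iff)
    next
      case 2
      have "card (?T - {?A, ?B}) < card ?T" using AT big_iff 2 by (intro psubset_card_mono) auto
      then have "card ?T' \<le> card ?T" using le by (simp add: of_bool_def split: if_splits)
      then show ?thesis using 2 by (simp add: big_iff mid_iff)
    next
      case 3
      have "card (?T - {?A, ?B}) < card ?T" using BT big_iff 3 by (intro psubset_card_mono) auto
      then have "card ?T' \<le> card ?T" using le by (simp add: of_bool_def split: if_splits)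
      then show ?thesis using 3 by (simp add: big_iff mid_iff)
    next
      case 4
      show ?thesis
      proof (cases "card ?A + card ?B > K")
        case True
        then have "x \<in> in_mid K G \<or> y \<in> in_mid K G" using 4 mid_iff by linarith
        moreover have "card ?T' \<le> card ?T + 1" using le le0 by (simp add: of_bool_def split: if_splits)
        ultimately show ?thesis using 4 by (simp add: big_iff)
      next
        case False
        then have "card ?T' \<le> card ?T" using le le0 by simp
        then show ?thesis using 4 by (simp add: big_iff)
      qed
    qed
  qed
qed

lemma real_choose_two: "real (w choose 2) = real w * (real w - 1) / 2"
  by (cases w) (simp_all add: choose_two real_of_nat_div algebra_simps)

lemma E_uminus: "E m (\<lambda>G. - f G) = - E m f"
  using E_cmult[of m "- 1" f] by simp

lemma sum_accept_inside:
  assumes "valid n G" "W \<subseteq> unfrozen G"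
  shows "(\<Sum>e\<in>edges. accept G e * of_bool (e \<subseteq> W)) = real (card W) * (real (card W) - 1) / 2"
proof -
  have Wn: "W \<subseteq> {1..n}" using assms(2) by (auto simp: unfrozen_def)
  have finW: "finite W" by (rule finite_subset[OF assms(2)]) simp
  have "(\<Sum>e\<in>edges. accept G e * of_bool (e \<subseteq> W)) = (\<Sum>e\<in>{e. e \<subseteq> W \<and> card e = 2}. 1)"
  proof (rule sum.mono_neutral_cong_right)
    show "{e. e \<subseteq> W \<and> card e = 2} \<subseteq> edges" using Wn by (auto simp: possible_edges_def)
    show "\<forall>e\<in>edges - {e. e \<subseteq> W \<and> card e = 2}. accept G e * of_bool (e \<subseteq> W) = 0"
      by (auto simp: possible_edges_def)
    fix e assume e: "e \<in> {e. e \<subseteq> W \<and> card e = 2}"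
    then have "\<forall>v\<in>e. in_tree G v" using assms(2) by (auto simp: unfrozen_def)
    then show "accept G e * of_bool (e \<subseteq> W) = 1" using e by (simp add: accept_def)
  qed simp
  also have "\<dots> = real (card W choose 2)" using finW by (simp add: n_subsets)
  also have "\<dots> = real (card W) * (real (card W) - 1) / 2" by (rule real_choose_two)
  finally show ?thesis .
qed

lemma hit_weight_le: "u \<le> n \<Longrightarrow> hit_weight w u \<le> real w * real n"
proof -
  assume u: "u \<le> n"
  have "p * (real n - real u) \<le> 1 * (real n - real u)" using p_le_1 u by (intro mult_right_mono) auto
  then have "real w * (real u + p * (real n - real u)) \<le> real w * real n" by (intro mult_left_mono) auto
  moreover have "real w * (real w + 1) / 2 \<ge> 0" by simp
  moreover have "hit_weight w u = real w * (real u + p * (real n - real u)) - real w * (real w + 1) / 2"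
    by (simp add: hit_weight_def algebra_simps)
  ultimately show ?thesis by linarith
qed

lemma gen_bigtrees:
  assumes "valid n G"
  shows "gen (\<lambda>G. real (card (bigtrees K G))) G \<le>
    - (real (nbig K G) * (real (nbig K G) - 1) / 2) + real (nmid K G) * real n"
proof -
  have "gen (\<lambda>G. real (card (bigtrees K G))) G \<le>
    (\<Sum>e\<in>edges. accept G e * (- of_bool (e \<subseteq> in_big K G) + of_bool (e \<inter> in_mid K G \<noteq> {})))"
  proof (rule gen_le[OF assms])
    fix e assume e: "e \<in> edges" "accept G e \<noteq> 0"
    obtain x y where xy: "e = {x, y}" "x \<noteq> y" "x \<in> {1..n}" "y \<in> {1..n}" "x \<in> unfrozen G"
      using accept_nonzeroE[OF assms e] .
    have "e \<subseteq> in_big K G \<longleftrightarrow> x \<in> in_big K G \<and> y \<in> in_big K G"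
      "e \<inter> in_mid K G \<noteq> {} \<longleftrightarrow> x \<in> in_mid K G \<or> y \<in> in_mid K G" using xy(1) by auto
    then show "real (card (bigtrees K (add_mset e G))) - real (card (bigtrees K G)) \<le>
       - of_bool (e \<subseteq> in_big K G) + of_bool (e \<inter> in_mid K G \<noteq> {})"
      using card_bigtrees_add_edge[OF assms xy(2-5), of K] xy(1) by simp
  qed
  also have "\<dots> = - (\<Sum>e\<in>edges. accept G e * of_bool (e \<subseteq> in_big K G)) +
     (\<Sum>e\<in>edges. accept G e * of_bool (e \<inter> in_mid K G \<noteq> {}))"
    by (simp only: distrib_left sum.distrib mult_minus_right sum_negf)
  also have "\<dots> \<le> - (real (nbig K G) * (real (nbig K G) - 1) / 2) + real (nmid K G) * real n"
    unfolding sum_accept_inside[OF assms in_big_mid_subset(1)] sum_accept_hitting[OF assms in_big_mid_subset(2)]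
    using hit_weight_le[OF nunf_le] by simp
  finally show ?thesis .
qed

section \<open>Time averages of the mass in large trees\<close>

lemma E_telescope: "E m \<Phi> = \<Phi> {#} + (\<Sum>i<m. E i (gen \<Phi>)) / N"
proof (induction m)
  case (Suc m)
  then show ?case by (simp add: E_Suc E_add E_divide add_divide_distrib)
qed simp

lemma sum_nbig_le_nmid:
  assumes "K \<ge> 1"
  shows "(\<Sum>i<m. E i (\<lambda>G. real (nbig K G) * (real (nbig K G) - 1) / 2)) \<le> (\<Sum>i<m. E i (\<lambda>G. real (nmid K G) * real n))"
proof -
  \<comment> \<open>Initially all components have size one, which is where \<open>K \<ge> 1\<close>
    enters.\<close>
  have "bigtrees K {#} = {}" using assms by (auto simp: bigtrees_def components_def)
  then have "0 \<le> (\<Sum>i<m. E i (gen (\<lambda>G. real (card (bigtrees K G))))) / N"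
    using E_telescope[of m "\<lambda>G. real (card (bigtrees K G))"] E_nonneg[of "\<lambda>G. real (card (bigtrees K G))" m] by simp
  then have "0 \<le> (\<Sum>i<m. E i (gen (\<lambda>G. real (card (bigtrees K G)))))" using N_pos by (simp add: zero_le_divide_iff)
  also have "\<dots> \<le> (\<Sum>i<m. E i (\<lambda>G. - (real (nbig K G) * (real (nbig K G) - 1) / 2) + real (nmid K G) * real n))"
    by (intro sum_mono E_mono gen_bigtrees)
  also have "\<dots> = - (\<Sum>i<m. E i (\<lambda>G. real (nbig K G) * (real (nbig K G) - 1) / 2)) + (\<Sum>i<m. E i (\<lambda>G. real (nmid K G) * real n))"
    by (simp only: E_add E_uminus sum.distrib sum_negf)
  finally show ?thesis by simp
qed

lemma sum_nmid_dyadic: "(\<Sum>j=1..J. nmid (2 ^ j) G) \<le> n"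
proof -
  have "(\<Sum>j=1..J. nmid (2 ^ j) G) = card (\<Union>j\<in>{1..J}. in_mid (2 ^ j) G)"
  proof (rule card_UN_disjoint[symmetric])
    have "in_mid (2 ^ i) G \<inter> in_mid (2 ^ j) G = {}" if "i < j" for i j :: nat
    proof -
      have "(2::nat) ^ Suc i \<le> 2 ^ j" using that by (intro power_increasing) auto
      then show ?thesis by (auto simp: in_mid_def)
    qed
    then show "\<forall>i\<in>{1..J}. \<forall>j\<in>{1..J}. i \<noteq> j \<longrightarrow> in_mid (2 ^ i) G \<inter> in_mid (2 ^ j) G = {}"
      by (metis Int_commute linorder_neqE_nat)
  qed auto
  also have "\<dots> \<le> card (unfrozen G)" by (intro card_mono UN_least in_big_mid_subset(2) finite_unfrozen)
  finally show ?thesis using nunf_le[of G] by linarith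
qed

lemma nbig_antimono: "K \<le> L \<Longrightarrow> nbig L G \<le> nbig K G"
  by (intro card_mono) (auto simp: in_big_def)

text \<open>The number of trees larger than \<open>K\<close> is nonnegative, so on average the rate at which they
  are destroyed, about \<open>nbig\<^sup>2 / n\<^sup>2\<close>, is at most the rate \<open>nmid / n\<close> at which they are
  created. The latter rates, for \<open>K = 2\<^sup>1, \<dots>, 2\<^sup>J\<close>, sum to at most one.\<close>

lemma sum_nbig_squared:
  shows "real J * (\<Sum>i<m. E i (\<lambda>G. (real (nbig (2 ^ J) G))\<^sup>2)) \<le> 2 * (real n)\<^sup>2 * real m + real J * real m * real n"
proof -
  let ?W = "\<lambda>K G. real (nbig K G) * (real (nbig K G) - 1) / 2"
  have "real J * (\<Sum>i<m. E i (?W (2 ^ J))) = (\<Sum>j=1..J. \<Sum>i<m. E i (?W (2 ^ J)))" by simp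
  also have "\<dots> \<le> (\<Sum>j=1..J. \<Sum>i<m. E i (?W (2 ^ j)))"
  proof (intro sum_mono E_mono)
    fix j i G assume "j \<in> {1..J}"
    then have "nbig (2 ^ J) G \<le> nbig (2 ^ j) G" by (intro nbig_antimono power_increasing) auto
    then have "nbig (2 ^ J) G choose 2 \<le> nbig (2 ^ j) G choose 2" by (rule binomial_right_mono)
    moreover have "?W K G = real (nbig K G choose 2)" for K by (rule real_choose_two[symmetric])
    ultimately show "?W (2 ^ J) G \<le> ?W (2 ^ j) G" by simp
  qed
  also have "\<dots> \<le> (\<Sum>j=1..J. \<Sum>i<m. E i (\<lambda>G. real (nmid (2 ^ j) G) * real n))"
    by (intro sum_mono sum_nbig_le_nmid) simp
  also have "\<dots> = (\<Sum>i<m. E i (\<lambda>G. \<Sum>j=1..J. real (nmid (2 ^ j) G) * real n))"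
    by (subst sum.swap) (simp add: E_setsum)
  also have "\<dots> \<le> (\<Sum>i<m. E i (\<lambda>G. real n * real n))"
  proof (intro sum_mono E_mono)
    fix i G
    have "(\<Sum>j=1..J. real (nmid (2 ^ j) G)) \<le> real n"
      using sum_nmid_dyadic[of G J] by (metis of_nat_le_iff of_nat_sum)
    then show "(\<Sum>j=1..J. real (nmid (2 ^ j) G) * real n) \<le> real n * real n"
      unfolding sum_distrib_right[symmetric] by (rule mult_right_mono) simp
  qed
  finally have 1: "real J * (\<Sum>i<m. E i (?W (2 ^ J))) \<le> real m * (real n)\<^sup>2" by (simp add: power2_eq_square)
  have "(\<Sum>i<m. E i (\<lambda>G. (real (nbig (2 ^ J) G))\<^sup>2)) \<le> (\<Sum>i<m. E i (\<lambda>G. 2 * ?W (2 ^ J) G + real n))"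
  proof (intro sum_mono E_mono)
    fix i G
    have "nbig (2 ^ J) G \<le> n" using card_mono[OF finite_unfrozen in_big_mid_subset(1)] nunf_le order_trans by blast
    then show "(real (nbig (2 ^ J) G))\<^sup>2 \<le> 2 * ?W (2 ^ J) G + real n" by (simp add: power2_eq_square field_simps)
  qed
  also have "\<dots> = 2 * (\<Sum>i<m. E i (?W (2 ^ J))) + real m * real n"
    by (simp only: E_add E_cmult E_const sum.distrib sum_distrib_left sum_constant card_lessThan)
  finally have "real J * (\<Sum>i<m. E i (\<lambda>G. (real (nbig (2 ^ J) G))\<^sup>2)) \<le>
     real J * (2 * (\<Sum>i<m. E i (?W (2 ^ J))) + real m * real n)"
    by (intro mult_left_mono) auto
  also have "\<dots> = 2 * (real J * (\<Sum>i<m. E i (?W (2 ^ J)))) + real J * real m * real n"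
    by (simp add: distrib_left)
  also have "\<dots> \<le> 2 * (real m * (real n)\<^sup>2) + real J * real m * real n" using 1 by simp
  finally show ?thesis by (simp add: mult_ac)
qed

text \<open>The mass in large trees is set apart because the approximation of tree counts is not
  uniform in their size.\<close>

lemma nunf_split: "valid n G \<Longrightarrow> nunf G = nbig K G + (\<Sum>k=1..K. k * tree_count n k G)"
proof -
  assume v: "valid n G"
  let ?V = "\<lambda>k. {v \<in> unfrozen G. card (component G v) = k}"
  have pos: "card (component G v) \<ge> 1" for v
    using finite_component[OF valid_loopless[OF v], of v] by (auto simp: Suc_le_eq card_gt_0_iff)
  have k: "card (?V k) = k * tree_count n k G" if "k \<ge> 1" for k
  proof -
    have "\<Union>(ktrees k G) = ?V k"
    proof (intro equalityI subsetI)
      fix w assume "w \<in> \<Union>(ktrees k G)"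
      then obtain C where C: "C \<in> ktrees k G" "w \<in> C" by blast
      from C(1) obtain u where u: "u \<in> {1..n}" "C = component G u" "in_tree G u" "card C = k" by (rule ktreesE)
      have "u \<in> unfrozen G" using u by (simp add: unfrozen_def)
      then have "w \<in> unfrozen G" by (rule unfrozen_component[OF v]) (use C(2) u(2) in simp)
      moreover have "component G w = C" using component_memD[of w G u] C(2) u(2) by simp
      ultimately show "w \<in> ?V k" using u by simp
    next
      fix w assume "w \<in> ?V k"
      then have "component G w \<in> ktrees k G" by (auto simp: ktrees_def components_def unfrozen_def)
      then show "w \<in> \<Union>(ktrees k G)" by (rule UnionI) (rule component_refl)
    qed
    moreover have "k * card (ktrees k G) = card (\<Union>(ktrees k G))"
    proof (rule card_partition)
      show "finite (\<Union>(ktrees k G))" unfolding \<open>\<Union>(ktrees k G) = ?V k\<close> by simp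
      show "\<And>C. C \<in> ktrees k G \<Longrightarrow> card C = k" by (simp add: ktrees_def)
      show "C1 \<inter> C2 = {}" if C12: "C1 \<in> ktrees k G" "C2 \<in> ktrees k G" "C1 \<noteq> C2" for C1 C2
      proof -
        obtain u1 u2 where "C1 = component G u1" "C2 = component G u2"
          using C12(1,2) by (auto simp: ktrees_def components_def)
        then show ?thesis using C12(3) component_disjoint by simp
      qed
    qed simp
    ultimately show ?thesis by (simp add: tree_count_eq)
  qed
  have "unfrozen G = in_big K G \<union> (\<Union>k\<in>{1..K}. ?V k)"
  proof (intro equalityI subsetI)
    fix w assume "w \<in> unfrozen G"
    then show "w \<in> in_big K G \<union> (\<Union>k\<in>{1..K}. ?V k)" using pos[of w] by (cases "card (component G w) > K") (auto simp: in_big_def)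
  qed (auto simp: in_big_def)
  moreover have "card (in_big K G \<union> (\<Union>k\<in>{1..K}. ?V k)) = nbig K G + card (\<Union>k\<in>{1..K}. ?V k)"
    by (rule card_Un_disjoint) (auto simp: in_big_def)
  moreover have "card (\<Union>k\<in>{1..K}. ?V k) = (\<Sum>k=1..K. card (?V k))"
    by (rule card_UN_disjoint) auto
  moreover have "(\<Sum>k=1..K. card (?V k)) = (\<Sum>k=1..K. k * tree_count n k G)"
    by (rule sum.cong) (use k in auto)
  ultimately show ?thesis by metis
qed

end

section \<open>Poisson convergence from factorial moments\<close>

text \<open>Interchange of limits. It serves for the truncated inclusion-exclusion, for truncated
  moments, and for the fixed time up to which the fluid limit is used.\<close>

lemma approx_tendsto:
  fixes x :: "nat \<Rightarrow> real"
  assumes a: "\<And>M. a M \<longlonglongrightarrow> b M" and b: "b \<longlonglongrightarrow> y"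
    and e: "\<And>M. e M \<longlonglongrightarrow> E M" and E: "E \<longlonglongrightarrow> 0"
    and le: "\<And>M. eventually (\<lambda>n. \<bar>x n - a M n\<bar> \<le> e M n) sequentially"
  shows "x \<longlonglongrightarrow> y"
proof (rule LIMSEQ_I)
  fix r :: real assume r: "r > 0"
  have "eventually (\<lambda>M. dist (b M) y < r / 4 \<and> E M < r / 4) sequentially"
    using tendstoD[OF b, of "r / 4"] order_tendstoD(2)[OF E, of "r / 4"] r by (intro eventually_conj) auto
  then obtain M where M: "dist (b M) y < r / 4" "E M < r / 4" by (auto simp: eventually_sequentially)
  have "eventually (\<lambda>n. dist (a M n) (b M) < r / 4 \<and> e M n < r / 4 \<and> \<bar>x n - a M n\<bar> \<le> e M n) sequentially"
    using tendstoD[OF a[of M], of "r / 4"] order_tendstoD(2)[OF e M(2)] le[of M] r by (intro eventually_conj) auto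
  then have "eventually (\<lambda>n. norm (x n - y) < r) sequentially"
  proof eventually_elim
    case (elim n)
    then show ?case using M(1) unfolding dist_real_def real_norm_def by linarith
  qed
  then show "\<exists>no. \<forall>n\<ge>no. norm (x n - y) < r" by (simp add: eventually_sequentially)
qed

section \<open>Bonferroni inequalities\<close>

lemma sum_alternating_choose:
  "(\<Sum>r<Suc R. (- 1) ^ r * real (Suc d choose r)) = (- 1) ^ R * real (d choose R)"
proof (induction R)
  case (Suc R)
  have "(\<Sum>r<Suc (Suc R). (- 1) ^ r * real (Suc d choose r)) =
    (- 1) ^ R * real (d choose R) + (- 1) ^ Suc R * real (Suc d choose Suc R)"
    by (subst sum.lessThan_Suc) (simp only: Suc)
  then show ?case by (simp add: algebra_simps)
qed simp

lemma partial_alternating_choose: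
  "\<bar>(\<Sum>r<R. (- 1) ^ r * real (d choose r)) - of_bool (d = 0)\<bar> \<le> real (d choose R)"
proof (cases R)
  case 0
  then show ?thesis by simp
next
  case (Suc R')
  show ?thesis
  proof (cases d)
    case 0
    have "(\<Sum>r<Suc R'. (- 1) ^ r * real (0 choose r)) = 1" by (subst sum.lessThan_Suc_shift) simp
    then show ?thesis using 0 Suc by simp
  next
    case (Suc d')
    have "\<bar>(- 1) ^ R' * real (d' choose R')\<bar> = real (d' choose R')" by (simp add: abs_mult)
    then show ?thesis unfolding \<open>R = Suc R'\<close> Suc sum_alternating_choose by simp
  qed
qed

text \<open>Factoring out \<open>x choose j\<close> reduces the claim to \<open>j = 0\<close> with
  \<open>x - j\<close> in place of \<open>x\<close>. There, truncated alternating sums along a row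
  of Pascal's triangle are again binomial coefficients up to sign.\<close>

lemma Bonferroni_choose:
  "\<bar>(\<Sum>r<R. (- 1) ^ r * real ((j + r) choose j) * real (x choose (j + r))) - of_bool (x = j)\<bar> \<le>
     real ((j + R) choose j) * real (x choose (j + R))"
proof -
  have 1: "real ((j + r) choose j) * real (x choose (j + r)) = real (x choose j) * real ((x - j) choose r)" for r
  proof (cases "j + r \<le> x")
    case True
    then show ?thesis using choose_mult[of j "j + r" x] by (simp add: mult.commute flip: of_nat_mult)
  next
    case False
    then show ?thesis by (cases "x < j") (simp_all add: binomial_eq_0)
  qed
  have "(\<Sum>r<R. (- 1) ^ r * real ((j + r) choose j) * real (x choose (j + r))) - of_bool (x = j) =
     real (x choose j) * ((\<Sum>r<R. (- 1) ^ r * real ((x - j) choose r)) - of_bool (x - j = 0))"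
  proof -
    have "(\<Sum>r<R. (- 1) ^ r * real ((j + r) choose j) * real (x choose (j + r))) =
       (\<Sum>r<R. real (x choose j) * ((- 1) ^ r * real ((x - j) choose r)))"
      by (rule sum.cong) (simp_all only: mult.assoc 1 mult.left_commute)
    moreover have "of_bool (x = j) = real (x choose j) * of_bool (x - j = 0)"
      by (cases "x < j") (auto simp: binomial_eq_0)
    ultimately show ?thesis by (simp only: sum_distrib_left right_diff_distrib)
  qed
  also have "\<bar>\<dots>\<bar> \<le> real (x choose j) * real ((x - j) choose R)"
    unfolding abs_mult abs_of_nat by (intro mult_left_mono partial_alternating_choose) simp
  finally show ?thesis unfolding 1 .
qed

abbreviation fmom :: "nat pmf \<Rightarrow> nat \<Rightarrow> real" where
  "fmom P r \<equiv> measure_pmf.expectation P (\<lambda>x. real (x choose r))"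

lemma pmf_Bonferroni:
  assumes int: "\<And>r. integrable (measure_pmf P) (\<lambda>x. real (x choose r))"
  shows "\<bar>pmf P j - (\<Sum>r<R. (- 1) ^ r * real ((j + r) choose j) * fmom P (j + r))\<bar> \<le> real ((j + R) choose j) * fmom P (j + R)"
proof -
  let ?S = "\<lambda>x. \<Sum>r<R. (- 1) ^ r * real ((j + r) choose j) * real (x choose (j + r))"
  have iS: "integrable (measure_pmf P) ?S" by (intro Bochner_Integration.integrable_sum integrable_mult_right int)
  have ib: "integrable (measure_pmf P) (\<lambda>x. of_bool (x = j) :: real)"
    by (rule measure_pmf.integrable_const_bound[where B = 1]) auto
  have p: "pmf P j = measure_pmf.expectation P (\<lambda>x. of_bool (x = j))"
  proof -
    have "measure_pmf.expectation P (\<lambda>x. of_bool (x = j)) = (\<Sum>a\<in>{j}. of_bool (a = j) * pmf P a)"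
      by (rule integral_measure_pmf_real) (simp_all split: if_splits)
    also have "\<dots> = pmf P j" by simp
    finally show ?thesis by (rule sym)
  qed
  have s: "measure_pmf.expectation P ?S = (\<Sum>r<R. (- 1) ^ r * real ((j + r) choose j) * fmom P (j + r))"
    by (subst Bochner_Integration.integral_sum) (intro integrable_mult_right int, simp)
  have eq: "pmf P j - (\<Sum>r<R. (- 1) ^ r * real ((j + r) choose j) * fmom P (j + r)) =
      measure_pmf.expectation P (\<lambda>x. of_bool (x = j) - ?S x)"
    unfolding p s[symmetric] by (rule Bochner_Integration.integral_diff[OF ib iS, symmetric])
  have "\<bar>measure_pmf.expectation P (\<lambda>x. of_bool (x = j) - ?S x)\<bar> \<le> measure_pmf.expectation P (\<lambda>x. \<bar>of_bool (x = j) - ?S x\<bar>)"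
    by (rule integral_abs_bound)
  also have "\<dots> \<le> measure_pmf.expectation P (\<lambda>x. real ((j + R) choose j) * real (x choose (j + R)))"
  proof (rule integral_mono)
    show "integrable (measure_pmf P) (\<lambda>x. \<bar>of_bool (x = j) - ?S x\<bar>)"
      by (intro integrable_abs Bochner_Integration.integrable_diff ib iS)
    show "integrable (measure_pmf P) (\<lambda>x. real ((j + R) choose j) * real (x choose (j + R)))"
      by (intro integrable_mult_right int)
    show "\<bar>of_bool (x = j) - ?S x\<bar> \<le> real ((j + R) choose j) * real (x choose (j + R))" for x
      using Bonferroni_choose[of j x R] by (subst abs_minus_commute)
  qed
  also have "\<dots> = real ((j + R) choose j) * fmom P (j + R)" by (rule integral_mult_right_zero)
  finally show ?thesis by (simp only: eq)
qed

text \<open>The summands vanish below \<open>r\<close>; shifted by \<open>r\<close>, they form an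
  exponential series.\<close>

lemma fmom_poisson:
  assumes "rate > 0"
  shows "integrable (measure_pmf (poisson_pmf rate)) (\<lambda>x. real (x choose r))" "fmom (poisson_pmf rate) r = rate ^ r / fact r"
proof -
  let ?f = "\<lambda>x. pmf (poisson_pmf rate) x * real (x choose r)"
  have shift: "?f (x + r) = rate ^ r / fact r * exp (- rate) * (rate ^ x / fact x)" for x
    using assms binomial_fact[of r "x + r", where 'a = real] by (simp add: power_add field_simps)
  have "(\<lambda>x. rate ^ x / fact x) sums exp rate"
    using exp_converges[of rate] by (simp add: field_simps)
  then have "(\<lambda>x. rate ^ r / fact r * exp (- rate) * (rate ^ x / fact x)) sums (rate ^ r / fact r * exp (- rate) * exp rate)"
    by (rule sums_mult)
  moreover have "rate ^ r / fact r * exp (- rate) * exp rate = rate ^ r / fact r" by (simp add: exp_minus)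
  ultimately have "(\<lambda>x. ?f (x + r)) sums (rate ^ r / fact r)" unfolding shift by (simp only:)
  then have s: "?f sums (rate ^ r / fact r)"
    by (subst (asm) sums_iff_shift) (simp add: binomial_eq_0)
  have i: "integrable (count_space UNIV) ?f"
    using s assms by (subst integrable_count_space_nat_iff) (auto simp: sums_iff abs_mult)
  have "integrable (density (count_space UNIV) (pmf (poisson_pmf rate))) (\<lambda>x. real (x choose r))"
    by (subst integrable_density) (use i in auto)
  then show "integrable (measure_pmf (poisson_pmf rate)) (\<lambda>x. real (x choose r))"
    by (simp add: measure_pmf_eq_density)
  have "fmom (poisson_pmf rate) r = integral\<^sup>L (count_space UNIV) ?f"
    unfolding measure_pmf_eq_density by (subst integral_density) auto
  then show "fmom (poisson_pmf rate) r = rate ^ r / fact r"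
    using integral_count_space_nat[OF i] s by (simp add: sums_iff)
qed

text \<open>The spare power of \<open>x\<close>, available because \<open>R \<ge> r + 1\<close>,
  yields the factor \<open>1 / M\<close> on \<open>x \<ge> M\<close>; the remaining power is
  compared with \<open>(x / R) ^ R \<le> x choose R\<close>.\<close>

lemma powr_le_choose:
  assumes "M \<ge> 1" "R \<le> M" "M \<le> x" "r + 1 \<le> real R"
  shows "real x powr r \<le> real R ^ R / real M * real (x choose R)"
proof -
  have x: "real x \<ge> 1" "real x \<ge> real M" using assms by auto
  have "(real x / real R) ^ R \<le> real (x choose R)"
    using assms by (intro binomial_ge_n_over_k_pow_k) auto
  then have 1: "real x ^ R \<le> real R ^ R * real (x choose R)"
    by (cases "R = 0") (simp_all add: power_divide field_simps)
  have "real x powr r * real M \<le> real x powr r * real x" using x by (intro mult_left_mono) auto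
  also have "\<dots> = real x powr (r + 1)" using x by (simp add: powr_add)
  also have "\<dots> \<le> real x powr real R" using x assms(4) by (intro powr_mono) auto
  also have "\<dots> = real x ^ R" using x by (simp add: powr_realpow)
  finally show ?thesis using 1 assms(1) by (simp add: field_simps)
qed

lemma powr_moment_truncation:
  assumes int: "\<And>r. integrable (measure_pmf P) (\<lambda>x. real (x choose r))"
    and M: "M \<ge> 1" "R \<le> M" "r + 1 \<le> real R"
  shows "\<bar>measure_pmf.expectation P (\<lambda>x. real x powr r) - (\<Sum>x<M. real x powr r * pmf P x)\<bar> \<le> real R ^ R / real M * fmom P R"
proof -
  let ?g = "\<lambda>x. real x powr r" and ?h = "\<lambda>x. real R ^ R / real M * real (x choose R)"
  let ?t = "\<lambda>x. if x < M then ?g x else 0"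
  have tail: "\<bar>?g x - ?t x\<bar> \<le> ?h x" for x
    using powr_le_choose[of M R x r] M by (cases "x < M") auto
  have ih: "integrable (measure_pmf P) ?h" by (intro integrable_mult_right int)
  have it: "integrable (measure_pmf P) ?t"
  proof (rule measure_pmf.integrable_const_bound[where B = "\<Sum>x<M. ?g x"])
    show "AE x in measure_pmf P. norm (?t x) \<le> (\<Sum>x<M. ?g x)"
    proof (rule AE_I2)
      fix x show "norm (?t x) \<le> (\<Sum>x<M. ?g x)"
        by (cases "x < M") (auto intro!: member_le_sum sum_nonneg)
    qed
  qed auto
  have id: "integrable (measure_pmf P) (\<lambda>x. ?g x - ?t x)"
    by (rule Bochner_Integration.integrable_bound[OF ih]) (use tail in \<open>auto intro: order_trans[OF _ abs_ge_self]\<close>)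
  have "integrable (measure_pmf P) (\<lambda>x. (?g x - ?t x) + ?t x)" using id it by (rule Bochner_Integration.integrable_add)
  then have ig: "integrable (measure_pmf P) ?g" by simp
  have "measure_pmf.expectation P ?t = (\<Sum>x<M. ?t x * pmf P x)"
    by (rule integral_measure_pmf_real) (auto split: if_splits)
  also have "\<dots> = (\<Sum>x<M. ?g x * pmf P x)" by (rule sum.cong) auto
  finally have "measure_pmf.expectation P ?g - (\<Sum>x<M. ?g x * pmf P x) = measure_pmf.expectation P (\<lambda>x. ?g x - ?t x)"
    using ig it by simp
  also have "\<bar>\<dots>\<bar> \<le> measure_pmf.expectation P (\<lambda>x. \<bar>?g x - ?t x\<bar>)" by (rule integral_abs_bound)
  also have "\<dots> \<le> measure_pmf.expectation P ?h" using id ih tail by (intro integral_mono integrable_abs) auto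
  finally show ?thesis using int by simp
qed

theorem poisson_from_factorial_moments:
  fixes P :: "nat \<Rightarrow> nat pmf"
  assumes rate: "rate > 0" and fin: "\<And>n. finite (set_pmf (P n))"
    and mom: "\<And>r. (\<lambda>n. fmom (P n) r) \<longlonglongrightarrow> rate ^ r / fact r"
  shows "weak_conv_m (\<lambda>n. distr (measure_pmf (P n)) borel real) (distr (measure_pmf (poisson_pmf rate)) borel real)"
    and "r > 0 \<Longrightarrow> (\<lambda>n. measure_pmf.expectation (P n) (\<lambda>x. real x powr r)) \<longlonglongrightarrow>
           measure_pmf.expectation (poisson_pmf rate) (\<lambda>x. real x powr r)"
proof -
  let ?Q = "poisson_pmf rate"
  have int: "integrable (measure_pmf (P n)) f" for f :: "nat \<Rightarrow> real" and n by (rule integrable_measure_pmf_finite[OF fin])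
  note Q = fmom_poisson[OF rate]
  have mom': "(\<lambda>n. fmom (P n) r) \<longlonglongrightarrow> fmom ?Q r" for r using mom Q(2) by simp
  have pmf_lim: "(\<lambda>n. pmf (P n) j) \<longlonglongrightarrow> pmf ?Q j" for j
  proof (rule approx_tendsto)
    let ?b = "\<lambda>P R. \<Sum>r<R. (- 1) ^ r * real ((j + r) choose j) * fmom P (j + r)"
    let ?e = "\<lambda>P R. real ((j + R) choose j) * fmom P (j + R)"
    show "(\<lambda>n. ?b (P n) R) \<longlonglongrightarrow> ?b ?Q R" for R by (intro tendsto_intros mom')
    show "(\<lambda>n. ?e (P n) R) \<longlonglongrightarrow> ?e ?Q R" for R by (intro tendsto_intros mom')
    show "eventually (\<lambda>n. \<bar>pmf (P n) j - ?b (P n) R\<bar> \<le> ?e (P n) R) sequentially" for R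
      using pmf_Bonferroni[OF int] by (intro always_eventually allI)
    show e0: "?e ?Q \<longlonglongrightarrow> 0"
    proof -
      have "?e ?Q R = rate ^ j / fact j * (rate ^ R / fact R)" for R
        using binomial_fact[of j "j + R", where 'a = real] unfolding Q(2) by (simp add: power_add field_simps)
      moreover have "(\<lambda>R. rate ^ R / fact R) \<longlonglongrightarrow> 0"
        using summable_LIMSEQ_zero[OF summable_exp[of rate]] by (simp add: field_simps)
      then have "(\<lambda>R. rate ^ j / fact j * (rate ^ R / fact R)) \<longlonglongrightarrow> rate ^ j / fact j * 0" by (intro tendsto_intros)
      ultimately show ?thesis by simp
    qed
    have "\<bar>?b ?Q R - pmf ?Q j\<bar> \<le> ?e ?Q R" for R
      using pmf_Bonferroni[OF Q(1), of j R] by (simp add: abs_minus_commute)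
    then have "(\<lambda>R. ?b ?Q R - pmf ?Q j) \<longlonglongrightarrow> 0"
      by (intro tendsto_rabs_zero_cancel[OF tendsto_sandwich[OF _ _ tendsto_const e0]]) (auto intro: always_eventually)
    then show "?b ?Q \<longlonglongrightarrow> pmf ?Q j" by (simp only: LIM_zero_iff)
  qed
  show "weak_conv_m (\<lambda>n. distr (measure_pmf (P n)) borel real) (distr (measure_pmf ?Q) borel real)"
    unfolding weak_conv_m_def weak_conv_def
  proof (intro allI impI)
    fix x :: real
    \<comment> \<open>On natural numbers the distribution function at \<open>x\<close> is a finite
      sum of point probabilities, so it converges at every \<open>x\<close>, continuity point or
      not.\<close>
    have cdf: "cdf (distr (measure_pmf p) borel real) x = (\<Sum>k | real k \<le> x. pmf p k)" for p :: "nat pmf"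
    proof -
      have "cdf (distr (measure_pmf p) borel real) x = measure (measure_pmf p) {k. real k \<le> x}"
        unfolding cdf_def by (subst measure_distr) (auto simp: vimage_def)
      also have "\<dots> = (\<Sum>k | real k \<le> x. pmf p k)"
      proof (rule measure_measure_pmf_finite)
        show "finite {k. real k \<le> x}" by (rule finite_subset[of _ "{..nat \<lfloor>x\<rfloor>}"]) (auto simp: le_nat_floor)
      qed
      finally show ?thesis .
    qed
    show "(\<lambda>n. cdf (distr (measure_pmf (P n)) borel real) x) \<longlonglongrightarrow> cdf (distr (measure_pmf ?Q) borel real) x"
      unfolding cdf by (intro tendsto_sum pmf_lim)
  qed
  show "(\<lambda>n. measure_pmf.expectation (P n) (\<lambda>x. real x powr r)) \<longlonglongrightarrow> measure_pmf.expectation ?Q (\<lambda>x. real x powr r)"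
    if "r > 0"
  proof (rule approx_tendsto)
    \<comment> \<open>The factorial moment of order \<open>R \<ge> r + 1\<close> controls the tail.
      Truncation takes place at \<open>M + R\<close> because the cut must not lie below
      \<open>R\<close>.\<close>
    define R where "R = nat \<lceil>r\<rceil> + 1"
    have R: "r + 1 \<le> real R" unfolding R_def by linarith
    let ?b = "\<lambda>P M. \<Sum>x<M + R. real x powr r * pmf P x"
    let ?e = "\<lambda>P M. real R ^ R / real (M + R) * fmom P R"
    have M: "M + R \<ge> 1" "R \<le> M + R" for M by (simp_all add: R_def)
    show "(\<lambda>n. ?b (P n) M) \<longlonglongrightarrow> ?b ?Q M" for M by (intro tendsto_intros pmf_lim)
    show "(\<lambda>n. ?e (P n) M) \<longlonglongrightarrow> ?e ?Q M" for M by (intro tendsto_intros mom')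
    show "eventually (\<lambda>n. \<bar>measure_pmf.expectation (P n) (\<lambda>x. real x powr r) - ?b (P n) M\<bar> \<le> ?e (P n) M) sequentially" for M
      using powr_moment_truncation[OF int M R] by (intro always_eventually allI)
    show e0: "?e ?Q \<longlonglongrightarrow> 0"
    proof -
      have "(\<lambda>M. real R ^ R * fmom ?Q R * inverse (real (M + R))) \<longlonglongrightarrow> real R ^ R * fmom ?Q R * 0"
        by (intro tendsto_intros LIMSEQ_ignore_initial_segment lim_inverse_n)
      then show ?thesis by (simp add: field_simps)
    qed
    have "\<bar>?b ?Q M - measure_pmf.expectation ?Q (\<lambda>x. real x powr r)\<bar> \<le> ?e ?Q M" for M
      using powr_moment_truncation[OF Q(1) M R] by (simp add: abs_minus_commute)
    then have "(\<lambda>M. ?b ?Q M - measure_pmf.expectation ?Q (\<lambda>x. real x powr r)) \<longlonglongrightarrow> 0"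
      by (intro tendsto_rabs_zero_cancel[OF tendsto_sandwich[OF _ _ tendsto_const e0]]) (auto intro: always_eventually)
    then show "?b ?Q \<longlonglongrightarrow> measure_pmf.expectation ?Q (\<lambda>x. real x powr r)" by (simp only: LIM_zero_iff)
  qed
qed

section \<open>Tree counts are determined by the number of isolated vertices\<close>

lemma choose_le_pow: "real (n choose k) \<le> real n ^ k"
proof (cases "k \<le> n")
  case True
  then show ?thesis using binomial_le_pow[of k n] by (metis of_nat_le_iff of_nat_power)
qed (simp add: binomial_eq_0)

lemma choose_diff_le:
  assumes "x \<le> n" "k \<ge> 1"
  shows "real (x choose k) \<le> real ((x - j) choose k) + real j * real n ^ (k - 1)"
proof (induction j)
  case (Suc j)
  have "real ((x - j) choose k) \<le> real ((x - Suc j) choose k) + real n ^ (k - 1)"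
  proof (cases "j < x")
    case True
    then obtain z where z: "x - j = Suc z" "x - Suc j = z" by (metis Suc_diff_Suc)
    obtain l where l: "k = Suc l" using assms(2) by (cases k) auto
    have "real (z choose l) \<le> real z ^ l" by (rule choose_le_pow)
    also have "\<dots> \<le> real n ^ l" using z assms(1) by (intro power_mono) auto
    finally show ?thesis using z l by simp
  qed simp
  then show ?case using Suc by (simp add: algebra_simps)
qed simp

text \<open>Ordered pairs of \<open>k\<close>-subsets: the disjoint ones are counted through
  \<open>2 * k\<close>-subsets, and those that meet are of lower order.\<close>

lemma choose_square_le:
  assumes "x \<le> n" "k \<ge> 1"
  shows "(real (x choose k))\<^sup>2 \<le> real ((2 * k) choose k) * real (x choose (2 * k)) + real k * real n ^ (2 * k - 1)"
proof -
  have 1: "real (x choose k) * real ((x - k) choose k) = real ((2 * k) choose k) * real (x choose (2 * k))"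
  proof (cases "2 * k \<le> x")
    case True
    then have "(x choose (2 * k)) * ((2 * k) choose k) = (x choose k) * ((x - k) choose (2 * k - k))"
      using choose_mult[of k "2 * k" x] by simp
    moreover have "2 * k - k = k" by simp
    ultimately show ?thesis by (metis mult.commute of_nat_mult)
  next
    case False
    then have "x choose (2 * k) = 0" "(x choose k) * ((x - k) choose k) = 0"
      by (cases "x < k"; simp add: binomial_eq_0)+
    then show ?thesis by (metis mult_zero_right of_nat_0 of_nat_mult)
  qed
  have "(real (x choose k))\<^sup>2 = real (x choose k) * real (x choose k)" by (rule power2_eq_square)
  also have "\<dots> \<le> real (x choose k) * (real ((x - k) choose k) + real k * real n ^ (k - 1))"
    by (intro mult_left_mono choose_diff_le assms) simp
  also have "\<dots> = real ((2 * k) choose k) * real (x choose (2 * k)) + real (x choose k) * (real k * real n ^ (k - 1))"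
    by (simp only: distrib_left 1)
  also have "real (x choose k) \<le> real n ^ k"
    using assms(1) by (intro order_trans[OF choose_le_pow power_mono]) auto
  then have "real (x choose k) * (real k * real n ^ (k - 1)) \<le> real n ^ k * (real k * real n ^ (k - 1))"
    by (rule mult_right_mono) simp
  also have "real n ^ k * (real k * real n ^ (k - 1)) = real k * real n ^ (2 * k - 1)"
  proof -
    have "2 * k - 1 = k + (k - 1)" using assms(2) by simp
    then show ?thesis by (simp add: power_add)
  qed
  finally show ?thesis by simp
qed

lemma pow_minus_falling:
  fixes x b :: nat
  shows "real (x choose b) * fact b \<le> real x ^ b"
    "real x ^ b - real (x choose b) * fact b \<le> (real b)\<^sup>2 * real x ^ (b - 1)"
proof -
  have "real (x choose b) * fact b \<le> real x ^ b \<and> real x ^ b - real (x choose b) * fact b \<le> (real b)\<^sup>2 * real x ^ (b - 1)"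
  proof (induction b)
    case 0
    then show ?case by simp
  next
    case (Suc b)
    let ?f = "\<lambda>b. real (x choose b) * fact b"
    have rec: "?f (Suc b) = ?f b * (real x - real b)"
    proof (cases "b \<le> x")
      case True
      have "Suc b * (x choose Suc b) = (x - b) * (x choose b)"
        by (metis binomial_absorb_comp binomial_absorption mult.commute)
      then have "real (Suc b) * real (x choose Suc b) = real (x - b) * real (x choose b)" by (metis of_nat_mult)
      moreover have "?f (Suc b) = (real (Suc b) * real (x choose Suc b)) * fact b" by (simp add: mult_ac)
      ultimately have "?f (Suc b) = (real (x - b) * real (x choose b)) * fact b" by (simp only:)
      then show ?thesis using True by (simp add: of_nat_diff)
    qed (simp add: binomial_eq_0)
    have f: "0 \<le> ?f b" by simp
    show ?case
    proof (cases "b = 0")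
      case True
      then show ?thesis by simp
    next
      case False
      have pw: "real x ^ b = real x ^ (b - 1) * real x" using False by (metis power_minus_mult neq0_conv)
      have "?f (Suc b) \<le> ?f b * real x" unfolding rec using f by (intro mult_left_mono) auto
      also have "\<dots> \<le> real x ^ b * real x" using Suc by (intro mult_right_mono) auto
      finally have 1: "?f (Suc b) \<le> real x ^ Suc b" by (simp add: mult.commute)
      have "real x ^ Suc b - ?f (Suc b) = (real x ^ b - ?f b) * real x + ?f b * real b" unfolding rec by (simp add: algebra_simps)
      also have "\<dots> \<le> ((real b)\<^sup>2 * real x ^ (b - 1)) * real x + real x ^ b * real b"
        using Suc by (intro add_mono mult_right_mono) auto
      also have "\<dots> = ((real b)\<^sup>2 + real b) * real x ^ b" using pw by (simp add: algebra_simps)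
      also have "\<dots> \<le> (real (Suc b))\<^sup>2 * real x ^ b" by (intro mult_right_mono) (auto simp: power2_eq_square algebra_simps)
      finally show ?thesis using 1 by simp
    qed
  qed
  then show "real (x choose b) * fact b \<le> real x ^ b"
    "real x ^ b - real (x choose b) * fact b \<le> (real b)\<^sup>2 * real x ^ (b - 1)" by auto
qed

context frozen_process
begin

lemma N_ge: "N \<ge> (real n)\<^sup>2 / 4"
proof -
  have "real n * (real n - 2) \<ge> 0" using n_ge_2 by simp
  then show ?thesis by (simp add: N_eq power2_eq_square algebra_simps)
qed

lemma niso_le: "niso G \<le> n"
proof -
  have "isolated G \<subseteq> {1..n}" by (auto simp: isolated_def)
  then show ?thesis using card_mono[of "{1..n}" "isolated G"] by simp
qed

section \<open>Moments of isolated vertices: regularity in time\<close>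

abbreviation chooseiso :: "nat \<Rightarrow> multigraph \<Rightarrow> real" where
  "chooseiso l G \<equiv> real (niso G choose l)"

lemma E_chooseiso_Suc: "E (Suc m) (chooseiso l) = E m (\<lambda>G. chooseiso l G * (1 - hit_weight l (nunf G) / N))"
  unfolding E_Suc by (rule E_cong) (simp add: gen_choose_isolated algebra_simps)

lemma hit_weight_nonneg:
  assumes "l \<le> u" "u \<le> n" shows "hit_weight l u \<ge> 0"
proof (cases "l = 0")
  case False
  have "real l * real l \<le> real l * real u" using assms by (intro mult_left_mono) auto
  moreover have "real l * 1 \<le> real l * real l" using False by (intro mult_left_mono) auto
  ultimately have "real l * (real l + 1) / 2 \<le> real l * real u" by (simp add: algebra_simps)
  moreover have "0 \<le> p * real l * (real n - real u)" using p_pos assms by (intro mult_nonneg_nonneg) auto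
  ultimately show ?thesis by (simp add: hit_weight_def)
qed (simp add: hit_weight_def)

lemma chooseiso_hit_nonneg: "valid n G \<Longrightarrow> 0 \<le> chooseiso l G * hit_weight l (nunf G)"
proof -
  assume v: "valid n G"
  show ?thesis
  proof (cases "l \<le> niso G")
    case True
    then have "l \<le> nunf G" using niso_le_nunf[OF v] by simp
    then show ?thesis using hit_weight_nonneg[OF _ nunf_le] by simp
  qed (simp add: binomial_eq_0)
qed

lemma chooseiso_le: "chooseiso l G \<le> real n ^ l"
  using niso_le[of G] by (intro order_trans[OF choose_le_pow power_mono]) auto

text \<open>Isolated vertices never reappear, and a moment of order \<open>n ^ l\<close> moves by
  order \<open>n ^ (l - 1)\<close> per step. The shifts by a few steps that come with cutting out
  trees are therefore negligible.\<close>

lemma E_chooseiso_step: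
  "E (Suc m) (chooseiso l) \<le> E m (chooseiso l)"
  "E m (chooseiso l) - E (Suc m) (chooseiso l) \<le> 4 * real l * real n ^ l / real n"
proof -
  have d: "E m (chooseiso l) - E (Suc m) (chooseiso l) = E m (\<lambda>G. chooseiso l G * hit_weight l (nunf G) / N)"
    unfolding E_chooseiso_Suc E_diff[symmetric] by (rule E_cong) (simp add: algebra_simps)
  have "0 \<le> E m (\<lambda>G. chooseiso l G * hit_weight l (nunf G) / N)"
    using chooseiso_hit_nonneg N_pos by (intro E_nonneg) simp
  then show "E (Suc m) (chooseiso l) \<le> E m (chooseiso l)" using d by simp
  have "E m (\<lambda>G. chooseiso l G * hit_weight l (nunf G) / N) \<le> E m (\<lambda>G. 4 * real l * real n ^ l / real n)"
  proof (rule E_mono)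
    fix G assume v: "valid n G"
    have n0: "real n > 0" using n_ge_2 by simp
    have "chooseiso l G * hit_weight l (nunf G) \<le> chooseiso l G * (real l * real n)"
      using hit_weight_le[OF nunf_le] by (intro mult_left_mono) auto
    also have "\<dots> \<le> real n ^ l * (real l * real n)" using chooseiso_le by (intro mult_right_mono) auto
    finally have "chooseiso l G * hit_weight l (nunf G) / N \<le> real n ^ l * (real l * real n) / N"
      using N_pos by (intro divide_right_mono) auto
    also have "\<dots> \<le> real n ^ l * (real l * real n) / ((real n)\<^sup>2 / 4)"
      using N_ge N_pos n0 by (intro divide_left_mono) auto
    also have "\<dots> = 4 * real l * real n ^ l / real n" using n0 by (simp add: power2_eq_square field_simps)
    finally show "chooseiso l G * hit_weight l (nunf G) / N \<le> 4 * real l * real n ^ l / real n" .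
  qed
  then show "E m (chooseiso l) - E (Suc m) (chooseiso l) \<le> 4 * real l * real n ^ l / real n" using d by simp
qed

lemma E_chooseiso_antimono: "i \<le> j \<Longrightarrow> E j (chooseiso l) \<le> E i (chooseiso l)"
  by (rule lift_Suc_antimono_le[of "\<lambda>i. E i (chooseiso l)"]) (rule E_chooseiso_step)

lemma E_chooseiso_diff: "E i (chooseiso l) - E (i + j) (chooseiso l) \<le> real j * (4 * real l * real n ^ l / real n)"
proof (induction j)
  case (Suc j)
  then show ?case using E_chooseiso_step(2)[of "i + j" l]
    unfolding add_Suc_right of_nat_Suc distrib_right mult_1 by linarith
qed simp

lemma E_chooseiso_diff_le:
  assumes "i \<le> j" "j \<le> i + b"
  shows "E i (chooseiso l) - E j (chooseiso l) \<le> real b * (4 * real l * real n ^ l / real n)"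
proof -
  have "E i (chooseiso l) - E (i + (j - i)) (chooseiso l) \<le> real (j - i) * (4 * real l * real n ^ l / real n)"
    by (rule E_chooseiso_diff)
  also have "\<dots> \<le> real b * (4 * real l * real n ^ l / real n)" using assms by (intro mult_right_mono) auto
  finally show ?thesis using assms by simp
qed

lemma tree_number_nonneg: "tree_number k \<ge> 0"
  by (simp add: tree_number_def)

lemma mark_rate_nonneg: "mark_rate k m \<ge> 0"
  using N_pos by (simp add: mark_rate_def tree_number_nonneg)

lemma mark_rate_mono: "i \<le> j \<Longrightarrow> mark_rate k i \<le> mark_rate k j"
  unfolding mark_rate_def using N_pos tree_number_nonneg
  by (intro mult_right_mono divide_right_mono) (auto intro: binomial_right_mono)

lemma mark_rate_le:
  assumes "real m \<le> A * real n"
  shows "mark_rate k m \<le> (4 * A) ^ (k - 1) * tree_number k / real n ^ (k - 1)"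
proof -
  let ?b = "k - 1"
  have n0: "real n > 0" using n_ge_2 by simp
  have "real (m choose ?b) * fact ?b / N ^ ?b \<le> (A * real n) ^ ?b / ((real n)\<^sup>2 / 4) ^ ?b"
  proof (rule frac_le)
    show "real (m choose ?b) * fact ?b \<le> (A * real n) ^ ?b"
      using pow_minus_falling(1)[of m ?b] power_mono[OF assms, of ?b] by simp
    show "0 \<le> (A * real n) ^ ?b" using assms order_trans[of 0 "real m"] by (intro zero_le_power) simp
    show "0 < ((real n)\<^sup>2 / 4) ^ ?b" using n0 by simp
    show "((real n)\<^sup>2 / 4) ^ ?b \<le> N ^ ?b" using N_ge by (intro power_mono) auto
  qed
  also have "\<dots> = (4 * A) ^ ?b / real n ^ ?b"
  proof -
    have "A * real n / ((real n)\<^sup>2 / 4) = 4 * A / real n" using n0 by (simp add: power2_eq_square field_simps)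
    then show ?thesis by (simp only: power_divide[symmetric])
  qed
  finally show ?thesis unfolding mark_rate_def using tree_number_nonneg[of k]
    by (metis mult_right_mono times_divide_eq_left)
qed

text \<open>The summand 1 is for the diagonal, the mean tree count divided by \<open>n\<close>; the
  others are for the time shifts and for pairs of subsets that meet.\<close>

definition approx_const :: "nat \<Rightarrow> real \<Rightarrow> real" where
  "approx_const k A = 1 + ((4 * A) ^ (k - 1) * tree_number k)\<^sup>2 *
     (real ((2 * k) choose k) * (real (k - 1) * (8 * real k)) + real k)"

lemma tree_count_le: "valid n G \<Longrightarrow> tree_count n k G \<le> n"
proof -
  have "tree_count n k G \<le> card (components n G)" unfolding tree_count_def by (intro card_mono) (auto simp: components_def)
  also have "\<dots> \<le> n" using card_image_le[of "{1..n}" "component G"] by (simp add: components_def)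
  finally show ?thesis .
qed

lemma tree_count_1: "valid n G \<Longrightarrow> tree_count n 1 G = niso G"
proof -
  assume v: "valid n G"
  have "ktrees 1 G = (\<lambda>v. {v}) ` isolated G"
  proof (intro equalityI subsetI)
    fix C assume "C \<in> ktrees 1 G"
    then obtain u where u: "u \<in> {1..n}" "C = component G u" "card C = 1" by (rule ktreesE)
    then have "C = {u}" by (metis card_1_singletonE component_refl singletonD)
    then show "C \<in> (\<lambda>v. {v}) ` isolated G" using u by (auto simp: isolated_def)
  next
    fix C assume "C \<in> (\<lambda>v. {v}) ` isolated G"
    then obtain u where u: "u \<in> {1..n}" "component G u = {u}" "C = {u}" by (auto simp: isolated_def)
    then have "in_tree G u" using in_tree_isolated valid_loopless[OF v] by blast
    then show "C \<in> ktrees 1 G" using u by (auto simp: ktrees_def components_def intro: image_eqI[of _ _ u])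
  qed
  then show ?thesis by (simp add: tree_count_eq card_image)
qed

text \<open>Second moment method. By the marking identity, pairs of trees, the mixed term and the
  square all reduce to the mean of \<open>chooseiso (2 * k)\<close> with matching constants, apart
  from time shifts by at most \<open>2 * (k - 1)\<close> steps and lower-order terms. The main terms
  cancel and order \<open>n\<close> remains.\<close>

lemma E_tree_count_approx:
  assumes "k \<ge> 1" "real m \<le> A * real n"
  shows "E m (\<lambda>G. (real (tree_count n k G) - mark_rate k m * chooseiso k G)\<^sup>2) \<le> real n * approx_const k A"
proof (cases "k = 1")
  case True
  have "mark_rate 1 m = 1" by (simp add: mark_rate_def tree_number_def)
  then have "E m (\<lambda>G. (real (tree_count n k G) - mark_rate k m * chooseiso k G)\<^sup>2) = E m (\<lambda>G. 0)"
    using True tree_count_1 by (intro E_cong) simp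
  moreover have "0 \<le> real n * approx_const k A"
    unfolding approx_const_def by (intro mult_nonneg_nonneg add_nonneg_nonneg) auto
  ultimately show ?thesis by simp
next
  case False
  then have k: "k \<ge> 2" using assms by simp
  let ?b = "k - 1" and ?s = "mark_rate k m" and ?c = "real ((2 * k) choose k)" and ?Y = "chooseiso (2 * k)"
  have n0: "real n > 0" using n_ge_2 by simp
  have c: "?c = fact (2 * k) / (fact k * fact k)" using binomial_fact[of k "2 * k", where 'a = real] by simp
  have tc2: "E m (\<lambda>G. real (tree_count n k G choose 2)) = ?s * mark_rate k (m - ?b) * (?c / 2) * E (m - 2 * ?b) ?Y"
    using E_choose_tree_count[OF k, of m 2 0] unfolding c by (simp add: lessThan_Suc numeral_2_eq_2 power2_eq_square mult_ac)
  have tcY: "E m (\<lambda>G. real (tree_count n k G) * chooseiso k G) = ?s * ?c * E (m - ?b) ?Y"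
    using E_choose_tree_count[OF k, of m 1 k] unfolding c by (simp add: mult_2)
  have YY: "E m (\<lambda>G. (chooseiso k G)\<^sup>2) \<le> ?c * E m ?Y + real k * real n ^ (2 * k - 1)"
  proof -
    have "E m (\<lambda>G. (chooseiso k G)\<^sup>2) \<le> E m (\<lambda>G. ?c * ?Y G + real k * real n ^ (2 * k - 1))"
      by (intro E_mono choose_square_le niso_le assms)
    then show ?thesis by (simp add: E_add E_cmult)
  qed
  have tc: "E m (\<lambda>G. real (tree_count n k G)) \<le> real n"
    using E_mono[of "\<lambda>G. real (tree_count n k G)" "\<lambda>_. real n" m] tree_count_le by simp
  have expand: "(real (tree_count n k G) - ?s * chooseiso k G)\<^sup>2 =
     2 * real (tree_count n k G choose 2) + real (tree_count n k G) - 2 * ?s * (real (tree_count n k G) * chooseiso k G) + ?s\<^sup>2 * (chooseiso k G)\<^sup>2" for G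
    unfolding real_choose_two by (simp add: power2_eq_square field_simps)
  have "E m (\<lambda>G. (real (tree_count n k G) - ?s * chooseiso k G)\<^sup>2) =
     2 * E m (\<lambda>G. real (tree_count n k G choose 2)) + E m (\<lambda>G. real (tree_count n k G))
     - 2 * ?s * E m (\<lambda>G. real (tree_count n k G) * chooseiso k G) + ?s\<^sup>2 * E m (\<lambda>G. (chooseiso k G)\<^sup>2)"
    unfolding expand by (simp only: E_add E_diff E_cmult)
  also have "\<dots> \<le> ?c * ?s\<^sup>2 * E (m - 2 * ?b) ?Y + real n - 2 * ?s\<^sup>2 * ?c * E (m - ?b) ?Y + ?s\<^sup>2 * (?c * E (m - ?b) ?Y + real k * real n ^ (2 * k - 1))"
  proof -
    have Y0: "0 \<le> E i ?Y" for i by (intro E_nonneg) simp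
    have "?s * mark_rate k (m - ?b) \<le> ?s * ?s" by (intro mult_left_mono mark_rate_mono mark_rate_nonneg) simp
    then have "?c * (?s * mark_rate k (m - ?b)) * E (m - 2 * ?b) ?Y \<le> ?c * (?s * ?s) * E (m - 2 * ?b) ?Y"
      by (rule mult_right_mono[OF mult_left_mono Y0]) auto
    moreover have "?s\<^sup>2 * E m (\<lambda>G. (chooseiso k G)\<^sup>2) \<le> ?s\<^sup>2 * (?c * E (m - ?b) ?Y + real k * real n ^ (2 * k - 1))"
    proof (rule mult_left_mono)
      have "?c * E m ?Y \<le> ?c * E (m - ?b) ?Y" by (intro mult_left_mono E_chooseiso_antimono) auto
      then show "E m (\<lambda>G. (chooseiso k G)\<^sup>2) \<le> ?c * E (m - ?b) ?Y + real k * real n ^ (2 * k - 1)" using YY by linarith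
    qed simp
    ultimately show ?thesis unfolding tc2 tcY using tc by (simp add: power2_eq_square mult_ac)
  qed
  also have "\<dots> = ?s\<^sup>2 * (?c * (E (m - 2 * ?b) ?Y - E (m - ?b) ?Y) + real k * real n ^ (2 * k - 1)) + real n"
    by (simp add: algebra_simps)
  also have "\<dots> \<le> ((4 * A) ^ ?b * tree_number k / real n ^ ?b)\<^sup>2 * (?c * (real ?b * (4 * real (2 * k) * real n ^ (2 * k) / real n)) + real k * real n ^ (2 * k - 1)) + real n"
  proof (intro add_right_mono mult_mono power_mono mark_rate_le assms add_mono mult_left_mono)
    show "E (m - 2 * ?b) ?Y - E (m - ?b) ?Y \<le> real ?b * (4 * real (2 * k) * real n ^ (2 * k) / real n)"
      by (rule E_chooseiso_diff_le) auto
    have nn: "E (m - ?b) ?Y \<le> E (m - 2 * ?b) ?Y" by (intro E_chooseiso_antimono) simp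
    then show "0 \<le> ?c * (E (m - 2 * ?b) ?Y - E (m - ?b) ?Y) + real k * real n ^ (2 * k - 1)"
      by (intro add_nonneg_nonneg mult_nonneg_nonneg) auto
    show "0 \<le> E (m - 2 * ?b) ?Y - E (m - ?b) ?Y" using nn by simp
  qed (auto simp: mark_rate_nonneg)
  also have "\<dots> = real n * approx_const k A"
  proof -
    have e: "real n ^ (2 * k) / real n = real n ^ (2 * k - 1)" using n0 k by (simp add: power_diff)
    have "real n ^ (2 * k - 1) = real n * (real n ^ ?b)\<^sup>2"
    proof -
      have "2 * k - 1 = 1 + ?b * 2" using k by simp
      then show ?thesis by (simp only: power_add power_mult power_one_right)
    qed
    then have "real n ^ (2 * k) / real n = real n * (real n ^ ?b)\<^sup>2" "real n ^ (2 * k - 1) = real n * (real n ^ ?b)\<^sup>2" using e by auto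
    then show ?thesis unfolding approx_const_def using n0 by (simp add: field_simps)
  qed
  finally show ?thesis .
qed

end

section \<open>Comparison with the fluid limit\<close>

definition mono_const :: "nat \<Rightarrow> real \<Rightarrow> real" where
  "mono_const k A = tree_coeff k / real k * 2 ^ (k - 1) * (A ^ (k - 1) * 2 ^ (k - 1) * ((real (k - 1))\<^sup>2 + (real k)\<^sup>2 + real (k - 1)))"

lemma falling_ratio:
  fixes x n b :: nat
  assumes "real x \<le> A * real n" "A \<ge> 1" "n \<ge> 1"
  shows "0 \<le> real (x choose b) * fact b / real n ^ b"
    "real (x choose b) * fact b / real n ^ b \<le> (real x / real n) ^ b"
    "(real x / real n) ^ b - real (x choose b) * fact b / real n ^ b \<le> (real b)\<^sup>2 * A ^ b / real n"
    "(real x / real n) ^ b \<le> A ^ b"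
proof -
  have n0: "real n > 0" using assms by simp
  show "0 \<le> real (x choose b) * fact b / real n ^ b" by simp
  show "real (x choose b) * fact b / real n ^ b \<le> (real x / real n) ^ b"
    unfolding power_divide by (intro divide_right_mono pow_minus_falling(1)) simp
  have r: "real x / real n \<le> A" using assms n0 by (simp add: pos_divide_le_eq)
  then show "(real x / real n) ^ b \<le> A ^ b" by (intro power_mono) auto
  have "(real x / real n) ^ b - real (x choose b) * fact b / real n ^ b = (real x ^ b - real (x choose b) * fact b) / real n ^ b"
    by (simp add: power_divide diff_divide_distrib)
  also have "\<dots> \<le> (real b)\<^sup>2 * real x ^ (b - 1) / real n ^ b"
    by (intro divide_right_mono pow_minus_falling(2)) simp
  also have "\<dots> \<le> (real b)\<^sup>2 * A ^ b / real n"
  proof (cases b)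
    case (Suc c)
    have "real x ^ (b - 1) / real n ^ b = (real x / real n) ^ c / real n" using Suc by (simp add: power_divide)
    also have "\<dots> \<le> A ^ c / real n" using r by (intro divide_right_mono power_mono) auto
    also have "\<dots> \<le> A ^ b / real n" using Suc assms(2) by (intro divide_right_mono power_increasing) auto
    finally have "(real b)\<^sup>2 * (real x ^ (b - 1) / real n ^ b) \<le> (real b)\<^sup>2 * (A ^ b / real n)" by (intro mult_left_mono) auto
    then show ?thesis by simp
  qed simp
  finally show "(real x / real n) ^ b - real (x choose b) * fact b / real n ^ b \<le> (real b)\<^sup>2 * A ^ b / real n" .
qed

lemma product_diff_le:
  fixes x1 x2 x3 a1 a2 :: real
  assumes "0 \<le> x1" "x1 \<le> a1" "a1 - x1 \<le> e1" "a1 \<le> B" "0 \<le> x2" "x2 \<le> a2" "a2 - x2 \<le> e2" "a2 \<le> 1"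
    "1 \<le> x3" "x3 - 1 \<le> e3" "x3 \<le> D" "0 \<le> e1" "0 \<le> e2" "0 \<le> e3"
  shows "\<bar>x1 * x2 * x3 - a1 * a2\<bar> \<le> e1 * D + B * e2 * D + B * e3"
proof -
  have B: "0 \<le> B" and D: "0 \<le> D" using assms by linarith+
  have eq: "x1 * x2 * x3 - a1 * a2 = (x1 - a1) * (x2 * x3) + a1 * (x2 - a2) * x3 + (a1 * a2) * (x3 - 1)"
    by (simp add: algebra_simps)
  have "\<bar>(x1 - a1) * (x2 * x3)\<bar> \<le> e1 * D"
  proof -
    have "x2 * x3 \<le> 1 * D" using assms by (intro mult_mono) auto
    then show ?thesis unfolding abs_mult using assms by (intro mult_mono) (auto simp: abs_mult)
  qed
  moreover have "\<bar>a1 * (x2 - a2) * x3\<bar> \<le> B * e2 * D"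
    unfolding abs_mult using assms B by (intro mult_mono) auto
  moreover have "\<bar>(a1 * a2) * (x3 - 1)\<bar> \<le> B * e3"
  proof -
    have "a1 * a2 \<le> B * 1" using assms B by (intro mult_mono) auto
    then show ?thesis unfolding abs_mult using assms B by (intro mult_mono) (auto simp: abs_mult)
  qed
  ultimately show ?thesis unfolding eq by linarith
qed

text \<open>\<open>t * hpoly K t c\<close> is the tree series at \<open>t * c\<close> truncated at
  order \<open>K\<close>. It predicts the unfrozen fraction from the isolated fraction
  \<open>c\<close> at time \<open>t\<close>; dividing by \<open>t\<close> inside the sum keeps time
  zero regular.\<close>

definition hpoly :: "nat \<Rightarrow> real \<Rightarrow> real \<Rightarrow> real" where
  "hpoly K t c = (\<Sum>k=1..K. tree_coeff k * t ^ (k - 1) * c ^ k)"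

lemma hpoly_mono: "0 \<le> t \<Longrightarrow> 0 \<le> c \<Longrightarrow> c \<le> d \<Longrightarrow> hpoly K t c \<le> hpoly K t d"
  unfolding hpoly_def by (intro sum_mono mult_left_mono power_mono) (auto simp: tree_coeff_nonneg)

lemma hpoly_nonneg: "0 \<le> t \<Longrightarrow> 0 \<le> c \<Longrightarrow> 0 \<le> hpoly K t c"
  unfolding hpoly_def by (intro sum_nonneg mult_nonneg_nonneg) (auto simp: tree_coeff_nonneg)

context frozen_process
begin

sublocale fl: fluid p
  by unfold_locales (rule p_pos, rule p_le_1)

text \<open>Three factors are perturbed: the falling factorials of \<open>m\<close> and of
  \<open>x\<close>, and the power of \<open>d = 1 - 1 / n\<close> by which \<open>N\<close> differs
  from \<open>n ^ 2 / 2\<close>.\<close>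

lemma mark_rate_approx:
  assumes "k \<ge> 1" "real m \<le> A * real n" "A \<ge> 1" "x \<le> n"
  shows "\<bar>mark_rate k m * real (x choose k) / real n -
     tree_coeff k / real k * (2 * real m / real n) ^ (k - 1) * (real x / real n) ^ k\<bar> \<le> mono_const k A / real n"
proof -
  define b where "b = k - 1"
  have k: "k = Suc b" using assms by (simp add: b_def)
  have n0: "real n > 0" using n_ge_2 by simp
  define d where "d = 1 - 1 / real n"
  have d: "1 / 2 \<le> d" "d \<le> 1" using n_ge_2 by (auto simp: d_def field_simps)
  define x1 where "x1 = real (m choose b) * fact b / real n ^ b"
  define x2 where "x2 = real (x choose k) * fact k / real n ^ k"
  define x3 where "x3 = 1 / d ^ b"
  have N: "N = (real n)\<^sup>2 / 2 * d" using n0 by (simp add: N_eq d_def power2_eq_square field_simps)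
  have T: "tree_number k = tree_coeff k / real k * fact k" using k by (simp add: tree_number_def tree_coeff_def)
  have s: "mark_rate k m * real (x choose k) / real n = tree_coeff k / real k * 2 ^ b * (x1 * x2 * x3)"
  proof -
    have "N ^ b * real n = (1 / 2 ^ b) * (real n ^ b * real n ^ k * d ^ b)"
      by (simp add: N k power_mult_distrib power_divide power2_eq_square)
    moreover have "mark_rate k m * real (x choose k) / real n =
      (tree_coeff k / real k) * ((real (m choose b) * fact b) * (real (x choose k) * fact k)) / (N ^ b * real n)"
      by (simp add: mark_rate_def T b_def mult_ac)
    ultimately show ?thesis by (simp add: x1_def x2_def x3_def)
  qed
  have t: "tree_coeff k / real k * (2 * real m / real n) ^ (k - 1) * (real x / real n) ^ k =
     tree_coeff k / real k * 2 ^ b * ((real m / real n) ^ b * (real x / real n) ^ k)"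
    by (simp add: b_def power_mult_distrib[symmetric])
  have n1: "n \<ge> 1" using n_ge_2 by simp
  have xn: "real x \<le> 1 * real n" using assms by simp
  note f1 = falling_ratio[OF assms(2,3) n1, of b, folded x1_def]
  note f2 = falling_ratio[OF xn order_refl n1, of k, folded x2_def]
  have x3: "1 \<le> x3" "x3 \<le> 2 ^ b" "x3 - 1 \<le> real b * 2 ^ b / real n"
  proof -
    have db: "0 < d ^ b" "d ^ b \<le> 1" "(1 / 2) ^ b \<le> d ^ b" using d by (auto intro: power_le_one power_mono)
    show "1 \<le> x3" using db by (simp add: x3_def)
    have "x3 \<le> 1 / (1 / 2) ^ b" unfolding x3_def using db by (intro divide_left_mono) auto
    then show x3b: "x3 \<le> 2 ^ b" by (simp add: power_divide)
    have "1 + real b * (- (1 / real n)) \<le> (1 + (- (1 / real n))) ^ b" using n_ge_2 by (intro Bernoulli_inequality) auto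
    then have "1 - d ^ b \<le> real b / real n" by (simp add: d_def)
    then have "(1 - d ^ b) * x3 \<le> (real b / real n) * 2 ^ b" using x3b \<open>1 \<le> x3\<close> db by (intro mult_mono) auto
    moreover have "(1 - d ^ b) * x3 = x3 - 1" using db d by (auto simp: x3_def diff_divide_distrib)
    ultimately show "x3 - 1 \<le> real b * 2 ^ b / real n" by simp
  qed
  have "\<bar>x1 * x2 * x3 - (real m / real n) ^ b * (real x / real n) ^ k\<bar> \<le>
     ((real b)\<^sup>2 * A ^ b / real n) * 2 ^ b + A ^ b * ((real k)\<^sup>2 * 1 ^ k / real n) * 2 ^ b + A ^ b * (real b * 2 ^ b / real n)"
    using f1 f2 x3 assms(3) by (intro product_diff_le) auto
  also have "\<dots> = A ^ b * 2 ^ b * ((real b)\<^sup>2 + (real k)\<^sup>2 + real b) / real n"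
    by (simp add: algebra_simps add_divide_distrib)
  finally have "(tree_coeff k / real k * 2 ^ b) * \<bar>x1 * x2 * x3 - (real m / real n) ^ b * (real x / real n) ^ k\<bar> \<le>
     (tree_coeff k / real k * 2 ^ b) * (A ^ b * 2 ^ b * ((real b)\<^sup>2 + (real k)\<^sup>2 + real b) / real n)"
    by (rule mult_left_mono) (simp add: tree_coeff_nonneg)
  moreover have "\<bar>mark_rate k m * real (x choose k) / real n -
     tree_coeff k / real k * (2 * real m / real n) ^ (k - 1) * (real x / real n) ^ k\<bar> =
     (tree_coeff k / real k * 2 ^ b) * \<bar>x1 * x2 * x3 - (real m / real n) ^ b * (real x / real n) ^ k\<bar>"
    unfolding s t right_diff_distrib[symmetric] abs_mult by (simp add: tree_coeff_nonneg)
  ultimately show ?thesis by (simp add: mono_const_def b_def mult_ac)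
qed

abbreviation ciso :: "multigraph \<Rightarrow> real" where "ciso G \<equiv> real (niso G) / real n"

abbreviation unf :: "multigraph \<Rightarrow> real" where "unf G \<equiv> real (nunf G) / real n"

abbreviation tm :: "nat \<Rightarrow> real" where "tm i \<equiv> 2 * real i / real n"

definition err_const :: "nat \<Rightarrow> real \<Rightarrow> real" where
  "err_const K A = (\<Sum>k=1..K. real k * (1 + approx_const k A + mono_const k A))"

lemma ciso_range: "0 \<le> ciso G" "ciso G \<le> 1"
  using niso_le[of G] n_ge_2 by auto

lemma unf_range: "0 \<le> unf G" "unf G \<le> 1"
  using nunf_le[of G] n_ge_2 by auto

lemma E_unf_approx:
  assumes "real m \<le> A * real n" "A \<ge> 1"
  shows "E m (\<lambda>G. \<bar>unf G - hpoly K (tm m) (ciso G)\<bar>) \<le> E m (\<lambda>G. real (nbig K G) / real n) + err_const K A / sqrt (real n)"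
proof -
  have n0: "real n > 0" "real n \<ge> 1" using n_ge_2 by auto
  let ?X = "\<lambda>k G. real (tree_count n k G) - mark_rate k m * chooseiso k G"
  have sq: "sqrt (real n) > 0" "sqrt (real n) * sqrt (real n) = real n" using n0 by auto
  have pt: "\<bar>unf G - hpoly K (tm m) (ciso G)\<bar> \<le>
     real (nbig K G) / real n + (\<Sum>k=1..K. real k * (1 / sqrt (real n) + (?X k G)\<^sup>2 / (real n * sqrt (real n)) + mono_const k A / real n))"
    if v: "valid n G" for G
  proof -
    have U: "unf G = real (nbig K G) / real n + (\<Sum>k=1..K. real k * (real (tree_count n k G) / real n))"
      unfolding nunf_split[OF v, of K] by (simp add: add_divide_distrib sum_divide_distrib)
    have H: "hpoly K (tm m) (ciso G) = (\<Sum>k=1..K. real k * (tree_coeff k / real k * tm m ^ (k - 1) * ciso G ^ k))"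
      unfolding hpoly_def by (rule sum.cong) auto
    have "\<bar>unf G - hpoly K (tm m) (ciso G)\<bar> = \<bar>real (nbig K G) / real n + (\<Sum>k=1..K. real k * (real (tree_count n k G) / real n - tree_coeff k / real k * tm m ^ (k - 1) * ciso G ^ k))\<bar>"
      unfolding U H by (simp add: right_diff_distrib sum_subtractf)
    also have "\<dots> \<le> real (nbig K G) / real n + \<bar>\<Sum>k=1..K. real k * (real (tree_count n k G) / real n - tree_coeff k / real k * tm m ^ (k - 1) * ciso G ^ k)\<bar>"
      by (rule order_trans[OF abs_triangle_ineq]) simp
    also have "\<bar>\<Sum>k=1..K. real k * (real (tree_count n k G) / real n - tree_coeff k / real k * tm m ^ (k - 1) * ciso G ^ k)\<bar> \<le>
      (\<Sum>k=1..K. real k * (1 / sqrt (real n) + (?X k G)\<^sup>2 / (real n * sqrt (real n)) + mono_const k A / real n))"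
    proof (rule order_trans[OF sum_abs], rule sum_mono)
      fix k assume k: "k \<in> {1..K}"
      \<comment> \<open>The second moment is of order \<open>n\<close>, so \<open>sqrt n\<close> is
        the right scale in \<open>|X| \<le> a + X ^ 2 / a\<close>.\<close>
      have "\<bar>?X k G\<bar> \<le> sqrt (real n) + (?X k G)\<^sup>2 / sqrt (real n)"
      proof -
        have "0 \<le> (\<bar>?X k G\<bar> - sqrt (real n))\<^sup>2" by simp
        then have "2 * \<bar>?X k G\<bar> * sqrt (real n) \<le> (?X k G)\<^sup>2 + real n"
          using sq by (simp add: power2_diff algebra_simps)
        moreover have "0 \<le> \<bar>?X k G\<bar> * sqrt (real n)" using sq by simp
        ultimately have "\<bar>?X k G\<bar> * sqrt (real n) \<le> (?X k G)\<^sup>2 + real n" by linarith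
        then show ?thesis using sq by (simp add: field_simps)
      qed
      then have "\<bar>?X k G\<bar> / real n \<le> (sqrt (real n) + (?X k G)\<^sup>2 / sqrt (real n)) / real n" using n0 by (intro divide_right_mono) auto
      also have "\<dots> = 1 / sqrt (real n) + (?X k G)\<^sup>2 / (real n * sqrt (real n))"
        using sq n0 by (simp add: field_simps)
      finally have 1: "\<bar>?X k G / real n\<bar> \<le> 1 / sqrt (real n) + (?X k G)\<^sup>2 / (real n * sqrt (real n))" using n0 by (simp add: abs_divide)
      have 2: "\<bar>mark_rate k m * chooseiso k G / real n - tree_coeff k / real k * tm m ^ (k - 1) * ciso G ^ k\<bar> \<le> mono_const k A / real n"
        using k by (intro mark_rate_approx assms niso_le) auto
      have "real (tree_count n k G) / real n - tree_coeff k / real k * tm m ^ (k - 1) * ciso G ^ k =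
        ?X k G / real n + (mark_rate k m * chooseiso k G / real n - tree_coeff k / real k * tm m ^ (k - 1) * ciso G ^ k)"
        by (simp add: diff_divide_distrib)
      then have "\<bar>real (tree_count n k G) / real n - tree_coeff k / real k * tm m ^ (k - 1) * ciso G ^ k\<bar> \<le>
        1 / sqrt (real n) + (?X k G)\<^sup>2 / (real n * sqrt (real n)) + mono_const k A / real n" using 1 2 by linarith
      then show "\<bar>real k * (real (tree_count n k G) / real n - tree_coeff k / real k * tm m ^ (k - 1) * ciso G ^ k)\<bar> \<le>
        real k * (1 / sqrt (real n) + (?X k G)\<^sup>2 / (real n * sqrt (real n)) + mono_const k A / real n)"
        unfolding abs_mult abs_of_nat by (intro mult_left_mono) auto
    qed
    finally show ?thesis by simp
  qed
  have "E m (\<lambda>G. \<bar>unf G - hpoly K (tm m) (ciso G)\<bar>) \<le> E m (\<lambda>G. real (nbig K G) / real n +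
      (\<Sum>k=1..K. real k * (1 / sqrt (real n) + (?X k G)\<^sup>2 / (real n * sqrt (real n)) + mono_const k A / real n)))"
    by (intro E_mono pt)
  also have "\<dots> = E m (\<lambda>G. real (nbig K G) / real n) +
      (\<Sum>k=1..K. real k * (1 / sqrt (real n) + E m (\<lambda>G. (?X k G)\<^sup>2) / (real n * sqrt (real n)) + mono_const k A / real n))"
    by (simp only: E_add E_setsum E_cmult E_divide E_const)
  also have "\<dots> \<le> E m (\<lambda>G. real (nbig K G) / real n) +
      (\<Sum>k=1..K. real k * (1 / sqrt (real n) + real n * approx_const k A / (real n * sqrt (real n)) + mono_const k A / sqrt (real n)))"
  proof (intro add_left_mono sum_mono mult_left_mono add_mono divide_right_mono)
    fix k assume k: "k \<in> {1..K}"
    then show "E m (\<lambda>G. (?X k G)\<^sup>2) \<le> real n * approx_const k A" by (intro E_tree_count_approx assms) auto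
    have "sqrt (real n) * 1 \<le> sqrt (real n) * sqrt (real n)" using n0 by (intro mult_left_mono) auto
    then have "sqrt (real n) \<le> real n" using sq by simp
    moreover have "0 \<le> mono_const k A" unfolding mono_const_def using assms(2)
      by (intro mult_nonneg_nonneg add_nonneg_nonneg divide_nonneg_nonneg) (auto simp: tree_coeff_nonneg)
    ultimately show "mono_const k A / real n \<le> mono_const k A / sqrt (real n)" using sq n0 by (intro divide_left_mono) auto
  qed (use n0 in auto)
  also have "(\<Sum>k=1..K. real k * (1 / sqrt (real n) + real n * approx_const k A / (real n * sqrt (real n)) + mono_const k A / sqrt (real n))) = err_const K A / sqrt (real n)"
    unfolding err_const_def sum_divide_distrib using n0 by (intro sum.cong) (auto simp: add_divide_distrib distrib_left)
  finally show ?thesis .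
qed

text \<open>The time average of the squared mass controls that of the mass through
  \<open>x \<le> \<delta> + x ^ 2 / \<delta>\<close>. Smallness at a single time is not
  claimed.\<close>

lemma sum_E_nbig:
  assumes "\<delta> > 0" "J \<ge> 1"
  shows "(\<Sum>i<m. E i (\<lambda>G. real (nbig (2 ^ J) G) / real n)) \<le> real m * (\<delta> + (2 / real J + 1 / real n) / \<delta>)"
proof -
  have n0: "real n > 0" using n_ge_2 by auto
  have J0: "real J > 0" using assms by simp
  let ?S = "\<Sum>i<m. E i (\<lambda>G. (real (nbig (2 ^ J) G))\<^sup>2)"
  have "real J * ?S \<le> real J * (real m * (real n)\<^sup>2 * (2 / real J + 1 / real n))"
  proof -
    have "real J * (real m * (real n)\<^sup>2 * (2 / real J + 1 / real n)) = 2 * (real n)\<^sup>2 * real m + real J * real m * real n"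
      using J0 n0 by (simp add: field_simps power2_eq_square)
    then show ?thesis using sum_nbig_squared[of J m] by linarith
  qed
  then have S: "?S \<le> real m * (real n)\<^sup>2 * (2 / real J + 1 / real n)" using J0 by simp
  have pt: "real x / real n \<le> \<delta> + (real x)\<^sup>2 / ((real n)\<^sup>2 * \<delta>)" for x :: nat
  proof (cases "real x / real n \<le> \<delta>")
    case False
    then have "\<delta> * (real x / real n) \<le> (real x / real n) * (real x / real n)" by (intro mult_right_mono) auto
    then have "real x / real n \<le> (real x)\<^sup>2 / ((real n)\<^sup>2 * \<delta>)" using assms(1) n0 by (simp add: field_simps power2_eq_square)
    then show ?thesis using assms(1) by simp
  next
    case True
    have "0 \<le> (real x)\<^sup>2 / ((real n)\<^sup>2 * \<delta>)" using assms(1) by simp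
    with True show ?thesis by linarith
  qed
  have "(\<Sum>i<m. E i (\<lambda>G. real (nbig (2 ^ J) G) / real n)) \<le> (\<Sum>i<m. E i (\<lambda>G. \<delta> + (real (nbig (2 ^ J) G))\<^sup>2 / ((real n)\<^sup>2 * \<delta>)))"
    by (intro sum_mono E_mono pt)
  also have "\<dots> = real m * \<delta> + ?S / ((real n)\<^sup>2 * \<delta>)"
    by (simp add: E_add E_divide sum.distrib sum_divide_distrib)
  also have "\<dots> \<le> real m * \<delta> + (real m * (real n)\<^sup>2 * (2 / real J + 1 / real n)) / ((real n)\<^sup>2 * \<delta>)"
    using S assms(1) by (intro add_left_mono divide_right_mono) auto
  also have "\<dots> = real m * (\<delta> + (2 / real J + 1 / real n) / \<delta>)"
  proof -
    have e: "(real m * (real n)\<^sup>2 * z) / ((real n)\<^sup>2 * \<delta>) = real m * (z / \<delta>)" for z using n0 assms(1) by simp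
    show ?thesis unfolding e by (rule distrib_left[symmetric])
  qed
  finally show ?thesis .
qed

section \<open>Mean square deviation from the fluid limit\<close>

abbreviation sqdev :: "nat \<Rightarrow> real" where
  "sqdev i \<equiv> E i (\<lambda>G. (ciso G - fl.y (tm i))\<^sup>2)"

text \<open>If \<open>u\<close> and \<open>w\<close> were equal to \<open>hpoly K t c\<close> and
  \<open>hpoly K t y\<close>, the left side would be minus the product of \<open>c - y\<close> with
  the corresponding difference of an increasing function, hence nonpositive. Only the closure errors
  of \<open>u\<close> and \<open>w\<close> remain, with constant one whatever \<open>K\<close>
  is.\<close>

lemma dissipative:
  assumes "0 \<le> t" "0 \<le> c" "c \<le> 1" "0 \<le> y" "y \<le> 1" "0 \<le> u"
  shows "- ((c - y) * (c * (p + (1 - p) * u) - y * (p + (1 - p) * w))) \<le> \<bar>u - hpoly K t c\<bar> + \<bar>w - hpoly K t y\<bar>"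
proof -
  let ?h = "hpoly K t"
  have m: "(c - y) * (c * ?h c - y * ?h y) \<ge> 0"
  proof (cases "c \<le> y")
    case True
    have "c * ?h c \<le> y * ?h y" using assms True by (intro mult_mono hpoly_mono hpoly_nonneg) auto
    then show ?thesis using True by (intro mult_nonpos_nonpos) auto
  next
    case False
    have "y * ?h y \<le> c * ?h c" using assms False by (intro mult_mono hpoly_mono hpoly_nonneg) auto
    then show ?thesis using False by (intro mult_nonneg_nonneg) auto
  qed
  have eq: "- ((c - y) * (c * (p + (1 - p) * u) - y * (p + (1 - p) * w))) =
    - (p * (c - y)\<^sup>2) - (1 - p) * ((c - y) * (c * ?h c - y * ?h y)) - (1 - p) * ((c - y) * (c * (u - ?h c) - y * (w - ?h y)))"
    by (simp add: power2_eq_square algebra_simps)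
  have cy: "\<bar>c - y\<bar> \<le> 1" using assms by auto
  have "\<bar>c * (u - ?h c) - y * (w - ?h y)\<bar> \<le> c * \<bar>u - ?h c\<bar> + y * \<bar>w - ?h y\<bar>"
    using abs_triangle_ineq4[of "c * (u - ?h c)" "y * (w - ?h y)"] assms by (simp add: abs_mult)
  also have "\<dots> \<le> 1 * \<bar>u - ?h c\<bar> + 1 * \<bar>w - ?h y\<bar>" using assms by (intro add_mono mult_right_mono) auto
  finally have b: "\<bar>c * (u - ?h c) - y * (w - ?h y)\<bar> \<le> \<bar>u - ?h c\<bar> + \<bar>w - ?h y\<bar>" by simp
  have "\<bar>(1 - p) * ((c - y) * (c * (u - ?h c) - y * (w - ?h y)))\<bar> \<le> 1 * (1 * (\<bar>u - ?h c\<bar> + \<bar>w - ?h y\<bar>))"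
    unfolding abs_mult using cy b p_pos p_le_1 by (intro mult_mono) auto
  moreover have "0 \<le> p * (c - y)\<^sup>2" using p_pos by simp
  moreover have "0 \<le> (1 - p) * ((c - y) * (c * ?h c - y * ?h y))" using m p_le_1 by simp
  moreover have "\<bar>c'\<bar> \<le> 1 * (1 * B) \<Longrightarrow> 0 \<le> a' \<Longrightarrow> 0 \<le> b' \<Longrightarrow> - a' - b' - c' \<le> B" for a' b' c' B :: real
    by linarith
  ultimately show ?thesis unfolding eq by blast
qed

lemma hit_weight_1_approx:
  assumes "valid n G"
  shows "\<bar>hit_weight 1 (nunf G) / N - 2 / real n * (p + (1 - p) * unf G)\<bar> \<le> 4 / (real n)\<^sup>2"
proof -
  have n0: "real n \<ge> 2" using n_ge_2 by auto
  define w where "w = real (nunf G) + p * (real n - real (nunf G))"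
  have w: "0 \<le> w" "w \<le> real n"
    using nunf_le[of G] p_pos hit_weight_le[OF nunf_le, of 1 G] mult_right_mono[OF p_le_1, of "real n - real (nunf G)"] by (auto simp: w_def)
  have h: "hit_weight 1 (nunf G) = w - 1" by (simp add: hit_weight_def w_def)
  have u: "p + (1 - p) * unf G = w / real n" using n0 by (simp add: w_def field_simps)
  have "hit_weight 1 (nunf G) / N - 2 / real n * (p + (1 - p) * unf G) = 2 * (w - real n) / ((real n)\<^sup>2 * (real n - 1))"
    unfolding h u N_eq using n0 by (simp add: field_simps power2_eq_square)
  also have "\<bar>\<dots>\<bar> = 2 * (real n - w) / ((real n)\<^sup>2 * (real n - 1))" using w n0 by (simp add: abs_mult abs_divide)
  also have "\<dots> \<le> 2 * real n / ((real n)\<^sup>2 * (real n - 1))" using w n0 by (intro divide_right_mono) auto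
  also have "\<dots> \<le> 4 / (real n)\<^sup>2"
    using n0 by (simp add: field_simps power2_eq_square)
  finally show ?thesis .
qed

text \<open>A discrete energy estimate. The drift is handled by \<open>dissipative\<close>; squared
  jumps and squared increments of \<open>y\<close> are of order \<open>1 / n ^ 2\<close>. The
  decrease of \<open>q\<close> is kept as a difference because it telescopes, which spares a bound
  on second derivatives of \<open>y\<close>.\<close>

lemma sqdev_step:
  shows "sqdev (Suc i) \<le> sqdev i + 4 / real n * (E i (\<lambda>G. \<bar>unf G - hpoly K (tm i) (ciso G)\<bar>) + \<bar>fl.v (tm i) - hpoly K (tm i) (fl.y (tm i))\<bar>)
    + 16 / (real n)\<^sup>2 + 4 / real n * (fl.q (tm i) - fl.q (tm (Suc i)))"
proof -
  have n0: "real n > 0" using n_ge_2 by auto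
  define y y' q q' where "y = fl.y (tm i)" "y' = fl.y (tm (Suc i))" "q = fl.q (tm i)" "q' = fl.q (tm (Suc i))"
  have t0: "0 \<le> tm i" "0 \<le> tm (Suc i)" by auto
  have h: "tm (Suc i) - tm i = 2 / real n" by (simp add: add_divide_distrib algebra_simps)
  have le: "tm i \<le> tm (Suc i)" using h n0 by (simp add: divide_right_mono)
  have yq: "2 / real n * q' \<le> y - y'" "y - y' \<le> 2 / real n * q"
    using fl.y_increment[OF le] unfolding h y_y'_q_q'_def by auto
  have q: "0 \<le> q'" "q \<le> 1" unfolding y_y'_q_q'_def using fl.q_nonneg fl.q_le_1[OF t0(1)] by auto
  have yr: "0 \<le> y" "y \<le> 1" "0 \<le> y'" "y' \<le> 1"
    unfolding y_y'_q_q'_def using fl.y_pos fl.y_le_1 t0 by (auto intro: less_imp_le)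
  have yy: "0 \<le> y - y'" "y - y' \<le> 2 / real n"
  proof -
    have "0 \<le> 2 / real n * q'" using q n0 by simp
    then show "0 \<le> y - y'" using yq by linarith
    have "2 / real n * q \<le> 2 / real n * 1" using q n0 by (intro mult_left_mono) auto
    then show "y - y' \<le> 2 / real n" using yq by linarith
  qed
  let ?R = "\<lambda>G. 4 / real n * (\<bar>unf G - hpoly K (tm i) (ciso G)\<bar> + \<bar>fl.v (tm i) - hpoly K (tm i) y\<bar>) + 16 / (real n)\<^sup>2 + 4 / real n * (q - q')"
  have pt: "(ciso G - y')\<^sup>2 + gen (\<lambda>G. (ciso G - y')\<^sup>2) G / N \<le> (ciso G - y)\<^sup>2 + ?R G" if v: "valid n G" for G
  proof -
    define c u \<theta> where "c = ciso G" "u = unf G" "\<theta> = hit_weight 1 (nunf G)"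
    have c: "0 \<le> c" "c \<le> 1" and u: "0 \<le> u" unfolding c_u_\<theta>_def using ciso_range unf_range by auto
    have \<theta>c: "0 \<le> c * \<theta>" using chooseiso_hit_nonneg[OF v, of 1] n0 by (simp add: c_u_\<theta>_def)
    \<comment> \<open>Expanding the square gives a part linear in the change of \<open>niso\<close>,
      whose drift is known exactly, and a quadratic part of at most \<open>4 / n ^ 2\<close> per
      edge.\<close>
    have "gen (\<lambda>G. (ciso G - y')\<^sup>2) G \<le> (\<Sum>e\<in>edges. accept G e * (2 * (c - y') * ((real (niso (add_mset e G)) - real (niso G)) / real n) + 4 / (real n)\<^sup>2))"
    proof (rule gen_le[OF v])
      fix e assume e: "e \<in> edges" "accept G e \<noteq> 0"
      obtain x z where xz: "e = {x, z}" "x \<noteq> z" using e(1) by (rule edgesE)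
      define d where "d = (real (niso (add_mset e G)) - real (niso G)) / real n"
      have sub: "isolated (add_mset e G) = isolated G - {x, z}" unfolding xz(1) by (rule isolated_add_edge[OF xz(2)])
      have "niso (add_mset e G) \<le> niso G" unfolding sub by (intro card_mono) auto
      moreover have "niso G \<le> niso (add_mset e G) + 2"
      proof -
        have "isolated G \<subseteq> isolated (add_mset e G) \<union> {x, z}" unfolding sub by auto
        then have "niso G \<le> card (isolated (add_mset e G) \<union> {x, z})" by (intro card_mono) auto
        also have "\<dots> \<le> niso (add_mset e G) + card {x, z}" by (rule card_Un_le)
        finally show ?thesis using xz(2) by simp
      qed
      ultimately have "\<bar>real (niso (add_mset e G)) - real (niso G)\<bar> \<le> 2" by linarith
      then have "\<bar>d\<bar> \<le> 2 / real n" unfolding d_def abs_divide using n0 by (simp add: divide_right_mono)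
      then have "d\<^sup>2 \<le> (2 / real n)\<^sup>2" by (simp add: abs_le_square_iff[symmetric])
      moreover have "ciso (add_mset e G) = c + d" by (simp add: c_u_\<theta>_def d_def diff_divide_distrib)
      then have "(ciso (add_mset e G) - y')\<^sup>2 - (c - y')\<^sup>2 = 2 * (c - y') * d + d\<^sup>2" by (simp add: power2_eq_square algebra_simps)
      ultimately show "(ciso (add_mset e G) - y')\<^sup>2 - (ciso G - y')\<^sup>2 \<le> 2 * (c - y') * ((real (niso (add_mset e G)) - real (niso G)) / real n) + 4 / (real n)\<^sup>2"
        by (simp add: d_def c_u_\<theta>_def power_divide)
    qed
    also have "\<dots> = 2 * (c - y') / real n * gen (\<lambda>G. chooseiso 1 G) G + (\<Sum>e\<in>edges. accept G e) * (4 / (real n)\<^sup>2)"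
      unfolding gen_def by (simp add: distrib_left sum.distrib sum_distrib_left sum_distrib_right sum_divide_distrib mult_ac)
    also have "(\<Sum>e\<in>edges. accept G e) * (4 / (real n)\<^sup>2) \<le> N * (4 / (real n)\<^sup>2)"
      unfolding N_def using accept_le_1 sum_mono[of edges "accept G" "\<lambda>_. 1"] by (intro mult_right_mono) auto
    finally have "gen (\<lambda>G. (ciso G - y')\<^sup>2) G \<le> 2 * (c - y') / real n * gen (\<lambda>G. chooseiso 1 G) G + N * (4 / (real n)\<^sup>2)" by simp
    also have "2 * (c - y') / real n * gen (\<lambda>G. chooseiso 1 G) G = - (2 * (c - y') * (c * \<theta>))"
      unfolding gen_choose_isolated[OF v] by (simp add: c_u_\<theta>_def)
    finally have "gen (\<lambda>G. (ciso G - y')\<^sup>2) G / N \<le> (- (2 * (c - y') * (c * \<theta>)) + N * (4 / (real n)\<^sup>2)) / N"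
      using N_pos by (intro divide_right_mono) auto
    also have "\<dots> = - (2 * (c - y') * (c * \<theta> / N)) + 4 / (real n)\<^sup>2"
    proof -
      have e: "(- a + N * z) / N = - (a / N) + z" for a z using N_pos by (simp add: field_simps)
      show ?thesis unfolding e by simp
    qed
    finally have g: "gen (\<lambda>G. (ciso G - y')\<^sup>2) G / N \<le> - (2 * (c - y') * (c * \<theta> / N)) + 4 / (real n)\<^sup>2" .
    define w where "w = p + (1 - p) * u"
    have \<theta>w: "\<bar>\<theta> / N - 2 / real n * w\<bar> \<le> 4 / (real n)\<^sup>2" unfolding w_def c_u_\<theta>_def by (rule hit_weight_1_approx[OF v])
    \<comment> \<open>Replacing \<open>y'\<close> by \<open>y\<close> is in the favourable
      direction, since \<open>y' \<le> y\<close> and the loss term \<open>c * \<theta>\<close> is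
      nonnegative.\<close>
    have "- (2 * (c - y') * (c * \<theta> / N)) \<le> - (2 * (c - y) * (c * \<theta> / N))"
    proof -
      have "0 \<le> (y - y') * (c * \<theta> / N)" using yy(1) \<theta>c N_pos by (intro mult_nonneg_nonneg) auto
      moreover have "0 \<le> (y - y') * z \<Longrightarrow> - (2 * (c - y') * z) \<le> - (2 * (c - y) * z)" for z
        by (simp add: algebra_simps)
      ultimately show ?thesis by blast
    qed
    also have "\<dots> \<le> - (2 * (c - y) * (c * (2 / real n * w))) + 8 / (real n)\<^sup>2"
    proof -
      have "\<bar>2 * (c - y) * c * (\<theta> / N - 2 / real n * w)\<bar> \<le> 2 * 1 * 1 * (4 / (real n)\<^sup>2)"
        unfolding abs_mult using \<theta>w c yr by (intro mult_mono) auto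
      then show ?thesis by (simp add: algebra_simps)
    qed
    finally have g2: "gen (\<lambda>G. (ciso G - y')\<^sup>2) G / N \<le> - (4 / real n * ((c - y) * (c * w))) + 12 / (real n)\<^sup>2"
      using g by (simp add: algebra_simps)
    have sq: "(c - y')\<^sup>2 = (c - y)\<^sup>2 + 2 * (c - y) * (y - y') + (y - y')\<^sup>2" by (simp add: power2_eq_square algebra_simps)
    have sq2: "(y - y')\<^sup>2 \<le> 4 / (real n)\<^sup>2"
      using power_mono[OF yy(2) yy(1), of 2] by (simp add: power_divide)
    \<comment> \<open>The increment \<open>y - y'\<close> is compared with the rate at the start of
      the step; the defect is at most the decrease of \<open>q\<close> during the step.\<close>
    have inc: "2 * (c - y) * (y - y') \<le> 4 / real n * ((c - y) * q) + 4 / real n * (q - q')"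
    proof -
      have "\<bar>(y - y') - 2 / real n * q\<bar> \<le> 2 / real n * (q - q')"
        unfolding right_diff_distrib using yq by linarith
      then have "\<bar>2 * (c - y) * ((y - y') - 2 / real n * q)\<bar> \<le> 2 * 1 * (2 / real n * (q - q'))"
        unfolding abs_mult using c yr by (intro mult_mono) auto
      moreover have "\<bar>2 * d * (z - a * q)\<bar> \<le> 2 * 1 * (a * r) \<Longrightarrow> 2 * d * z \<le> 2 * a * (d * q) + 2 * a * r" for d z a r
        by (simp add: algebra_simps)
      ultimately have "2 * (c - y) * (y - y') \<le> 2 * (2 / real n) * ((c - y) * q) + 2 * (2 / real n) * (q - q')" by blast
      then show ?thesis by simp
    qed
    have dis: "- ((c - y) * (c * w - q)) \<le> \<bar>u - hpoly K (tm i) c\<bar> + \<bar>fl.v (tm i) - hpoly K (tm i) y\<bar>"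
      unfolding w_def y_y'_q_q'_def(3) fl.q_def using dissipative[OF t0(1) c yr(1,2) u, of "fl.v (tm i)" K]
      by (simp add: y_y'_q_q'_def)
    have "4 / real n * (- ((c - y) * (c * w - q))) \<le> 4 / real n * (\<bar>u - hpoly K (tm i) c\<bar> + \<bar>fl.v (tm i) - hpoly K (tm i) y\<bar>)"
      using dis n0 by (intro mult_left_mono) auto
    moreover have "4 / real n * (- ((c - y) * (c * w - q))) = - (4 / real n * ((c - y) * (c * w))) + 4 / real n * ((c - y) * q)"
    proof -
      have "a * (- (d * (x - z))) = - (a * (d * x)) + a * (d * z)" for a d x z :: real by (simp add: algebra_simps)
      then show ?thesis .
    qed
    moreover have "12 / (real n)\<^sup>2 + 4 / (real n)\<^sup>2 = 16 / (real n)\<^sup>2" by simp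
    ultimately have "(c - y')\<^sup>2 + gen (\<lambda>G. (ciso G - y')\<^sup>2) G / N \<le> (c - y)\<^sup>2 +
      (4 / real n * (\<bar>u - hpoly K (tm i) c\<bar> + \<bar>fl.v (tm i) - hpoly K (tm i) y\<bar>) + 16 / (real n)\<^sup>2 + 4 / real n * (q - q'))"
      using g2 sq sq2 inc by linarith
    then show ?thesis by (simp only: c_u_\<theta>_def)
  qed
  have "sqdev (Suc i) \<le> E i (\<lambda>G. (ciso G - y)\<^sup>2 + ?R G)"
    unfolding E_Suc by (rule E_mono) (use pt in \<open>simp add: y_y'_q_q'_def\<close>)
  also have "\<dots> = E i (\<lambda>G. (ciso G - y)\<^sup>2) + (4 / real n * (E i (\<lambda>G. \<bar>unf G - hpoly K (tm i) (ciso G)\<bar>) + \<bar>fl.v (tm i) - hpoly K (tm i) y\<bar>) + 16 / (real n)\<^sup>2 + 4 / real n * (q - q'))"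
    by (simp only: E_add E_cmult E_const)
  finally show ?thesis by (simp add: y_y'_q_q'_def)
qed

lemma sqdev_bound:
  "sqdev m \<le> 4 / real n * ((\<Sum>i<m. E i (\<lambda>G. \<bar>unf G - hpoly K (tm i) (ciso G)\<bar>)) + (\<Sum>i<m. \<bar>fl.v (tm i) - hpoly K (tm i) (fl.y (tm i))\<bar>))
    + 16 * real m / (real n)\<^sup>2 + 4 / real n"
proof -
  let ?a = "\<lambda>i. E i (\<lambda>G. \<bar>unf G - hpoly K (tm i) (ciso G)\<bar>)" and ?b = "\<lambda>i. \<bar>fl.v (tm i) - hpoly K (tm i) (fl.y (tm i))\<bar>"
  have n0: "real n > 0" using n_ge_2 by auto
  have "sqdev m \<le> 4 / real n * ((\<Sum>i<m. ?a i) + (\<Sum>i<m. ?b i)) + 16 * real m / (real n)\<^sup>2 + 4 / real n * (fl.q 0 - fl.q (tm m))"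
  proof (induction m)
    case 0
    have "isolated {#} = {1..n}" by (auto simp: isolated_def)
    then have "ciso {#} = 1" using n0 by simp
    then show ?case by (simp add: fl.y_early)
  next
    case (Suc m)
    have e: "4 / real n * ((\<Sum>i<Suc m. ?a i) + (\<Sum>i<Suc m. ?b i)) + 16 * real (Suc m) / (real n)\<^sup>2 + 4 / real n * (fl.q 0 - fl.q (tm (Suc m)))
      = (4 / real n * ((\<Sum>i<m. ?a i) + (\<Sum>i<m. ?b i)) + 16 * real m / (real n)\<^sup>2 + 4 / real n * (fl.q 0 - fl.q (tm m)))
       + (4 / real n * (?a m + ?b m) + 16 / (real n)\<^sup>2 + 4 / real n * (fl.q (tm m) - fl.q (tm (Suc m))))"
      unfolding sum.lessThan_Suc of_nat_Suc by (simp only: distrib_left right_diff_distrib add_divide_distrib mult_1_right)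
    show ?case unfolding e using Suc.IH sqdev_step[of m K] by linarith
  qed
  moreover have "4 / real n * (fl.q 0 - fl.q (tm m)) \<le> 4 / real n * 1"
    using fl.q_nonneg[of "tm m"] fl.q_le_1[of 0] n0 by (intro mult_left_mono) auto
  ultimately show ?thesis by linarith
qed

end

section \<open>Law of large numbers\<close>

context fluid
begin

definition tail :: "nat \<Rightarrow> real" where
  "tail K = exp 1 * (1 - (\<Sum>k<Suc K. tree_coeff k * exp (- 1) ^ k))"

lemma tree_coeff_sums_1: "(\<lambda>k. tree_coeff k * exp (- 1) ^ k) sums 1"
  using tree_function_sums[of 1] by simp

lemma tail_nonneg: "tail K \<ge> 0"
proof -
  have "(\<Sum>k<Suc K. tree_coeff k * exp (- 1) ^ k) \<le> suminf (\<lambda>k. tree_coeff k * exp (- 1) ^ k)"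
    by (rule sum_le_suminf[OF sums_summable[OF tree_coeff_sums_1]]) (auto simp: tree_coeff_nonneg)
  also have "\<dots> = 1" by (rule sums_unique[OF tree_coeff_sums_1, symmetric])
  finally show ?thesis by (simp add: tail_def)
qed

lemma tail_limit: "(\<lambda>J. tail (2 ^ J)) \<longlonglongrightarrow> 0"
proof -
  have "(\<lambda>K. \<Sum>k<K. tree_coeff k * exp (- 1) ^ k) \<longlonglongrightarrow> 1" using tree_coeff_sums_1 by (simp add: sums_def)
  moreover have "filterlim (\<lambda>J::nat. Suc (2 ^ J)) at_top sequentially"
  proof (rule filterlim_at_top_mono[OF filterlim_ident])
    show "eventually (\<lambda>J. J \<le> Suc (2 ^ J)) sequentially"
      using less_exp by (intro always_eventually allI) (simp add: le_SucI less_imp_le)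
  qed
  ultimately have "(\<lambda>J. \<Sum>k<Suc (2 ^ J). tree_coeff k * exp (- 1) ^ k) \<longlonglongrightarrow> 1" by (rule filterlim_compose)
  from tendsto_mult[OF tendsto_const[of "exp 1"] tendsto_diff[OF tendsto_const[of 1] this]]
  show ?thesis by (simp add: tail_def)
qed

text \<open>As \<open>t * y t \<le> exp (- 1)\<close>, the tail of the tree series is dominated by
  the tail at the critical argument, uniformly in time. One factor is bounded by \<open>t\<close>
  instead, and this is the \<open>t\<close> that is divided out, so small times do no harm.\<close>

lemma v_hpoly:
  assumes "t \<ge> 0" "K \<ge> 1" shows "\<bar>v t - hpoly K t (y t)\<bar> \<le> tail K"
proof (cases "t = 0")
  case True
  have "hpoly K 0 1 = (\<Sum>k\<in>{1}. tree_coeff k * 0 ^ (k - 1) * 1 ^ k)"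
    unfolding hpoly_def using assms(2) by (intro sum.mono_neutral_right) auto
  then have "hpoly K 0 1 = 1" by (simp add: tree_coeff_def)
  moreover have "v 0 = 1" "y 0 = 1" by (simp_all add: v_def frozen_frac_def y_early)
  ultimately show ?thesis using True tail_nonneg by simp
next
  case False
  then have t: "t > 0" using assms by simp
  let ?f = "\<lambda>k. tree_coeff k * (t * y t) ^ k" and ?g = "\<lambda>k. t * exp 1 * (tree_coeff k * exp (- 1) ^ k)"
  have th: "t * hpoly K t (y t) = (\<Sum>k<Suc K. ?f k)"
  proof -
    have "(\<Sum>k<Suc K. ?f k) = (\<Sum>k=1..K. ?f k)"
      by (rule sum.mono_neutral_cong_right) (auto simp: tree_coeff_def Suc_le_eq)
    also have "\<dots> = (\<Sum>k=1..K. t * (tree_coeff k * t ^ (k - 1) * y t ^ k))"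
    proof (rule sum.cong)
      fix k assume "k \<in> {1..K}"
      then have "t ^ k = t * t ^ (k - 1)" by (cases k) auto
      then show "?f k = t * (tree_coeff k * t ^ (k - 1) * y t ^ k)" by (simp add: power_mult_distrib)
    qed simp
    finally show ?thesis by (simp add: hpoly_def sum_distrib_left)
  qed
  have s1: "(\<lambda>k. ?f (k + Suc K)) sums (t * v t - (\<Sum>k<Suc K. ?f k))"
    by (rule sums_split_initial_segment[OF tree_series[OF assms(1)]])
  have s2: "(\<lambda>k. ?g (k + Suc K)) sums (t * exp 1 * 1 - (\<Sum>k<Suc K. ?g k))"
    by (rule sums_split_initial_segment) (rule sums_mult[OF tree_coeff_sums_1])
  have fy: "0 \<le> t * y t" "t * y t \<le> exp (- 1)"
  proof -
    show "0 \<le> t * y t" using t y_pos[of t] by simp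
    have "t * y t = (t * v t) * exp (- (t * v t))" by (simp add: y_def)
    then show "t * y t \<le> exp (- 1)" by (simp only: x_exp_le)
  qed
  have le: "?f (k + Suc K) \<le> ?g (k + Suc K)" for k
  proof -
    have "(t * y t) ^ (k + Suc K) = (t * y t) * (t * y t) ^ (k + K)" by simp
    also have "\<dots> \<le> (t * 1) * exp (- 1) ^ (k + K)"
      using fy t y_le_1[of t] y_pos[of t] by (intro mult_mono power_mono) auto
    also have "\<dots> = t * exp 1 * exp (- 1) ^ (k + Suc K)"
      by (simp add: exp_minus)
    finally show ?thesis using mult_left_mono[OF _ tree_coeff_nonneg[of "k + Suc K"]] by (fastforce simp: mult_ac)
  qed
  have "t * v t - (\<Sum>k<Suc K. ?f k) \<le> t * exp 1 * 1 - (\<Sum>k<Suc K. ?g k)" by (rule sums_le[OF le s1 s2])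
  also have "\<dots> = t * tail K"
    unfolding tail_def sum_distrib_left[symmetric] by (simp only: right_diff_distrib mult.assoc)
  finally have "t * (v t - hpoly K t (y t)) \<le> t * tail K" by (simp add: right_diff_distrib th)
  then have 1: "v t - hpoly K t (y t) \<le> tail K" using t by simp
  have "0 \<le> t * v t - (\<Sum>k<Suc K. ?f k)"
    by (rule sums_le[OF _ sums_zero s1]) (use fy in \<open>simp add: tree_coeff_nonneg\<close>)
  then have "0 \<le> t * (v t - hpoly K t (y t))" by (simp add: right_diff_distrib th)
  then have "0 \<le> v t - hpoly K t (y t)" using t by (simp add: zero_le_mult_iff)
  with 1 show ?thesis by simp
qed

end

text \<open>The constant depends on \<open>K\<close>, which is acceptable here: it is used for a
  fixed \<open>K\<close>, with the deviation of the isolated fraction made small afterwards.\<close>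

lemma hpoly_lipschitz:
  assumes "0 \<le> t" "t \<le> B" "1 \<le> B" "0 \<le> c" "c \<le> 1" "0 \<le> d" "d \<le> 1"
  shows "\<bar>hpoly K t c - hpoly K t d\<bar> \<le> (\<Sum>k=1..K. tree_coeff k * B ^ (k - 1) * real k) * \<bar>c - d\<bar>"
proof -
  have pw: "\<bar>c ^ k - d ^ k\<bar> \<le> real k * \<bar>c - d\<bar>" for k
    using norm_power_diff[of c d k] assms by simp
  have "\<bar>hpoly K t c - hpoly K t d\<bar> = \<bar>\<Sum>k=1..K. tree_coeff k * t ^ (k - 1) * (c ^ k - d ^ k)\<bar>"
    by (simp add: hpoly_def sum_subtractf right_diff_distrib)
  also have "\<dots> \<le> (\<Sum>k=1..K. \<bar>tree_coeff k * t ^ (k - 1) * (c ^ k - d ^ k)\<bar>)" by (rule sum_abs)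
  also have "\<dots> \<le> (\<Sum>k=1..K. tree_coeff k * B ^ (k - 1) * (real k * \<bar>c - d\<bar>))"
  proof (rule sum_mono)
    fix k
    have "\<bar>tree_coeff k * t ^ (k - 1)\<bar> \<le> tree_coeff k * B ^ (k - 1)"
      using assms by (simp add: abs_mult tree_coeff_nonneg power_abs) (intro mult_left_mono power_mono tree_coeff_nonneg; simp)
    then show "\<bar>tree_coeff k * t ^ (k - 1) * (c ^ k - d ^ k)\<bar> \<le> tree_coeff k * B ^ (k - 1) * (real k * \<bar>c - d\<bar>)"
      unfolding abs_mult[of _ "c ^ k - d ^ k"] using pw assms by (intro mult_mono) (auto simp: tree_coeff_nonneg)
  qed
  finally show ?thesis by (simp add: sum_distrib_right mult.assoc)
qed

context frozen_process
begin

text \<open>Accumulated closure errors of the process and of the fluid limit, the only quantity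
  through which the truncation level enters the deviation.\<close>

definition mass_err :: "nat \<Rightarrow> nat \<Rightarrow> real" where
  "mass_err K m = (\<Sum>i<m. E i (\<lambda>G. \<bar>unf G - hpoly K (tm i) (ciso G)\<bar>)) + (\<Sum>i<m. \<bar>fl.v (tm i) - hpoly K (tm i) (fl.y (tm i))\<bar>)"

lemma mass_err_bound:
  assumes "0 < \<delta>" "1 \<le> J" "1 \<le> A" "real m \<le> A * real n"
  shows "mass_err (2 ^ J) m \<le> real m * (\<delta> + (2 / real J + 1 / real n) / \<delta> + err_const (2 ^ J) A / sqrt (real n) + fl.tail (2 ^ J))"
proof -
  have "(\<Sum>i<m. E i (\<lambda>G. \<bar>unf G - hpoly (2 ^ J) (tm i) (ciso G)\<bar>)) \<le>
     (\<Sum>i<m. E i (\<lambda>G. real (nbig (2 ^ J) G) / real n) + err_const (2 ^ J) A / sqrt (real n))"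
    by (intro sum_mono E_unf_approx assms) (use assms(4) in auto)
  also have "\<dots> \<le> real m * (\<delta> + (2 / real J + 1 / real n) / \<delta>) + real m * (err_const (2 ^ J) A / sqrt (real n))"
    using sum_E_nbig[OF assms(1,2), of m] by (simp add: sum.distrib)
  finally have 1: "(\<Sum>i<m. E i (\<lambda>G. \<bar>unf G - hpoly (2 ^ J) (tm i) (ciso G)\<bar>)) \<le>
    real m * (\<delta> + (2 / real J + 1 / real n) / \<delta>) + real m * (err_const (2 ^ J) A / sqrt (real n))" .
  have "(\<Sum>i<m. \<bar>fl.v (tm i) - hpoly (2 ^ J) (tm i) (fl.y (tm i))\<bar>) \<le> (\<Sum>i<m. fl.tail (2 ^ J))"
    by (intro sum_mono fl.v_hpoly) auto
  then have 2: "(\<Sum>i<m. \<bar>fl.v (tm i) - hpoly (2 ^ J) (tm i) (fl.y (tm i))\<bar>) \<le> real m * fl.tail (2 ^ J)" by simp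
  show ?thesis unfolding mass_err_def using 1 2 by (simp only: distrib_left)
qed

lemma sqdev_mass_err: "sqdev m \<le> 4 / real n * mass_err K m + 16 * real m / (real n)\<^sup>2 + 4 / real n"
  unfolding mass_err_def by (rule sqdev_bound)

lemma E_abs_dev:
  assumes "0 < \<eta>" shows "E i (\<lambda>G. \<bar>ciso G - fl.y (tm i)\<bar>) \<le> \<eta> + sqdev i / \<eta>"
proof -
  have "\<bar>x\<bar> \<le> \<eta> + x\<^sup>2 / \<eta>" for x :: real
  proof (cases "\<bar>x\<bar> \<le> \<eta>")
    case True
    have "0 \<le> x\<^sup>2 / \<eta>" using assms by simp
    with True show ?thesis by linarith
  next
    case False
    then have "\<eta> * \<bar>x\<bar> \<le> \<bar>x\<bar> * \<bar>x\<bar>" by (intro mult_right_mono) auto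
    then have "\<bar>x\<bar> \<le> x\<^sup>2 / \<eta>" using assms by (simp add: pos_le_divide_eq power2_eq_square mult.commute)
    then show ?thesis using assms by simp
  qed
  then have "E i (\<lambda>G. \<bar>ciso G - fl.y (tm i)\<bar>) \<le> E i (\<lambda>G. \<eta> + (ciso G - fl.y (tm i))\<^sup>2 / \<eta>)" by (intro E_mono)
  then show ?thesis by (simp add: E_add E_divide)
qed

lemma sum_E_unf_v:
  assumes "1 \<le> A" "real m \<le> A * real n" "0 < \<eta>" "\<And>i. i < m \<Longrightarrow> sqdev i \<le> \<sigma>"
  shows "(\<Sum>i<m. E i (\<lambda>G. \<bar>unf G - fl.v (tm i)\<bar>)) \<le> mass_err K m +
     real m * ((\<Sum>k=1..K. tree_coeff k * (2 * A) ^ (k - 1) * real k) * (\<eta> + \<sigma> / \<eta>))"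
proof -
  let ?L = "\<Sum>k=1..K. tree_coeff k * (2 * A) ^ (k - 1) * real k"
  have n0: "real n > 0" using n_ge_2 by simp
  have L: "?L \<ge> 0" using assms(1) by (intro sum_nonneg mult_nonneg_nonneg) (auto simp: tree_coeff_nonneg)
  have "E i (\<lambda>G. \<bar>unf G - fl.v (tm i)\<bar>) \<le> E i (\<lambda>G. \<bar>unf G - hpoly K (tm i) (ciso G)\<bar>) +
    \<bar>fl.v (tm i) - hpoly K (tm i) (fl.y (tm i))\<bar> + ?L * (\<eta> + \<sigma> / \<eta>)" if i: "i < m" for i
  proof -
    have tmA: "tm i \<le> 2 * A"
    proof -
      have "real i \<le> A * real n" using i assms(2) by simp
      then have "2 * real i \<le> 2 * A * real n" by simp
      then show ?thesis using n0 by (simp add: pos_divide_le_eq)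
    qed
    have "E i (\<lambda>G. \<bar>unf G - fl.v (tm i)\<bar>) \<le> E i (\<lambda>G. \<bar>unf G - hpoly K (tm i) (ciso G)\<bar> +
       \<bar>fl.v (tm i) - hpoly K (tm i) (fl.y (tm i))\<bar> + ?L * \<bar>ciso G - fl.y (tm i)\<bar>)"
    proof (rule E_mono)
      fix G
      have "\<bar>hpoly K (tm i) (ciso G) - hpoly K (tm i) (fl.y (tm i))\<bar> \<le> ?L * \<bar>ciso G - fl.y (tm i)\<bar>"
        using tmA assms(1) ciso_range[of G] fl.y_pos[of "tm i"] fl.y_le_1[of "tm i"] by (intro hpoly_lipschitz) auto
      then show "\<bar>unf G - fl.v (tm i)\<bar> \<le> \<bar>unf G - hpoly K (tm i) (ciso G)\<bar> +
         \<bar>fl.v (tm i) - hpoly K (tm i) (fl.y (tm i))\<bar> + ?L * \<bar>ciso G - fl.y (tm i)\<bar>" by linarith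
    qed
    also have "\<dots> = E i (\<lambda>G. \<bar>unf G - hpoly K (tm i) (ciso G)\<bar>) +
       \<bar>fl.v (tm i) - hpoly K (tm i) (fl.y (tm i))\<bar> + ?L * E i (\<lambda>G. \<bar>ciso G - fl.y (tm i)\<bar>)"
      by (simp only: E_add E_cmult E_const)
    also have "?L * E i (\<lambda>G. \<bar>ciso G - fl.y (tm i)\<bar>) \<le> ?L * (\<eta> + \<sigma> / \<eta>)"
    proof (rule mult_left_mono[OF _ L])
      have "sqdev i / \<eta> \<le> \<sigma> / \<eta>" using assms(3,4) i by (intro divide_right_mono) auto
      then show "E i (\<lambda>G. \<bar>ciso G - fl.y (tm i)\<bar>) \<le> \<eta> + \<sigma> / \<eta>" using E_abs_dev[OF assms(3), of i] by linarith
    qed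
    finally show ?thesis by simp
  qed
  then have "(\<Sum>i<m. E i (\<lambda>G. \<bar>unf G - fl.v (tm i)\<bar>)) \<le> (\<Sum>i<m. E i (\<lambda>G. \<bar>unf G - hpoly K (tm i) (ciso G)\<bar>) +
    \<bar>fl.v (tm i) - hpoly K (tm i) (fl.y (tm i))\<bar> + ?L * (\<eta> + \<sigma> / \<eta>))" by (intro sum_mono) auto
  also have "\<dots> = mass_err K m + real m * (?L * (\<eta> + \<sigma> / \<eta>))"
    unfolding mass_err_def by (simp only: sum.distrib sum_constant card_lessThan)
  finally show ?thesis .
qed

lemma E_unf_antimono: "i \<le> j \<Longrightarrow> E j unf \<le> E i unf"
proof (rule lift_Suc_antimono_le[of "\<lambda>i. E i unf"])
  fix i
  have "gen unf G = gen (\<lambda>G. real (nunf G)) G / real n" for G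
    by (simp add: gen_def sum_divide_distrib diff_divide_distrib[symmetric])
  then have "E (Suc i) unf \<le> E i (\<lambda>G. unf G + 0)" unfolding E_Suc
    using gen_nunf_le N_pos by (intro E_mono add_left_mono) (simp add: divide_nonpos_nonneg)
  then show "E (Suc i) unf \<le> E i unf" by simp
qed

text \<open>The unfrozen mass is controlled on average over time only, but its mean decreases, so
  the value at step \<open>n * T\<close> is at most the average over the \<open>n\<close> steps
  before. These begin at time \<open>2 * (T - 1)\<close>, hence the argument of
  \<open>v\<close>.\<close>

lemma E_unf_le_v:
  assumes "T \<ge> 1" "(\<Sum>i<n * T. E i (\<lambda>G. \<bar>unf G - fl.v (tm i)\<bar>)) \<le> \<epsilon> * real n"
  shows "E (n * T) unf \<le> fl.v (2 * (real T - 1)) + \<epsilon>"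
proof -
  have n0: "real n > 0" using n_ge_2 by simp
  let ?I = "{n * (T - 1)..<n * T}"
  have card: "card ?I = n" using assms(1) by (cases T) auto
  have "real n * E (n * T) unf = (\<Sum>i\<in>?I. E (n * T) unf)" by (simp only: sum_constant card)
  also have "\<dots> \<le> (\<Sum>i\<in>?I. fl.v (2 * (real T - 1)) + E i (\<lambda>G. \<bar>unf G - fl.v (tm i)\<bar>))"
  proof (rule sum_mono)
    fix i assume i: "i \<in> ?I"
    have "E (n * T) unf \<le> E i unf" using i by (intro E_unf_antimono) auto
    also have "\<dots> \<le> E i (\<lambda>G. fl.v (tm i) + \<bar>unf G - fl.v (tm i)\<bar>)" by (intro E_mono) auto
    also have "\<dots> = fl.v (tm i) + E i (\<lambda>G. \<bar>unf G - fl.v (tm i)\<bar>)" by (simp only: E_add E_const)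
    finally have le: "E (n * T) unf \<le> fl.v (tm i) + E i (\<lambda>G. \<bar>unf G - fl.v (tm i)\<bar>)" .
    have "fl.v (tm i) \<le> fl.v (2 * (real T - 1))"
    proof (rule fl.v_antimono)
      have "real (n * (T - 1)) \<le> real i" using i by (simp only: of_nat_le_iff) auto
      then have "(real T - 1) * real n \<le> real i" using assms(1) by (simp add: of_nat_diff mult.commute)
      then have "2 * ((real T - 1) * real n) \<le> 2 * real i" by simp
      then show "2 * (real T - 1) \<le> tm i" by (simp only: pos_le_divide_eq[OF n0] mult.assoc)
    qed
    then show "E (n * T) unf \<le> fl.v (2 * (real T - 1)) + E i (\<lambda>G. \<bar>unf G - fl.v (tm i)\<bar>)" using le by linarith
  qed
  also have "\<dots> = real n * fl.v (2 * (real T - 1)) + (\<Sum>i\<in>?I. E i (\<lambda>G. \<bar>unf G - fl.v (tm i)\<bar>))"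
    by (simp only: sum.distrib sum_constant card)
  also have "(\<Sum>i\<in>?I. E i (\<lambda>G. \<bar>unf G - fl.v (tm i)\<bar>)) \<le> (\<Sum>i<n * T. E i (\<lambda>G. \<bar>unf G - fl.v (tm i)\<bar>))"
    by (intro sum_mono2) (auto intro: E_nonneg)
  also note assms(2)
  finally have "real n * E (n * T) unf \<le> real n * (fl.v (2 * (real T - 1)) + \<epsilon>)" by (simp add: algebra_simps)
  then show ?thesis using n0 by simp
qed

end

context fluid
begin

section \<open>Choice of the truncation level and limit in \<open>n\<close>\<close>

lemma frozen_process: "n \<ge> 2 \<Longrightarrow> frozen_process p n"
  by unfold_locales (use p_pos p_le_1 in auto)

lemma eventually_mass_err:
  assumes "0 < \<epsilon>" "1 \<le> A"
  shows "\<exists>K. eventually (\<lambda>n. \<forall>m. real m \<le> A * real n \<longrightarrow> frozen_process.mass_err p n K m \<le> real m * \<epsilon>) sequentially"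
proof -
  \<comment> \<open>Three quarters go to \<open>\<delta>\<close> itself and to the two terms
    depending only on \<open>J\<close>; the rest absorbs what vanishes with \<open>n\<close>.
    \<open>J\<close> has to be fixed first because \<open>err_const\<close> is unbounded in
    it.\<close>
  define \<delta> where "\<delta> = \<epsilon> / 4"
  have \<delta>: "\<delta> > 0" using assms by (simp add: \<delta>_def)
  have "(\<lambda>J. 2 / real J / \<delta>) \<longlonglongrightarrow> 0" using \<delta> by real_asymp
  then have "eventually (\<lambda>J. 2 / real J / \<delta> < \<delta> \<and> tail (2 ^ J) < \<delta> \<and> 1 \<le> J) sequentially"
    using \<delta> tail_limit by (intro eventually_conj order_tendstoD(2) eventually_ge_at_top) auto
  then obtain J where J: "2 / real J / \<delta> < \<delta>" "tail (2 ^ J) < \<delta>" "1 \<le> J" by (auto simp: eventually_sequentially)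
  define C where "C = frozen_process.err_const (2 ^ J) A"
  have "(\<lambda>n. \<delta> + (2 / real J + 1 / real n) / \<delta> + C / sqrt (real n) + tail (2 ^ J)) \<longlonglongrightarrow> \<delta> + (2 / real J + 0) / \<delta> + 0 + tail (2 ^ J)"
  proof (intro tendsto_add tendsto_const)
    have "(\<lambda>n. 1 / real n) \<longlonglongrightarrow> 0" by real_asymp
    then show "(\<lambda>n. (2 / real J + 1 / real n) / \<delta>) \<longlonglongrightarrow> (2 / real J + 0) / \<delta>"
      using \<delta> by (intro tendsto_divide tendsto_add tendsto_const) auto
    show "(\<lambda>n. C / sqrt (real n)) \<longlonglongrightarrow> 0" by real_asymp
  qed
  moreover have "\<delta> + (2 / real J + 0) / \<delta> + 0 + tail (2 ^ J) < \<epsilon>" using J \<delta> unfolding \<delta>_def by simp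
  ultimately have "eventually (\<lambda>n. \<delta> + (2 / real J + 1 / real n) / \<delta> + C / sqrt (real n) + tail (2 ^ J) < \<epsilon>) sequentially"
    by (rule order_tendstoD(2))
  then have "eventually (\<lambda>n. \<forall>m. real m \<le> A * real n \<longrightarrow> frozen_process.mass_err p n (2 ^ J) m \<le> real m * \<epsilon>) sequentially"
    using eventually_ge_at_top[of 2]
  proof eventually_elim
    case (elim n)
    show ?case
    proof (intro allI impI)
      fix m assume m: "real m \<le> A * real n"
      have "frozen_process.mass_err p n (2 ^ J) m \<le> real m * (\<delta> + (2 / real J + 1 / real n) / \<delta> + C / sqrt (real n) + tail (2 ^ J))"
        unfolding C_def by (rule frozen_process.mass_err_bound[OF frozen_process[OF elim(2)] \<delta> J(3) assms(2) m])
      also have "\<dots> \<le> real m * \<epsilon>" using elim(1) by (intro mult_left_mono) auto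
      finally show "frozen_process.mass_err p n (2 ^ J) m \<le> real m * \<epsilon>" .
    qed
  qed
  then show ?thesis by blast
qed

lemma eventually_sqdev:
  assumes "0 < \<epsilon>" "1 \<le> A"
  shows "eventually (\<lambda>n. \<forall>m. real m \<le> A * real n \<longrightarrow> frozen_process.sqdev p n m \<le> \<epsilon>) sequentially"
proof -
  define \<delta> where "\<delta> = \<epsilon> / (8 * A)"
  have \<delta>: "\<delta> > 0" using assms by (simp add: \<delta>_def)
  obtain K where K: "eventually (\<lambda>n. \<forall>m. real m \<le> A * real n \<longrightarrow> frozen_process.mass_err p n K m \<le> real m * \<delta>) sequentially"
    using eventually_mass_err[OF \<delta> assms(2)] by blast
  have "(\<lambda>n. (16 * A + 4) / real n) \<longlonglongrightarrow> 0" by real_asymp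
  then have "eventually (\<lambda>n. (16 * A + 4) / real n < \<epsilon> / 2) sequentially" using assms by (intro order_tendstoD(2)) auto
  with K show ?thesis using eventually_ge_at_top[of 2]
  proof eventually_elim
    case (elim n)
    have n0: "real n > 0" using elim by simp
    show ?case
    proof (intro allI impI)
      fix m assume m: "real m \<le> A * real n"
      then have mn: "real m / real n \<le> A" using n0 by (simp add: pos_divide_le_eq)
      have "frozen_process.sqdev p n m \<le> 4 / real n * frozen_process.mass_err p n K m + 16 * real m / (real n)\<^sup>2 + 4 / real n"
        by (rule frozen_process.sqdev_mass_err[OF frozen_process[OF elim(3)]])
      also have "\<dots> \<le> 4 / real n * (real m * \<delta>) + 16 * real m / (real n)\<^sup>2 + 4 / real n"
        using elim(1) m n0 by (intro add_right_mono mult_left_mono) auto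
      also have "\<dots> = 4 * \<delta> * (real m / real n) + (16 * (real m / real n) + 4) / real n"
        using n0 by (simp add: field_simps power2_eq_square)
      also have "\<dots> \<le> 4 * \<delta> * A + (16 * A + 4) / real n"
        using mn \<delta> n0 by (intro add_mono mult_left_mono divide_right_mono) auto
      also have "4 * \<delta> * A = \<epsilon> / 2" using assms by (simp add: \<delta>_def)
      finally show "frozen_process.sqdev p n m \<le> \<epsilon>" using elim(2) by linarith
    qed
  qed
qed

lemma eventually_unf:
  assumes "0 < \<epsilon>" "T \<ge> 1"
  shows "eventually (\<lambda>n. frozen_process.E p n (n * T) (frozen_process.unf n) \<le> v (2 * (real T - 1)) + \<epsilon>) sequentially"
proof -
  define A where "A = real T"
  have A: "1 \<le> A" using assms by (simp add: A_def)
  define \<delta> where "\<delta> = \<epsilon> / (2 * A)"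
  have \<delta>: "\<delta> > 0" using assms A by (simp add: \<delta>_def)
  obtain K where K: "eventually (\<lambda>n. \<forall>m. real m \<le> A * real n \<longrightarrow> frozen_process.mass_err p n K m \<le> real m * \<delta>) sequentially"
    using eventually_mass_err[OF \<delta> A] by blast
  define L where "L = (\<Sum>k=1..K. tree_coeff k * (2 * A) ^ (k - 1) * real k)"
  have L: "L \<ge> 0" unfolding L_def using A by (intro sum_nonneg mult_nonneg_nonneg) (auto simp: tree_coeff_nonneg)
  \<comment> \<open>With squared deviations at most \<open>\<eta> ^ 2\<close>, the mean deviation is
    at most \<open>2 * \<eta>\<close>, and \<open>L\<close> times this stays below
    \<open>\<delta>\<close>.\<close>
  define \<eta> where "\<eta> = \<delta> / (2 * (L + 1))"
  have \<eta>: "\<eta> > 0" using \<delta> L by (simp add: \<eta>_def)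
  have "eventually (\<lambda>n. \<forall>m. real m \<le> A * real n \<longrightarrow> frozen_process.sqdev p n m \<le> \<eta>\<^sup>2) sequentially"
    using \<eta> A by (intro eventually_sqdev) auto
  with K show ?thesis using eventually_ge_at_top[of 2]
  proof eventually_elim
    case (elim n)
    interpret F: frozen_process p n by (rule frozen_process[OF elim(3)])
    have m: "real (n * T) \<le> A * real n" by (simp add: A_def)
    have "(\<Sum>i<n * T. F.E i (\<lambda>G. \<bar>F.unf G - v (F.tm i)\<bar>)) \<le> F.mass_err K (n * T) + real (n * T) * (L * (\<eta> + \<eta>\<^sup>2 / \<eta>))"
      unfolding L_def
    proof (rule F.sum_E_unf_v[OF A m \<eta>])
      fix i assume "i < n * T"
      then have "real i \<le> real (n * T)" by (simp only: of_nat_le_iff)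
      then have "real i \<le> A * real n" using m by linarith
      then show "F.sqdev i \<le> \<eta>\<^sup>2" using elim(2) by blast
    qed
    also have "\<dots> \<le> real (n * T) * \<delta> + real (n * T) * \<delta>"
    proof (intro add_mono mult_left_mono)
      show "F.mass_err K (n * T) \<le> real (n * T) * \<delta>" using elim(1) m by blast
      have "\<eta>\<^sup>2 / \<eta> = \<eta>" using \<eta> by (simp add: power2_eq_square)
      moreover have "\<eta> + \<eta> = \<delta> / (L + 1)"
      proof -
        have "\<eta> = \<delta> / (L + 1) / 2" by (simp add: \<eta>_def mult.commute)
        then show ?thesis by (simp only: field_sum_of_halves)
      qed
      ultimately have "L * (\<eta> + \<eta>\<^sup>2 / \<eta>) = \<delta> * (L / (L + 1))" by simp
      also have "\<dots> \<le> \<delta> * 1" using L \<delta> by (intro mult_left_mono) auto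
      finally show "L * (\<eta> + \<eta>\<^sup>2 / \<eta>) \<le> \<delta>" by simp
    qed auto
    also have "\<dots> = \<epsilon> * real n" using A by (simp add: \<delta>_def A_def field_simps)
    finally show ?case by (rule F.E_unf_le_v[OF assms(2)])
  qed
qed

end

section \<open>Isolated vertices at late times\<close>

context frozen_process
begin

text \<open>One-step survival factor of a set of \<open>l\<close> isolated vertices when nearly
  everything is frozen; \<open>s\<close> collects corrections of order one.\<close>

definition decay :: "nat \<Rightarrow> real \<Rightarrow> real" where
  "decay l s = 1 - (real l * p * real n - s) / N"

lemma hit_weight_decay: "1 - hit_weight l u / N = decay l (real l * (real l + 1) / 2) - real l * (1 - p) * real u / N"
  using N_pos by (simp add: hit_weight_def decay_def field_simps)

text \<open>\<open>f G + gen f G / N\<close> is the mean of \<open>f\<close> after one step from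
  \<open>G\<close>, an average with nonnegative weights.\<close>

lemma step_mono:
  assumes "\<And>H. f H \<le> g H" shows "f G + gen f G / N \<le> g G + gen g G / N"
proof -
  have eq: "h G + gen h G / N = (\<Sum>e\<in>edges. (1 - accept G e) * h G + accept G e * h (add_mset e G)) / N" for h
  proof -
    have "(\<Sum>e\<in>edges. (1 - accept G e) * h G + accept G e * h (add_mset e G)) = (\<Sum>e\<in>edges. h G + accept G e * (h (add_mset e G) - h G))"
      by (rule sum.cong) (simp_all add: algebra_simps)
    also have "\<dots> = N * h G + gen h G" by (simp add: sum.distrib gen_def N_def)
    finally show ?thesis using N_pos by (simp add: add_divide_distrib)
  qed
  have "(\<Sum>e\<in>edges. (1 - accept G e) * f G + accept G e * f (add_mset e G)) \<le> (\<Sum>e\<in>edges. (1 - accept G e) * g G + accept G e * g (add_mset e G))"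
    using assms accept_nonneg accept_le_1 by (intro sum_mono add_mono mult_left_mono) auto
  then show ?thesis unfolding eq using N_pos by (intro divide_right_mono) auto
qed

text \<open>Ignoring the extra losses of size \<open>real l * (1 - p) * real u / N\<close> gives a
  supersolution.\<close>

lemma E_chooseiso_upper:
  assumes "0 \<le> decay l (real l * (real l + 1) / 2)"
  shows "E (m + j) (chooseiso l) \<le> decay l (real l * (real l + 1) / 2) ^ j * E m (chooseiso l)"
proof (induction j)
  case (Suc j)
  let ?a = "decay l (real l * (real l + 1) / 2)"
  have "E (Suc (m + j)) (chooseiso l) \<le> E (m + j) (\<lambda>G. ?a * chooseiso l G)"
    unfolding E_chooseiso_Suc
  proof (rule E_mono)
    fix G
    have "0 \<le> real l * (1 - p) * real (nunf G) / N" using p_le_1 N_pos by simp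
    then have "chooseiso l G * (1 - hit_weight l (nunf G) / N) \<le> chooseiso l G * ?a"
      unfolding hit_weight_decay by (intro mult_left_mono) auto
    then show "chooseiso l G * (1 - hit_weight l (nunf G) / N) \<le> ?a * chooseiso l G" by (simp add: mult.commute)
  qed
  also have "\<dots> = ?a * E (m + j) (chooseiso l)" by (rule E_cmult)
  also have "\<dots> \<le> ?a * (?a ^ j * E m (chooseiso l))" using Suc assms by (intro mult_left_mono) auto
  finally show ?case by (simp add: mult.assoc)
qed simp

text \<open>A subsolution: while at most about \<open>n / c\<close> vertices are unfrozen, their number decays at a rate
  that dominates the additional loss of isolated vertices caused by edges to unfrozen vertices.\<close>

definition sub :: "nat \<Rightarrow> multigraph \<Rightarrow> real" where
  "sub l G = chooseiso l G * max 0 (1 - 4 * real l / p * (real (nunf G) - real l) / real n)"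

text \<open>The linear expression whose drift can be computed; \<open>sub\<close> is its positive
  part.\<close>

definition sub_lin :: "nat \<Rightarrow> multigraph \<Rightarrow> real" where
  "sub_lin l G = chooseiso l G - 4 * real l / (p * real n) * (chooseiso l G * (real (nunf G) - real l))"

lemma sub_lin_eq: "sub_lin l G = chooseiso l G * (1 - 4 * real l / p * (real (nunf G) - real l) / real n)"
proof -
  have "z - c * (z * d) = z * (1 - c * d)" for z c d :: real by (simp add: algebra_simps)
  moreover have "4 * real l / p * x / real n = 4 * real l / (p * real n) * x" for x by simp
  ultimately show ?thesis unfolding sub_lin_def by presburger
qed

lemma sub_nonneg: "0 \<le> sub l G" and sub_lin_le: "sub_lin l G \<le> sub l G"
  unfolding sub_def sub_lin_eq by (auto intro: mult_left_mono)

text \<open>With \<open>D\<close> unfrozen vertices besides the chosen \<open>l\<close> and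
  \<open>F\<close> frozen ones, the extra loss of isolated vertices is at most
  \<open>real l * (1 - p) * D / N\<close> in relative terms. The subtracted term decays faster by
  \<open>p * F / N\<close>, a gain of \<open>C * p * F * D / N\<close>, and \<open>C\<close> is such
  that \<open>C * p * F \<ge> l\<close>. Where \<open>sub\<close> vanishes, nonnegativity is
  enough.\<close>

lemma sub_step:
  assumes v: "valid n G" and l: "l \<ge> 1" and n: "n \<ge> 4 * l" and d: "0 \<le> decay l (real l * (real l + 1) / 2 - (real l)\<^sup>2 * (1 - p))"
  shows "decay l (real l * (real l + 1) / 2 - (real l)\<^sup>2 * (1 - p)) * sub l G \<le> sub l G + gen (sub l) G / N"
proof -
  let ?a = "decay l (real l * (real l + 1) / 2 - (real l)\<^sup>2 * (1 - p))"
  define D where "D = real (nunf G) - real l"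
  define F where "F = real n - real (nunf G)"
  define C where "C = 4 * real l / (p * real n)"
  define Y where "Y = chooseiso l G"
  have n0: "real n > 0" using n_ge_2 by simp
  have C: "C > 0" using l n0 p_pos by (simp add: C_def)
  have Ceq: "4 * real l / p * x / real n = C * x" for x by (simp add: C_def)
  have Y0: "Y \<ge> 0" by (simp add: Y_def)
  have s: "sub l G = Y * max 0 (1 - C * D)" unfolding sub_def Ceq Y_def D_def ..
  consider "1 \<le> C * D" | "Y = 0" | "C * D < 1" "Y \<noteq> 0" by linarith
  then show ?thesis
  proof cases
    case 3
    have "l \<le> niso G" using 3(2) by (auto simp: Y_def intro: ccontr)
    then have "l \<le> nunf G" using niso_le_nunf[OF v] by simp
    then have D0: "D \<ge> 0" by (simp add: D_def)
    \<comment> \<open>Positivity of \<open>1 - C * D\<close> gives \<open>D < n / 4\<close>, and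
      \<open>n \<ge> 4 * l\<close> bounds the remaining \<open>l\<close> vertices, so at least half
      of all vertices are frozen.\<close>
    have F: "F \<ge> real n / 2"
    proof -
      have "4 * real l * D < p * real n" using 3(1) p_pos n0 by (simp add: C_def pos_divide_less_eq)
      also have "\<dots> \<le> 1 * real n" using p_le_1 by (intro mult_right_mono) auto
      finally have "4 * real l * D < real n" by simp
      moreover have "4 * 1 * D \<le> 4 * real l * D" using l D0 by (intro mult_right_mono) auto
      moreover have "4 * real l \<le> real n" using n by linarith
      moreover have "real (nunf G) = D + real l" by (simp add: D_def)
      ultimately show ?thesis unfolding F_def by linarith
    qed
    have b: "1 - hit_weight l (nunf G) / N = ?a - real l * (1 - p) * D / N"
      unfolding hit_weight_decay decay_def D_def using N_pos by (simp add: field_simps power2_eq_square)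
    have g1: "Y + gen (chooseiso l) G / N = Y * (1 - hit_weight l (nunf G) / N)"
      by (simp add: gen_choose_isolated[OF v] Y_def algebra_simps)
    have g2: "Y * D + gen (\<lambda>G. chooseiso l G * (real (nunf G) - real l)) G / N \<le> Y * D * (1 - hit_weight l (nunf G) / N - p * F / N)"
    proof -
      have "gen (\<lambda>G. chooseiso l G * (real (nunf G) - real l)) G / N \<le> (- (hit_weight l (nunf G) + p * F) * (Y * D)) / N"
        using gen_choose_isolated_unfrozen[OF v, of l] N_pos unfolding Y_def D_def F_def by (intro divide_right_mono) auto
      also have "\<dots> = Y * D * (1 - hit_weight l (nunf G) / N - p * F / N) - Y * D"
      proof -
        have "(- (h + f) * z) / N = z * (1 - h / N - f / N) - z" for h f z using N_pos by (simp add: field_simps)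
        then show ?thesis .
      qed
      finally show ?thesis by linarith
    qed
    have glin: "gen (sub_lin l) G = gen (chooseiso l) G - C * gen (\<lambda>G. chooseiso l G * (real (nunf G) - real l)) G"
      unfolding gen_def sub_lin_def C_def[symmetric] sum_distrib_left sum_subtractf[symmetric] by (rule sum.cong) (simp_all add: algebra_simps)
    have "?a * sub l G = ?a * (Y * (1 - C * D))" using 3(1) by (simp add: s)
    also have "\<dots> \<le> Y * (?a - real l * (1 - p) * D / N) - C * (Y * D * (?a - real l * (1 - p) * D / N - p * F / N))"
    proof -
      have "real l \<le> C * (p * F)"
      proof -
        have "C * (p * (real n / 2)) \<le> C * (p * F)" using F C p_pos by (intro mult_left_mono) auto
        moreover have "C * (p * (real n / 2)) = 2 * real l" using p_pos n0 by (simp add: C_def)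
        ultimately show ?thesis by linarith
      qed
      moreover have "0 \<le> C * (real l * (1 - p) * D)" using C p_le_1 D0 by simp
      moreover have "real l * (1 - p) \<le> real l * 1" using p_pos by (intro mult_left_mono) auto
      ultimately have "0 \<le> - (real l * (1 - p)) + C * (real l * (1 - p) * D) + C * (p * F)" by linarith
      then have "0 \<le> (Y * D / N) * (- (real l * (1 - p)) + C * (real l * (1 - p) * D) + C * (p * F))"
        using Y0 D0 N_pos by (intro mult_nonneg_nonneg) auto
      also have "\<dots> = (Y * (?a - real l * (1 - p) * D / N) - C * (Y * D * (?a - real l * (1 - p) * D / N - p * F / N))) - ?a * (Y * (1 - C * D))"
        by (simp add: algebra_simps add_divide_distrib diff_divide_distrib)
      finally show ?thesis by linarith
    qed
    also have "\<dots> \<le> (Y + gen (chooseiso l) G / N) - C * (Y * D + gen (\<lambda>G. chooseiso l G * (real (nunf G) - real l)) G / N)"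
      using mult_left_mono[OF g2, of C] C unfolding g1 b by simp
    also have "\<dots> = sub_lin l G + gen (sub_lin l) G / N"
      unfolding glin sub_lin_def C_def[symmetric] Y_def D_def by (simp add: algebra_simps diff_divide_distrib)
    also have "\<dots> \<le> sub l G + gen (sub l) G / N" by (rule step_mono) (rule sub_lin_le)
    finally show ?thesis .
  next
    case 1
    then have "sub l G = 0" by (simp add: s)
    moreover have "0 \<le> sub l G + gen (sub l) G / N"
      using step_mono[of "\<lambda>_. 0" "sub l" G] sub_nonneg by (simp add: gen_def)
    ultimately show ?thesis by simp
  next
    case 2
    then have "sub l G = 0" by (simp add: s)
    moreover have "0 \<le> sub l G + gen (sub l) G / N"
      using step_mono[of "\<lambda>_. 0" "sub l" G] sub_nonneg by (simp add: gen_def)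
    ultimately show ?thesis by simp
  qed
qed

text \<open>The subsolution is iterated and compared with \<open>chooseiso\<close> at both ends. The
  price at the initial time is the mixed moment with \<open>unf\<close>, small if few vertices are
  unfrozen by then.\<close>

lemma E_chooseiso_lower:
  assumes l: "l \<ge> 1" and n: "n \<ge> 4 * l" and d: "0 \<le> decay l (real l * (real l + 1) / 2 - (real l)\<^sup>2 * (1 - p))"
  shows "decay l (real l * (real l + 1) / 2 - (real l)\<^sup>2 * (1 - p)) ^ j * (E m (chooseiso l) - 4 * real l / p * E m (\<lambda>G. chooseiso l G * unf G))
     \<le> E (m + j) (chooseiso l)"
proof -
  let ?a = "decay l (real l * (real l + 1) / 2 - (real l)\<^sup>2 * (1 - p))"
  have "?a ^ j * E m (sub l) \<le> E (m + j) (sub l)"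
  proof (induction j)
    case (Suc j)
    have "?a ^ Suc j * E m (sub l) = ?a * (?a ^ j * E m (sub l))" by (simp add: mult.assoc)
    also have "\<dots> \<le> ?a * E (m + j) (sub l)" using Suc d by (rule mult_left_mono)
    also have "\<dots> = E (m + j) (\<lambda>G. ?a * sub l G)" by (rule E_cmult[symmetric])
    also have "\<dots> \<le> E (Suc (m + j)) (sub l)" unfolding E_Suc using l n d by (intro E_mono sub_step)
    finally show ?case by simp
  qed simp
  also have "E (m + j) (sub l) \<le> E (m + j) (chooseiso l)"
  proof (rule E_mono)
    fix G assume v: "valid n G"
    show "sub l G \<le> chooseiso l G"
    proof (cases "l \<le> niso G")
      case True
      then have "real l \<le> real (nunf G)" using niso_le_nunf[OF v] by simp
      then have "0 \<le> 4 * real l / p * (real (nunf G) - real l) / real n" using p_pos by simp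
      then have "max 0 (1 - 4 * real l / p * (real (nunf G) - real l) / real n) \<le> 1" by simp
      then show ?thesis unfolding sub_def using mult_left_mono[of _ 1 "chooseiso l G"] by fastforce
    qed (simp add: sub_def binomial_eq_0)
  qed
  finally have 1: "?a ^ j * E m (sub l) \<le> E (m + j) (chooseiso l)" .
  have "E m (chooseiso l) - 4 * real l / p * E m (\<lambda>G. chooseiso l G * unf G) = E m (\<lambda>G. chooseiso l G - 4 * real l / p * (chooseiso l G * unf G))"
    by (simp only: E_diff E_cmult)
  also have "\<dots> \<le> E m (sub l)"
  proof (rule E_mono)
    fix G
    have "chooseiso l G - 4 * real l / p * (chooseiso l G * unf G) \<le> sub_lin l G"
    proof -
      have "4 * real l / (p * real n) * (chooseiso l G * (real (nunf G) - real l)) \<le> 4 * real l / (p * real n) * (chooseiso l G * real (nunf G))"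
        using p_pos by (intro mult_left_mono) auto
      then show ?thesis unfolding sub_lin_def by simp
    qed
    then show "chooseiso l G - 4 * real l / p * (chooseiso l G * unf G) \<le> sub l G" using sub_lin_le order_trans by blast
  qed
  finally have "?a ^ j * (E m (chooseiso l) - 4 * real l / p * E m (\<lambda>G. chooseiso l G * unf G)) \<le> ?a ^ j * E m (sub l)"
    using d by (intro mult_left_mono) auto
  with 1 show ?thesis by linarith
qed

abbreviation isomom :: "nat \<Rightarrow> multigraph \<Rightarrow> real" where
  "isomom l G \<equiv> chooseiso l G * fact l / real n ^ l"

text \<open>Powers are Lipschitz on \<open>[0, 1]\<close>, and falling factorials differ from powers
  by relative order \<open>1 / n\<close>.\<close>

lemma isomom_approx:
  shows "\<bar>E m (isomom l) - fl.y (tm m) ^ l\<bar> \<le> (real l)\<^sup>2 / real n + real l * E m (\<lambda>G. \<bar>ciso G - fl.y (tm m)\<bar>)"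
    and "E m (\<lambda>G. isomom l G * unf G) \<le> fl.y (tm m) ^ l * E m unf + real l * E m (\<lambda>G. \<bar>ciso G - fl.y (tm m)\<bar>)"
proof -
  let ?y = "fl.y (tm m)"
  have y: "0 \<le> ?y" "?y \<le> 1" using fl.y_pos[of "tm m"] fl.y_le_1[of "tm m"] by auto
  have pw: "\<bar>ciso G ^ l - ?y ^ l\<bar> \<le> real l * \<bar>ciso G - ?y\<bar>" for G
    using norm_power_diff[of "ciso G" ?y l] ciso_range[of G] y by simp
  have n1: "n \<ge> 1" using n_ge_2 by simp
  have fr: "isomom l G \<le> ciso G ^ l" "ciso G ^ l - isomom l G \<le> (real l)\<^sup>2 / real n" for G
    using falling_ratio(2,3)[of "niso G" 1 n l] niso_le[of G] n1 by auto
  have "\<bar>E m (isomom l) - ?y ^ l\<bar> = \<bar>E m (\<lambda>G. isomom l G - ?y ^ l)\<bar>" by (simp only: E_diff E_const)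
  also have "\<dots> \<le> E m (\<lambda>G. (real l)\<^sup>2 / real n + real l * \<bar>ciso G - ?y\<bar>)"
  proof (rule abs_leI)
    show "E m (\<lambda>G. isomom l G - ?y ^ l) \<le> E m (\<lambda>G. (real l)\<^sup>2 / real n + real l * \<bar>ciso G - ?y\<bar>)"
    proof (rule E_mono)
      fix G
      have "0 \<le> (real l)\<^sup>2 / real n" by simp
      then show "isomom l G - ?y ^ l \<le> (real l)\<^sup>2 / real n + real l * \<bar>ciso G - ?y\<bar>" using fr[of G] pw[of G] by linarith
    qed
    have "- E m (\<lambda>G. isomom l G - ?y ^ l) = E m (\<lambda>G. - (isomom l G - ?y ^ l))" by (rule E_uminus[symmetric])
    also have "\<dots> \<le> E m (\<lambda>G. (real l)\<^sup>2 / real n + real l * \<bar>ciso G - ?y\<bar>)"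
    proof (rule E_mono)
      fix G show "- (isomom l G - ?y ^ l) \<le> (real l)\<^sup>2 / real n + real l * \<bar>ciso G - ?y\<bar>" using fr[of G] pw[of G] by linarith
    qed
    finally show "- E m (\<lambda>G. isomom l G - ?y ^ l) \<le> E m (\<lambda>G. (real l)\<^sup>2 / real n + real l * \<bar>ciso G - ?y\<bar>)" .
  qed
  also have "\<dots> = (real l)\<^sup>2 / real n + real l * E m (\<lambda>G. \<bar>ciso G - ?y\<bar>)" by (simp only: E_add E_cmult E_const)
  finally show "\<bar>E m (isomom l) - ?y ^ l\<bar> \<le> (real l)\<^sup>2 / real n + real l * E m (\<lambda>G. \<bar>ciso G - ?y\<bar>)" .
  have "E m (\<lambda>G. isomom l G * unf G) \<le> E m (\<lambda>G. ?y ^ l * unf G + real l * \<bar>ciso G - ?y\<bar>)"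
  proof (rule E_mono)
    fix G
    have "isomom l G * unf G \<le> (?y ^ l + real l * \<bar>ciso G - ?y\<bar>) * unf G"
      using fr(1)[of G] pw[of G] unf_range[of G] by (intro mult_right_mono) linarith+
    also have "\<dots> = ?y ^ l * unf G + real l * \<bar>ciso G - ?y\<bar> * unf G" by (rule distrib_right)
    also have "real l * \<bar>ciso G - ?y\<bar> * unf G \<le> real l * \<bar>ciso G - ?y\<bar> * 1"
      using unf_range[of G] by (intro mult_left_mono) auto
    finally show "isomom l G * unf G \<le> ?y ^ l * unf G + real l * \<bar>ciso G - ?y\<bar>" by simp
  qed
  then show "E m (\<lambda>G. isomom l G * unf G) \<le> ?y ^ l * E m unf + real l * E m (\<lambda>G. \<bar>ciso G - ?y\<bar>)"
    by (simp only: E_add E_cmult)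
qed

end

text \<open>The loss \<open>x\<close> per step is \<open>2 * a / n\<close> up to order
  \<open>1 / n ^ 2\<close>. For \<open>j = o(n ^ 2)\<close> both
  \<open>j * x - 2 * a * j / n\<close> and \<open>j * x ^ 2\<close> vanish. The limit does not see
  \<open>s\<close>, so the upper and lower estimates with their different \<open>s\<close>
  meet.\<close>

lemma decay_limit:
  fixes a s :: real and j :: "nat \<Rightarrow> nat"
  assumes j: "(\<lambda>n. real (j n) / (real n)\<^sup>2) \<longlonglongrightarrow> 0" and a: "a > 0"
  defines "d \<equiv> \<lambda>n. 1 - (a * real n - s) / (real n * (real n - 1) / 2)"
  shows "(\<lambda>n. d n ^ j n * exp (2 * a * real (j n) / real n)) \<longlonglongrightarrow> 1"
    and "eventually (\<lambda>n. 0 \<le> d n) sequentially"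
proof -
  define x where "x n = (a * real n - s) / (real n * (real n - 1) / 2)" for n :: nat
  have dx: "d n = 1 - x n" for n by (simp add: d_def x_def)
  have "x \<longlonglongrightarrow> 0" unfolding x_def by real_asymp
  then have xs: "eventually (\<lambda>n. x n < 1 / 2) sequentially" by (rule order_tendstoD(2)) simp
  have "filterlim (\<lambda>n. a * real n - s) at_top sequentially" using a by real_asymp
  then have "eventually (\<lambda>n. 0 \<le> a * real n - s) sequentially" unfolding filterlim_at_top by blast
  then have xp: "eventually (\<lambda>n. 0 \<le> x n) sequentially"
    using eventually_ge_at_top[of 2] by eventually_elim (auto simp: x_def)
  show "eventually (\<lambda>n. 0 \<le> d n) sequentially"
    using xs by eventually_elim (simp add: dx)
  have l1: "(\<lambda>n. 2 * a * real (j n) / real n - real (j n) * x n) \<longlonglongrightarrow> 0"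
  proof -
    have "(\<lambda>n. (2 * s - 2 * a) * real n / (real n - 1)) \<longlonglongrightarrow> 2 * s - 2 * a" by real_asymp
    from tendsto_mult[OF j this]
    have "(\<lambda>n. real (j n) / (real n)\<^sup>2 * ((2 * s - 2 * a) * real n / (real n - 1))) \<longlonglongrightarrow> 0" by simp
    moreover have "eventually (\<lambda>n. real (j n) / (real n)\<^sup>2 * ((2 * s - 2 * a) * real n / (real n - 1)) = 2 * a * real (j n) / real n - real (j n) * x n) sequentially"
      using eventually_ge_at_top[of 2]
    proof eventually_elim
      case (elim n)
      then have "real n - 1 > 0" "real n > 0" by auto
      then show ?case unfolding x_def by (simp add: divide_simps power2_eq_square) (simp add: algebra_simps)
    qed
    ultimately show ?thesis by (rule Lim_transform_eventually)
  qed
  have l2: "(\<lambda>n. 2 * real (j n) * (x n)\<^sup>2) \<longlonglongrightarrow> 0"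
  proof -
    have "(\<lambda>n. (real n * x n)\<^sup>2) \<longlonglongrightarrow> (2 * a)\<^sup>2"
    proof (rule tendsto_power)
      show "(\<lambda>n. real n * x n) \<longlonglongrightarrow> 2 * a" unfolding x_def by real_asymp
    qed
    from tendsto_mult[OF tendsto_mult[OF tendsto_const[of 2] j] this]
    have "(\<lambda>n. 2 * (real (j n) / (real n)\<^sup>2) * (real n * x n)\<^sup>2) \<longlonglongrightarrow> 0" by simp
    moreover have "eventually (\<lambda>n. 2 * (real (j n) / (real n)\<^sup>2) * (real n * x n)\<^sup>2 = 2 * real (j n) * (x n)\<^sup>2) sequentially"
      using eventually_ge_at_top[of 2] by eventually_elim (simp add: power_mult_distrib)
    ultimately show ?thesis by (rule Lim_transform_eventually)
  qed
  show "(\<lambda>n. d n ^ j n * exp (2 * a * real (j n) / real n)) \<longlonglongrightarrow> 1"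
  proof (rule tendsto_sandwich)
    show "(\<lambda>n. exp ((2 * a * real (j n) / real n - real (j n) * x n) - 2 * real (j n) * (x n)\<^sup>2)) \<longlonglongrightarrow> 1"
      using tendsto_exp[OF tendsto_diff[OF l1 l2]] by simp
    show "(\<lambda>n. exp (2 * a * real (j n) / real n - real (j n) * x n)) \<longlonglongrightarrow> 1"
      using tendsto_exp[OF l1] by simp
    have eq: "d n ^ j n * exp (2 * a * real (j n) / real n) = exp (real (j n) * ln (1 - x n) + 2 * a * real (j n) / real n)" if "x n < 1 / 2" for n
      using that by (simp add: dx exp_add exp_of_nat_mult)
    show "eventually (\<lambda>n. exp ((2 * a * real (j n) / real n - real (j n) * x n) - 2 * real (j n) * (x n)\<^sup>2) \<le> d n ^ j n * exp (2 * a * real (j n) / real n)) sequentially"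
      using xs xp
    proof eventually_elim
      case (elim n)
      have "- x n - 2 * (x n)\<^sup>2 \<le> ln (1 - x n)" using elim by (intro ln_one_minus_pos_lower_bound) auto
      then have "real (j n) * (- x n - 2 * (x n)\<^sup>2) \<le> real (j n) * ln (1 - x n)" by (intro mult_left_mono) auto
      then show ?case unfolding eq[OF elim(1)] by (simp add: algebra_simps)
    qed
    show "eventually (\<lambda>n. d n ^ j n * exp (2 * a * real (j n) / real n) \<le> exp (2 * a * real (j n) / real n - real (j n) * x n)) sequentially"
      using xs xp
    proof eventually_elim
      case (elim n)
      have "ln (1 - x n) \<le> (1 - x n) - 1" using elim by (intro ln_le_minus_one) auto
      then have "real (j n) * ln (1 - x n) \<le> real (j n) * (- x n)" by (intro mult_left_mono) auto
      then show ?case unfolding eq[OF elim(1)] by simp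
    qed
  qed
qed

context fluid
begin

lemma eventually_isomom:
  assumes "0 < \<epsilon>" "T \<ge> 1"
  shows "eventually (\<lambda>n. \<bar>frozen_process.E p n (n * T) (frozen_process.isomom n l) - y (2 * real T) ^ l\<bar> \<le> \<epsilon> \<and>
     frozen_process.E p n (n * T) (\<lambda>G. frozen_process.isomom n l G * frozen_process.unf n G)
       \<le> y (2 * real T) ^ l * (v (2 * (real T - 1)) + \<epsilon>) + \<epsilon>) sequentially"
proof -
  define \<eta> where "\<eta> = \<epsilon> / (4 * (real l + 1))"
  have \<eta>: "\<eta> > 0" using assms by (simp add: \<eta>_def)
  have l\<eta>: "real l * (\<eta> + \<eta>) \<le> \<epsilon> / 2"
  proof -
    have "\<eta> * (4 * (real l + 1)) = \<epsilon>" by (simp add: \<eta>_def)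
    then have "(real l + 1) * (\<eta> + \<eta>) = \<epsilon> / 2" by (simp add: algebra_simps)
    moreover have "real l * (\<eta> + \<eta>) \<le> (real l + 1) * (\<eta> + \<eta>)" using \<eta> by (intro mult_right_mono) auto
    ultimately show ?thesis by simp
  qed
  have "(\<lambda>n. (real l)\<^sup>2 / real n) \<longlonglongrightarrow> 0" by real_asymp
  then have "eventually (\<lambda>n. (real l)\<^sup>2 / real n < \<epsilon> / 2) sequentially" using assms by (intro order_tendstoD(2)) auto
  moreover have "eventually (\<lambda>n. \<forall>m. real m \<le> real T * real n \<longrightarrow> frozen_process.sqdev p n m \<le> \<eta>\<^sup>2) sequentially"
    using \<eta> assms by (intro eventually_sqdev) auto
  moreover have "eventually (\<lambda>n. frozen_process.E p n (n * T) (frozen_process.unf n) \<le> v (2 * (real T - 1)) + \<epsilon>) sequentially"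
    by (rule eventually_unf[OF assms])
  ultimately show ?thesis using eventually_ge_at_top[of 2]
  proof eventually_elim
    case (elim n)
    interpret F: frozen_process p n by (rule frozen_process[OF elim(4)])
    have tm: "F.tm (n * T) = 2 * real T" using elim(4) by simp
    have "real (n * T) \<le> real T * real n" by simp
    then have "F.sqdev (n * T) \<le> \<eta>\<^sup>2" using elim(2) by blast
    then have "F.sqdev (n * T) / \<eta> \<le> \<eta>\<^sup>2 / \<eta>" using \<eta> by (intro divide_right_mono) auto
    then have "F.sqdev (n * T) / \<eta> \<le> \<eta>" using \<eta> by (simp only: power2_eq_square nonzero_mult_div_cancel_right)
    then have "F.E (n * T) (\<lambda>G. \<bar>F.ciso G - y (F.tm (n * T))\<bar>) \<le> \<eta> + \<eta>" using F.E_abs_dev[OF \<eta>, of "n * T"] by linarith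
    then have "real l * F.E (n * T) (\<lambda>G. \<bar>F.ciso G - y (F.tm (n * T))\<bar>) \<le> real l * (\<eta> + \<eta>)" by (intro mult_left_mono) auto
    then have dev: "real l * F.E (n * T) (\<lambda>G. \<bar>F.ciso G - y (F.tm (n * T))\<bar>) \<le> \<epsilon> / 2" using l\<eta> by linarith
    have "\<bar>F.E (n * T) (F.isomom l) - y (F.tm (n * T)) ^ l\<bar> \<le> \<epsilon>"
      using F.isomom_approx(1)[of "n * T" l] dev elim(1) by linarith
    moreover have "F.E (n * T) (\<lambda>G. F.isomom l G * F.unf G) \<le> y (F.tm (n * T)) ^ l * (v (2 * (real T - 1)) + \<epsilon>) + \<epsilon>"
    proof -
      have "y (F.tm (n * T)) ^ l * F.E (n * T) F.unf \<le> y (F.tm (n * T)) ^ l * (v (2 * (real T - 1)) + \<epsilon>)"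
        using elim(3) y_pos[of "F.tm (n * T)"] by (intro mult_left_mono) auto
      then show ?thesis using F.isomom_approx(2)[of "n * T" l] dev assms(1) by linarith
    qed
    ultimately show ?case unfolding tm by blast
  qed
qed

text \<open>The normalised moment is nearly constant from a large multiple of \<open>n\<close> steps
  on, so its limit is approximated by the value there, where the fluid limit applies and
  \<open>y_limit\<close> identifies the constant.\<close>

lemma isomom_limit:
  fixes m :: "nat \<Rightarrow> nat"
  assumes m1: "filterlim (\<lambda>n. real (m n) / real n) at_top sequentially" and m2: "(\<lambda>n. real (m n) / (real n)\<^sup>2) \<longlonglongrightarrow> 0"
    and l: "l \<ge> 1"
  shows "(\<lambda>n. frozen_process.E p n (m n) (frozen_process.isomom n l) * exp (2 * (real l * p) * real (m n) / real n)) \<longlonglongrightarrow> exp (- (real l * \<kappa>))"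
proof -
  define R where "R n = frozen_process.E p n (m n) (frozen_process.isomom n l) * exp (2 * (real l * p) * real (m n) / real n)" for n
  define a where "a = real l * p"
  have a: "a > 0" using l p_pos by (simp add: a_def)
  define C where "C = 4 * real l / p"
  have C: "C \<ge> 0" using p_pos by (simp add: C_def)
  define s1 s2 where "s1 = real l * (real l + 1) / 2" "s2 = s1 - (real l)\<^sup>2 * (1 - p)"
  \<comment> \<open>Fluid value after \<open>n * (M + 1)\<close> steps; the shift by one ensures
    \<open>T \<ge> 1\<close> and turns the argument \<open>2 * (T - 1)\<close> of \<open>v\<close>
    into \<open>2 * M\<close>.\<close>
  define b where "b M = (y (2 * (real M + 1)) * exp (p * (2 * (real M + 1)))) ^ l" for M :: nat
  define \<epsilon>' where "\<epsilon>' M = 1 / (real M + 1)" for M :: nat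
  define Err where "Err M = b M * \<epsilon>' M + 2 * \<epsilon>' M + C * (b M * (v (2 * real M) + \<epsilon>' M) + \<epsilon>' M)" for M
  have \<epsilon>0: "0 < \<epsilon>' M" "\<epsilon>' M \<le> 1" for M by (simp_all add: \<epsilon>'_def)
  have b0: "0 \<le> b M" for M using y_pos by (simp add: b_def less_imp_le)
  have at: "filterlim (\<lambda>M::nat. 2 * (real M + 1)) at_top sequentially" "filterlim (\<lambda>M::nat. 2 * real M) at_top sequentially"
    by real_asymp+
  have "b \<longlonglongrightarrow> exp (- \<kappa>) ^ l" unfolding b_def by (intro tendsto_power filterlim_compose[OF y_limit at(1)])
  moreover have "exp (- \<kappa>) ^ l = exp (- (real l * \<kappa>))" by (simp add: exp_of_nat_mult[symmetric])
  ultimately have blim: "b \<longlonglongrightarrow> exp (- (real l * \<kappa>))" by simp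
  have \<epsilon>lim: "\<epsilon>' \<longlonglongrightarrow> 0" unfolding \<epsilon>'_def by real_asymp
  have "Err \<longlonglongrightarrow> exp (- (real l * \<kappa>)) * 0 + 2 * 0 + C * (exp (- (real l * \<kappa>)) * (0 + 0) + 0)"
    unfolding Err_def by (intro tendsto_intros blim \<epsilon>lim filterlim_compose[OF v_limit at(2)])
  then have Errlim: "Err \<longlonglongrightarrow> 0" by simp
  have ev: "eventually (\<lambda>n. \<bar>R n - b M\<bar> \<le> Err M) sequentially" for M
  proof -
    define T where "T = M + 1"
    have T: "T \<ge> 1" "real T = real M + 1" by (simp_all add: T_def)
    define g where "g = exp (2 * a * real T)"
    have g: "g \<ge> 1" using a by (simp add: g_def)
    \<comment> \<open>The normalising exponential multiplies errors made at step
      \<open>n * T\<close> by \<open>g\<close>, so the tolerance there is divided by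
      \<open>g\<close>.\<close>
    define \<epsilon> where "\<epsilon> = \<epsilon>' M / g"
    have \<epsilon>: "0 < \<epsilon>" "\<epsilon> \<le> \<epsilon>' M" "g * \<epsilon> = \<epsilon>' M"
      using \<epsilon>0[of M] g by (auto simp: \<epsilon>_def pos_divide_le_eq)
    have bg: "b M = g * y (2 * real T) ^ l"
      unfolding b_def T(2)[symmetric] g_def a_def by (simp add: power_mult_distrib exp_of_nat_mult[symmetric] mult_ac)
    define j where "j n = m n - n * T" for n
    have "(\<lambda>n. real (j n) / (real n)\<^sup>2) \<longlonglongrightarrow> 0"
    proof (rule tendsto_sandwich[OF _ _ tendsto_const m2])
      show "eventually (\<lambda>n. 0 \<le> real (j n) / (real n)\<^sup>2) sequentially" by (intro always_eventually) auto
      show "eventually (\<lambda>n. real (j n) / (real n)\<^sup>2 \<le> real (m n) / (real n)\<^sup>2) sequentially"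
        by (intro always_eventually allI divide_right_mono) (auto simp: j_def)
    qed
    note dl = decay_limit[OF this a]
    let ?r = "\<lambda>s n. (1 - (a * real n - s) / (real n * (real n - 1) / 2)) ^ j n * exp (2 * a * real (j n) / real n)"
    have "eventually (\<lambda>n. ?r s1 n < 1 + \<epsilon>' M) sequentially" by (rule order_tendstoD(2)[OF dl(1)]) (use \<epsilon>0 in auto)
    moreover have "eventually (\<lambda>n. 1 - \<epsilon>' M < ?r s2 n) sequentially" by (rule order_tendstoD(1)[OF dl(1)]) (use \<epsilon>0 in auto)
    moreover have "eventually (\<lambda>n. real (m n) / real n \<ge> real T) sequentially" using m1 by (simp add: filterlim_at_top)
    moreover note dl(2)[of s1] dl(2)[of s2] eventually_isomom[OF \<epsilon>(1) T(1), of l] eventually_ge_at_top[of "4 * l + 2"]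
    ultimately show ?thesis
    proof eventually_elim
      case (elim n)
      have n2: "n \<ge> 2" and n4: "n \<ge> 4 * l" using elim(7) by auto
      have n0: "real n > 0" using n2 by simp
      interpret F: frozen_process p n by (rule frozen_process[OF n2])
      have dec: "F.decay l s = 1 - (a * real n - s) / (real n * (real n - 1) / 2)" for s
        by (simp add: F.decay_def F.N_eq a_def)
      have "real T * real n \<le> real (m n)" using elim(3) n0 by (simp add: pos_le_divide_eq)
      then have "real (n * T) \<le> real (m n)" by (simp add: mult.commute)
      then have nT: "n * T \<le> m n" by (simp only: of_nat_le_iff)
      have mj: "m n = n * T + j n" using nT by (simp add: j_def)
      have ex: "exp (2 * (real l * p) * real (m n) / real n) = g * exp (2 * a * real (j n) / real n)"
      proof -
        have "2 * (real l * p) * real (m n) / real n = 2 * a * real T + 2 * a * real (j n) / real n"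
          using n0 unfolding mj by (simp add: a_def field_simps)
        then show ?thesis by (simp add: g_def exp_add)
      qed
      define W where "W = fact l / real n ^ l"
      have W: "W > 0" using n0 by (simp add: W_def)
      have iso: "F.isomom l G = W * F.chooseiso l G" for G by (simp add: W_def)
      define \<beta> \<gamma> where "\<beta> = F.E (n * T) (F.isomom l)" "\<gamma> = F.E (n * T) (\<lambda>G. F.isomom l G * F.unf G)"
      have \<beta>: "\<beta> = W * F.E (n * T) (F.chooseiso l)" unfolding \<beta>_\<gamma>_def iso by (rule F.E_cmult)
      have \<gamma>: "\<gamma> = W * F.E (n * T) (\<lambda>G. F.chooseiso l G * F.unf G)" unfolding \<beta>_\<gamma>_def iso mult.assoc by (rule F.E_cmult)
      have \<beta>_bounds: "y (2 * real T) ^ l - \<epsilon> \<le> \<beta>" "\<beta> \<le> y (2 * real T) ^ l + \<epsilon>"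
        and \<gamma>_bound: "\<gamma> \<le> y (2 * real T) ^ l * (v (2 * real M) + \<epsilon>) + \<epsilon>"
        using elim(6) unfolding \<beta>_\<gamma>_def T(2) by auto
      have \<beta>0: "0 \<le> \<beta>" unfolding \<beta>_\<gamma>_def by (intro F.E_nonneg) auto
      have R: "R n = g * (W * F.E (n * T + j n) (F.chooseiso l) * exp (2 * a * real (j n) / real n))"
        unfolding R_def ex iso F.E_cmult mj[symmetric] by simp
      have upW: "W * F.E (n * T + j n) (F.chooseiso l) \<le> W * (F.decay l s1 ^ j n * F.E (n * T) (F.chooseiso l))"
        using F.E_chooseiso_upper[of l "n * T" "j n"] elim(4) W unfolding s1_s2_def(1)[symmetric] dec by (intro mult_left_mono) auto
      have "R n \<le> g * (W * (F.decay l s1 ^ j n * F.E (n * T) (F.chooseiso l)) * exp (2 * a * real (j n) / real n))"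
        unfolding R using g by (intro mult_left_mono[OF mult_right_mono[OF upW]]) auto
      also have "\<dots> = (g * \<beta>) * ?r s1 n" unfolding \<beta> dec by simp
      also have "\<dots> \<le> (g * (y (2 * real T) ^ l + \<epsilon>)) * (1 + \<epsilon>' M)"
        using \<beta>_bounds(2) \<beta>0 elim(1,4) g \<epsilon>(1) y_pos[of "2 * real T"] by (intro mult_mono) auto
      also have "g * (y (2 * real T) ^ l + \<epsilon>) = b M + \<epsilon>' M" unfolding bg distrib_left \<epsilon>(3) ..
      finally have "R n \<le> (b M + \<epsilon>' M) * (1 + \<epsilon>' M)" .
      moreover have "\<epsilon>' M * \<epsilon>' M \<le> \<epsilon>' M * 1" using \<epsilon>0[of M] by (intro mult_left_mono) auto
      ultimately have up: "R n - b M \<le> b M * \<epsilon>' M + 2 * \<epsilon>' M" by (simp add: algebra_simps)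
      define h where "h = \<epsilon>' M + C * (b M * (v (2 * real M) + \<epsilon>' M) + \<epsilon>' M)"
      have h0: "0 \<le> h" unfolding h_def using \<epsilon>0(1)[of M] C b0[of M] v_range(1)[of "2 * real M"]
        by (intro add_nonneg_nonneg mult_nonneg_nonneg) auto
      have lowg: "b M - h \<le> g * (\<beta> - C * \<gamma>)"
      proof -
        have "C * \<gamma> \<le> C * (y (2 * real T) ^ l * (v (2 * real M) + \<epsilon>) + \<epsilon>)" using \<gamma>_bound C by (rule mult_left_mono)
        then have "g * (y (2 * real T) ^ l - \<epsilon> - C * (y (2 * real T) ^ l * (v (2 * real M) + \<epsilon>) + \<epsilon>)) \<le> g * (\<beta> - C * \<gamma>)"
          using \<beta>_bounds(1) g by (intro mult_left_mono) auto
        moreover have "g * (y (2 * real T) ^ l - \<epsilon> - C * (y (2 * real T) ^ l * (v (2 * real M) + \<epsilon>) + \<epsilon>)) =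
           g * y (2 * real T) ^ l - g * \<epsilon> - C * (g * y (2 * real T) ^ l * (v (2 * real M) + \<epsilon>) + g * \<epsilon>)" by (simp add: algebra_simps)
        moreover have "\<dots> = b M - \<epsilon>' M - C * (b M * (v (2 * real M) + \<epsilon>) + \<epsilon>' M)" unfolding bg[symmetric] \<epsilon>(3) ..
        moreover have "C * (b M * (v (2 * real M) + \<epsilon>) + \<epsilon>' M) \<le> C * (b M * (v (2 * real M) + \<epsilon>' M) + \<epsilon>' M)"
          using \<epsilon>(2) b0 C by (intro mult_left_mono add_mono) auto
        ultimately show ?thesis unfolding h_def by linarith
      qed
      \<comment> \<open>Multiplication by the decay factor preserves the estimate only for a
        nonnegative lower bound; a negative one is covered by \<open>R n \<ge> 0\<close>.\<close>
      have low: "b M - h - b M * \<epsilon>' M \<le> R n"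
      proof (cases "b M - h \<ge> 0")
        case False
        have "0 \<le> R n" unfolding R using g W by (intro mult_nonneg_nonneg F.E_nonneg) auto
        moreover have "0 \<le> b M * \<epsilon>' M" using b0 \<epsilon>0(1)[of M] by simp
        ultimately show ?thesis using False by linarith
      next
        case True
        have lowW: "W * (F.decay l s2 ^ j n * (F.E (n * T) (F.chooseiso l) - C * F.E (n * T) (\<lambda>G. F.chooseiso l G * F.unf G))) \<le> W * F.E (n * T + j n) (F.chooseiso l)"
          using F.E_chooseiso_lower[OF l n4, of "j n" "n * T"] elim(5) W unfolding s1_s2_def C_def dec by (intro mult_left_mono) auto
        have h1: "g * (W * (F.decay l s2 ^ j n * (F.E (n * T) (F.chooseiso l) - C * F.E (n * T) (\<lambda>G. F.chooseiso l G * F.unf G))) * exp (2 * a * real (j n) / real n)) \<le> R n"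
          unfolding R using g by (intro mult_left_mono[OF mult_right_mono[OF lowW]]) auto
        have h2: "g * (W * (F.decay l s2 ^ j n * (F.E (n * T) (F.chooseiso l) - C * F.E (n * T) (\<lambda>G. F.chooseiso l G * F.unf G))) * exp (2 * a * real (j n) / real n))
          = (g * (\<beta> - C * \<gamma>)) * ?r s2 n" unfolding \<beta> \<gamma> dec by (simp add: algebra_simps)
        have 1: "(g * (\<beta> - C * \<gamma>)) * ?r s2 n \<le> R n" using h1 unfolding h2 .
        have "(b M - h) * (1 - \<epsilon>' M) \<le> (b M - h) * ?r s2 n" using True elim(2) by (intro mult_left_mono) auto
        also have "\<dots> \<le> (g * (\<beta> - C * \<gamma>)) * ?r s2 n" using lowg elim(5) by (intro mult_right_mono) auto
        also note 1
        finally have "(b M - h) * (1 - \<epsilon>' M) \<le> R n" .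
        moreover have "0 \<le> h * \<epsilon>' M" using h0 \<epsilon>0(1)[of M] by simp
        ultimately show ?thesis by (simp add: algebra_simps)
      qed
      have "0 \<le> C * (b M * (v (2 * real M) + \<epsilon>' M) + \<epsilon>' M)" using \<epsilon>0(1)[of M] C b0[of M] v_range(1)[of "2 * real M"]
        by (intro add_nonneg_nonneg mult_nonneg_nonneg) auto
      then show ?case using up low \<epsilon>0(1)[of M] unfolding Err_def h_def by linarith
    qed
  qed
  have "R \<longlonglongrightarrow> exp (- (real l * \<kappa>))"
    by (rule approx_tendsto[where a = "\<lambda>M n. b M" and b = b and e = "\<lambda>M n. Err M" and E = Err])
       (use blim Errlim ev in auto)
  then show ?thesis unfolding R_def .
qed

end

section \<open>Convergence of the factorial moments\<close>

text \<open>For \<open>K = k * p\<close> and \<open>B = k - 1\<close> this is the shifted critical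
  time: beyond any fixed time, hence late, but \<open>o(n)\<close>, so that the number of steps is
  \<open>o(n ^ 2)\<close>.\<close>

lemma crit_time_asymp:
  fixes K B c :: real
  assumes "K > 0"
  defines "t \<equiv> \<lambda>n::nat. ln (real n) / K + B / K * ln (ln (real n) / K) + c"
  shows "filterlim t at_top sequentially" "(\<lambda>n. t n / real n) \<longlonglongrightarrow> 0" "(\<lambda>n. t n / (ln (real n) / K)) \<longlonglongrightarrow> 1"
proof -
  have l0: "filterlim (\<lambda>n::nat. ln (real n) / K) at_top sequentially" using assms(1) by real_asymp
  have l1: "(\<lambda>n::nat. ln (ln (real n) / K) / (ln (real n) / K)) \<longlonglongrightarrow> 0" using assms(1) by real_asymp
  have l2: "(\<lambda>n::nat. c / (ln (real n) / K)) \<longlonglongrightarrow> 0" using assms(1) by real_asymp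
  have l3: "(\<lambda>n::nat. (ln (real n) / K) / real n) \<longlonglongrightarrow> 0" using assms(1) by real_asymp
  have "(\<lambda>n. 1 + B / K * (ln (ln (real n) / K) / (ln (real n) / K)) + c / (ln (real n) / K)) \<longlonglongrightarrow> 1 + B / K * 0 + 0"
    by (intro tendsto_intros l1 l2)
  moreover have "eventually (\<lambda>n. 1 + B / K * (ln (ln (real n) / K) / (ln (real n) / K)) + c / (ln (real n) / K) = t n / (ln (real n) / K)) sequentially"
    using eventually_ge_at_top[of 2]
  proof eventually_elim
    case (elim n)
    then have "ln (real n) > 0" by simp
    then have "ln (real n) / K \<noteq> 0" using assms(1) by simp
    then show ?case unfolding t_def add_divide_distrib by simp
  qed
  ultimately show r: "(\<lambda>n. t n / (ln (real n) / K)) \<longlonglongrightarrow> 1" using Lim_transform_eventually by fastforce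
  have eq: "eventually (\<lambda>n. t n / (ln (real n) / K) * (ln (real n) / K) = t n) sequentially"
    using eventually_ge_at_top[of 2]
  proof eventually_elim
    case (elim n)
    then have "ln (real n) > 0" by simp
    then show ?case using assms(1) by simp
  qed
  have "filterlim (\<lambda>n. t n / (ln (real n) / K) * (ln (real n) / K)) at_top sequentially"
    by (rule filterlim_tendsto_pos_mult_at_top[OF r _ l0]) simp
  then show "filterlim t at_top sequentially"
    by (rule filterlim_mono_eventually) (use eq in auto)
  have "(\<lambda>n. t n / (ln (real n) / K) * ((ln (real n) / K) / real n)) \<longlonglongrightarrow> 1 * 0"
    by (intro tendsto_mult r l3)
  moreover have "eventually (\<lambda>n. t n / (ln (real n) / K) * ((ln (real n) / K) / real n) = t n / real n) sequentially"
    using eq by eventually_elim (simp only: times_divide_eq_right)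
  ultimately show "(\<lambda>n. t n / real n) \<longlonglongrightarrow> 0" using Lim_transform_eventually by fastforce
qed

lemma falling_ratio_limit:
  assumes "filterlim (\<lambda>n. real (x n)) at_top sequentially"
  shows "(\<lambda>n. real (x n choose b) * fact b / real (x n) ^ b) \<longlonglongrightarrow> 1"
proof (rule tendsto_sandwich)
  have "(\<lambda>n. (real b)\<^sup>2 / real (x n)) \<longlonglongrightarrow> 0" using assms by (rule real_tendsto_divide_at_top[OF tendsto_const])
  from tendsto_diff[OF tendsto_const[of 1] this] show "(\<lambda>n. 1 - (real b)\<^sup>2 / real (x n)) \<longlonglongrightarrow> 1" by simp
  have pos: "eventually (\<lambda>n. real (x n) \<ge> 1) sequentially" using assms unfolding filterlim_at_top by blast
  show "eventually (\<lambda>n. 1 - (real b)\<^sup>2 / real (x n) \<le> real (x n choose b) * fact b / real (x n) ^ b) sequentially"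
    using pos
  proof eventually_elim
    case (elim n)
    then have x0: "real (x n) > 0" by linarith
    have "1 - real (x n choose b) * fact b / real (x n) ^ b = (real (x n) ^ b - real (x n choose b) * fact b) / real (x n) ^ b"
      using x0 by (simp add: diff_divide_distrib)
    also have "\<dots> \<le> (real b)\<^sup>2 * real (x n) ^ (b - 1) / real (x n) ^ b"
      by (intro divide_right_mono pow_minus_falling(2)) simp
    also have "\<dots> \<le> (real b)\<^sup>2 / real (x n)" using x0 by (cases b) auto
    finally show ?case by linarith
  qed
  show "eventually (\<lambda>n. real (x n choose b) * fact b / real (x n) ^ b \<le> 1) sequentially"
    using pos
  proof eventually_elim
    case (elim n)
    then have "real (x n) ^ b > 0" by simp
    then show ?case using pow_minus_falling(1)[of "x n" b] by (simp add: pos_divide_le_eq)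
  qed
qed (rule tendsto_const)

lemma tree_count_le_n: "tree_count n k G \<le> n"
proof -
  have "tree_count n k G \<le> card (components n G)" unfolding tree_count_def by (intro card_mono) (auto simp: components_def)
  also have "\<dots> \<le> n" using card_image_le[of "{1..n}" "component G"] by (simp add: components_def)
  finally show ?thesis .
qed

lemma finite_num_trees: "finite (set_pmf (num_trees p n k m))"
  by (rule finite_subset[of _ "{..n}"]) (auto simp: num_trees_def tree_count_le_n)

context frozen_process
begin

text \<open>The normalisation is distributed over the \<open>r\<close> factors, so that each factor
  and the remaining expectation converge separately.\<close>

lemma E_choose_tree_count_isomom:
  assumes "k \<ge> 1"
  shows "E m (\<lambda>G. real (tree_count n k G choose r)) =
    (\<Prod>j<r. mark_rate k (m - j * (k - 1)) / fact k * real n ^ k * exp (- (2 * (real k * p) * real (m - r * (k - 1)) / real n))) / fact r *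
      (E (m - r * (k - 1)) (isomom (r * k)) * exp (2 * (real (r * k) * p) * real (m - r * (k - 1)) / real n))"
proof -
  have n0: "real n > 0" using n_ge_2 by simp
  let ?m' = "m - r * (k - 1)"
  have "E m (\<lambda>G. real (tree_count n k G choose r)) =
    (\<Prod>j<r. mark_rate k (m - j * (k - 1))) * (fact (r * k) / (fact k ^ r * fact r)) * E ?m' (chooseiso (r * k))"
  proof (cases "k \<ge> 2")
    case True
    then show ?thesis using E_choose_tree_count[OF True, of m r 0] by simp
  next
    case False
    then have k: "k = 1" using assms by simp
    have "mark_rate 1 i = 1" for i by (simp add: mark_rate_def tree_number_def)
    moreover have "E m (\<lambda>G. real (tree_count n 1 G choose r)) = E m (chooseiso r)"
      by (rule E_cong) (simp add: tree_count_1[simplified])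
    ultimately show ?thesis by (simp add: k)
  qed
  also have "E ?m' (chooseiso (r * k)) = E ?m' (isomom (r * k)) * real n ^ (r * k) / fact (r * k)"
  proof -
    have "E ?m' (isomom (r * k)) = fact (r * k) / real n ^ (r * k) * E ?m' (chooseiso (r * k))"
      unfolding E_cmult[symmetric] by (rule arg_cong[of _ _ "E ?m'"]) (auto simp: fun_eq_iff)
    then show ?thesis using n0 by simp
  qed
  finally have 0: "E m (\<lambda>G. real (tree_count n k G choose r)) =
    (\<Prod>j<r. mark_rate k (m - j * (k - 1))) * (fact (r * k) / (fact k ^ r * fact r)) *
    (E ?m' (isomom (r * k)) * real n ^ (r * k) / fact (r * k))" .
  have nk: "real n ^ (r * k) = (real n ^ k) ^ r" by (simp add: power_mult[symmetric] mult.commute)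
  define I where "I = E ?m' (isomom (r * k))"
  have 1: "E m (\<lambda>G. real (tree_count n k G choose r)) =
    (\<Prod>j<r. mark_rate k (m - j * (k - 1))) * (real n ^ k) ^ r / fact k ^ r / fact r * I"
    unfolding 0 I_def[symmetric] unfolding nk by simp
  define z where "z = 2 * (real k * p) * real ?m' / real n"
  have ez: "exp (2 * (real (r * k) * p) * real ?m' / real n) = exp z ^ r"
    unfolding exp_of_nat_mult[symmetric] by (simp add: z_def mult_ac)
  have "(\<Prod>j<r. mark_rate k (m - j * (k - 1)) / fact k * real n ^ k * exp (- z)) =
    (\<Prod>j<r. mark_rate k (m - j * (k - 1))) * (real n ^ k) ^ r / fact k ^ r * exp (- z) ^ r"
    by (simp add: prod.distrib prod_dividef)
  moreover have "exp (- z) ^ r * exp z ^ r = 1" by (simp add: power_mult_distrib[symmetric] exp_minus)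
  ultimately show ?thesis unfolding 1 ez z_def[symmetric] I_def[symmetric] by simp
qed

end

lemma fmom_num_trees:
  assumes "frozen_process p n"
  shows "fmom (num_trees p n k m) r = frozen_process.E p n m (\<lambda>G. real (tree_count n k G choose r))"
  by (simp add: num_trees_def frozen_process.E_def[OF assms])

context fluid
begin

text \<open>The critical time is such that \<open>exp (K * (t n - c)) = n * L ^ (k - 1)\<close> with
  \<open>L = ln n / K\<close>. This balances \<open>n ^ k\<close> times \<open>mark_rate\<close>,
  which is of order \<open>n * (2 * m / n) ^ (k - 1)\<close> with \<open>2 * m / n\<close>
  asymptotic to \<open>L\<close>: the double logarithm compensates the power of
  \<open>L\<close>.\<close>

lemma fmom_limit:
  assumes k: "k \<ge> 1"
  shows "(\<lambda>n. fmom (num_trees p n k (num_steps p n k c)) r) \<longlonglongrightarrow>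
    (tree_number k / fact k * exp (- (real k * p * c)) * exp (- (real k * \<kappa>))) ^ r / fact r"
proof -
  define K where "K = real k * p"
  have K: "K > 0" using k p_pos by (simp add: K_def)
  define b where "b = k - 1"
  have kb: "k = Suc b" using k by (simp add: b_def)
  define t where "t n = ln (real n) / K + real b / K * ln (ln (real n) / K) + c" for n :: nat
  note ta = crit_time_asymp[OF K, of "real b" c, folded t_def]
  define m where "m n = num_steps p n k c" for n
  have m: "m n = nat \<lfloor>real n / 2 * t n\<rfloor>" for n
    by (simp add: m_def num_steps_def crit_time_def t_def K_def kb)
  define x where "x q n = m n - q" for q n :: nat
  have t0: "eventually (\<lambda>n. t n \<ge> 0) sequentially" using ta(1) unfolding filterlim_at_top by blast
  have mb: "eventually (\<lambda>n. real n / 2 * t n - 1 \<le> real (m n) \<and> real (m n) \<le> real n / 2 * t n) sequentially"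
    using t0
  proof eventually_elim
    case (elim n)
    then have "0 \<le> real n / 2 * t n" by simp
    then show ?case unfolding m by (simp add: of_nat_nat) linarith
  qed
  \<comment> \<open>Rounding and a bounded shift \<open>q\<close> of the number of steps change the
    time by order \<open>1 / n\<close> only.\<close>
  have xb: "eventually (\<lambda>n. \<bar>2 * real (x q n) / real n - t n\<bar> \<le> (2 + 2 * real q) / real n) sequentially" for q
    using mb eventually_ge_at_top[of 2]
  proof eventually_elim
    case (elim n)
    have n0: "real n > 0" using elim by simp
    have "real (x q n) \<le> real (m n)" "real (m n) - real q \<le> real (x q n)" by (auto simp: x_def)
    then have "real n / 2 * t n - 1 - real q \<le> real (x q n)" "real (x q n) \<le> real n / 2 * t n" using elim(1) by linarith+
    then have "- (2 + 2 * real q) \<le> 2 * real (x q n) - real n * t n" "2 * real (x q n) - real n * t n \<le> 2 + 2 * real q" by linarith+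
    then have "\<bar>2 * real (x q n) - real n * t n\<bar> \<le> 2 + 2 * real q" by (intro abs_leI) auto
    then have "\<bar>2 * real (x q n) - real n * t n\<bar> / real n \<le> (2 + 2 * real q) / real n" using n0 by (intro divide_right_mono) auto
    moreover have "2 * real (x q n) / real n - t n = (2 * real (x q n) - real n * t n) / real n" using n0 by (simp add: diff_divide_distrib)
    ultimately show ?case using n0 by (simp add: abs_divide)
  qed
  have w: "(\<lambda>n. 2 * real (x q n) / real n - t n) \<longlonglongrightarrow> 0" for q
  proof (rule tendsto_rabs_zero_cancel, rule tendsto_sandwich[OF _ xb tendsto_const])
    show "(\<lambda>n. (2 + 2 * real q) / real n) \<longlonglongrightarrow> 0" by real_asymp
  qed (auto intro: always_eventually)
  have xt: "filterlim (\<lambda>n. 2 * real (x q n) / real n) at_top sequentially" for q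
    using filterlim_tendsto_add_at_top[OF w[of q] ta(1)] by simp
  have x1: "filterlim (\<lambda>n. real (x q n) / real n) at_top sequentially" for q
    using filterlim_tendsto_pos_mult_at_top[OF tendsto_const[of "1 / 2"] _ xt[of q]] by simp
  have x0: "filterlim (\<lambda>n. real (x q n)) at_top sequentially" for q
  proof -
    have "filterlim (\<lambda>n. real (x q n) / real n * real n) at_top sequentially"
      by (rule filterlim_at_top_mult_at_top[OF x1 filterlim_real_sequentially])
    moreover have "eventually (\<lambda>n. real (x q n) / real n * real n = real (x q n)) sequentially"
      using eventually_gt_at_top[of 0] by eventually_elim simp
    ultimately show ?thesis by (rule filterlim_mono_eventually[OF _ order_refl order_refl])
  qed
  have x2: "(\<lambda>n. real (x q n) / (real n)\<^sup>2) \<longlonglongrightarrow> 0" for q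
  proof -
    have 1: "(\<lambda>n. (2 * real (x q n) / real n - t n) * (1 / (2 * real n)) + t n / real n * (1 / 2)) \<longlonglongrightarrow> 0 * 0 + 0 * (1 / 2)"
    proof (intro tendsto_add tendsto_mult w ta(2) tendsto_const)
      show "(\<lambda>n. 1 / (2 * real n)) \<longlonglongrightarrow> 0" by real_asymp
    qed
    have "eventually (\<lambda>n. (2 * real (x q n) / real n - t n) * (1 / (2 * real n)) + t n / real n * (1 / 2) = real (x q n) / (real n)\<^sup>2) sequentially"
      using eventually_gt_at_top[of 0] by eventually_elim (simp add: field_simps power2_eq_square)
    with 1 show ?thesis using Lim_transform_eventually by fastforce
  qed
  have xL: "(\<lambda>n. (2 * real (x q n) / real n) / (ln (real n) / K)) \<longlonglongrightarrow> 1" for q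
  proof -
    have "filterlim (\<lambda>n::nat. ln (real n) / K) at_top sequentially" using K by real_asymp
    from real_tendsto_divide_at_top[OF w[of q] this]
    have "(\<lambda>n. (2 * real (x q n) / real n - t n) / (ln (real n) / K) + t n / (ln (real n) / K)) \<longlonglongrightarrow> 0 + 1"
      by (intro tendsto_add ta(3))
    then show ?thesis unfolding add_divide_distrib[symmetric] by simp
  qed
  define A where "A q q' n = frozen_process.mark_rate n k (x q n) / fact k * real n ^ k * exp (- (2 * (real k * p) * real (x q' n) / real n))" for q q' n
  \<comment> \<open>Here \<open>q\<close> is the shift inside \<open>mark_rate\<close>, which varies
    along the product, and \<open>q'\<close> is the total shift in the exponential.\<close>
  have A: "A q q' \<longlonglongrightarrow> tree_number k / fact k * exp (- (real k * p * c))" for q q'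
  proof -
    define f where "f n = real (x q n choose b) * fact b / real (x q n) ^ b" for n
    let ?B = "\<lambda>n. tree_number k / fact k * f n * (1 / (1 - 1 / real n)) ^ b * ((2 * real (x q n) / real n) / (ln (real n) / K)) ^ b *
      exp (- (K * c)) * exp (- (K * (2 * real (x q' n) / real n - t n)))"
    have f: "f \<longlonglongrightarrow> 1" unfolding f_def by (rule falling_ratio_limit[OF x0])
    have "(\<lambda>n. 1 / (1 - 1 / real n)) \<longlonglongrightarrow> 1" by real_asymp
    then have "?B \<longlonglongrightarrow> tree_number k / fact k * 1 * 1 ^ b * 1 ^ b * exp (- (K * c)) * exp (- (K * 0))"
      by (intro tendsto_mult tendsto_power tendsto_exp tendsto_minus tendsto_const f xL w)
    then have "?B \<longlonglongrightarrow> tree_number k / fact k * exp (- (real k * p * c))" by (simp add: K_def)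
    moreover have "eventually (\<lambda>n. real (x q n) \<ge> 1) sequentially" using x0 unfolding filterlim_at_top by blast
    then have "eventually (\<lambda>n. ?B n = A q q' n) sequentially"
      using eventually_ge_at_top[of 2]
    proof eventually_elim
      case (elim n)
      interpret F: frozen_process p n by (rule frozen_process[OF elim(2)])
      define L where "L = ln (real n) / K"
      define X where "X = real (x q n)"
      define d where "d = 1 - 1 / real n"
      have pos: "real n > 0" "L > 0" "X > 0" "d > 0" using elim K by (auto simp: L_def X_def d_def)
      have "exp (K * (t n - c)) = real n * L ^ b"
      proof -
        have "K * (t n - c) = ln (real n) + real b * ln L" using K by (simp add: t_def L_def field_simps)
        then show ?thesis using pos by (simp add: exp_add exp_of_nat_mult)
      qed
      moreover have "exp (- (K * c)) * exp (- (K * (2 * real (x q' n) / real n - t n))) =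
         exp (K * (t n - c)) * exp (- (2 * (real k * p) * real (x q' n) / real n))"
        unfolding exp_add[symmetric] by (simp add: K_def algebra_simps)
      ultimately have e: "exp (- (K * c)) * exp (- (K * (2 * real (x q' n) / real n - t n))) =
         real n * L ^ b * exp (- (2 * (real k * p) * real (x q' n) / real n))" by simp
      have N: "F.N = (real n)\<^sup>2 / 2 * d" using pos by (simp add: F.N_eq d_def power2_eq_square field_simps)
      have "?B n = tree_number k / fact k * f n * (1 / d) ^ b * ((2 * X / real n) / L) ^ b * (exp (- (K * c)) * exp (- (K * (2 * real (x q' n) / real n - t n))))"
        by (simp add: L_def X_def d_def)
      also have "\<dots> = tree_number k / fact k * (real (x q n choose b) * fact b / X ^ b) * (1 / d) ^ b * ((2 * X / real n) / L) ^ b * (real n * L ^ b * exp (- (2 * (real k * p) * real (x q' n) / real n)))"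
        unfolding e f_def X_def ..
      also have "\<dots> = (tree_number k / fact k * (real (x q n choose b) * fact b) * exp (- (2 * (real k * p) * real (x q' n) / real n))) * (2 ^ b * real n / (d ^ b * real n ^ b))"
        using pos by (simp add: power_divide power_mult_distrib)
      also have "2 ^ b * real n / (d ^ b * real n ^ b) = real n ^ k / F.N ^ b"
        unfolding N kb using pos by (simp add: power_divide power_mult_distrib power2_eq_square, simp add: mult_ac)
      also have "(tree_number k / fact k * (real (x q n choose b) * fact b) * exp (- (2 * (real k * p) * real (x q' n) / real n))) * (real n ^ k / F.N ^ b) = A q q' n"
        unfolding A_def F.mark_rate_def b_def[symmetric] by (simp add: mult_ac)
      finally show ?case .
    qed
    ultimately show ?thesis by (rule Lim_transform_eventually)
  qed
  define I where "I n = frozen_process.E p n (x (r * b) n) (frozen_process.isomom n (r * k)) * exp (2 * (real (r * k) * p) * real (x (r * b) n) / real n)" for n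
  have I: "I \<longlonglongrightarrow> exp (- (real k * \<kappa>)) ^ r"
  proof (cases "r = 0")
    case True
    \<comment> \<open>\<open>isomom_limit\<close> is for positive order; for \<open>r = 0\<close>
      the expectation is 1.\<close>
    have "eventually (\<lambda>n. 1 = I n) sequentially" using eventually_ge_at_top[of 2]
    proof eventually_elim
      case (elim n)
      interpret F: frozen_process p n by (rule frozen_process[OF elim])
      show ?case by (simp add: I_def True)
    qed
    from Lim_transform_eventually[OF tendsto_const this] show ?thesis by (simp add: True)
  next
    case False
    then have "r * k \<ge> 1" using k by simp
    from isomom_limit[OF x1 x2 this] have "I \<longlonglongrightarrow> exp (- (real (r * k) * \<kappa>))" unfolding I_def .
    moreover have "exp (- (real (r * k) * \<kappa>)) = exp (- (real k * \<kappa>)) ^ r"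
      unfolding exp_of_nat_mult[symmetric] by (simp add: mult_ac)
    ultimately show ?thesis by simp
  qed
  have 1: "(\<lambda>n. (\<Prod>j<r. A (j * b) (r * b) n) / fact r * I n) \<longlonglongrightarrow>
     (\<Prod>j<r. tree_number k / fact k * exp (- (real k * p * c))) / fact r * exp (- (real k * \<kappa>)) ^ r"
    by (intro tendsto_mult tendsto_divide tendsto_prod A I tendsto_const) simp
  have 2: "(\<Prod>j<r. tree_number k / fact k * exp (- (real k * p * c))) / fact r * exp (- (real k * \<kappa>)) ^ r =
    (tree_number k / fact k * exp (- (real k * p * c)) * exp (- (real k * \<kappa>))) ^ r / fact r"
    unfolding prod_constant card_lessThan power_mult_distrib by (simp only: times_divide_eq_left)
  have 3: "eventually (\<lambda>n. (\<Prod>j<r. A (j * b) (r * b) n) / fact r * I n = fmom (num_trees p n k (num_steps p n k c)) r) sequentially"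
    using eventually_ge_at_top[of 2]
  proof eventually_elim
    case (elim n)
    interpret F: frozen_process p n by (rule frozen_process[OF elim])
    show ?case unfolding fmom_num_trees[OF F.frozen_process_axioms] F.E_choose_tree_count_isomom[OF k]
      by (simp only: A_def I_def x_def m_def b_def)
  qed
  show ?thesis by (rule Lim_transform_eventually[OF 1[unfolded 2] 3])
qed

end

theorem proposition1p10:
  fixes p c :: real and k :: nat
  assumes "0 < p" and "p \<le> 1" and "k \<ge> 1"
  shows "weak_conv_m
           (\<lambda>n. distr (measure_pmf (num_trees p n k (num_steps p n k c))) borel real)
           (distr (measure_pmf (poisson_pmf (limit_rate p k c))) borel real)
       \<and> (\<forall>r>0. (\<lambda>n. measure_pmf.expectation (num_trees p n k (num_steps p n k c))
                        (\<lambda>x. real x powr r))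
             \<longlonglongrightarrow> measure_pmf.expectation (poisson_pmf (limit_rate p k c)) (\<lambda>x. real x powr r))"
proof -
  interpret fluid p by unfold_locales (use assms in auto)
  \<comment> \<open>For \<open>k = 1\<close> the exponent is \<open>- 1\<close>, the reason for an
    integer power in the rate; both sides are then 1.\<close>
  have "real k powi (int k - 2) = tree_number k"
  proof (cases "k = 1")
    case False
    then have 1: "int k - 2 = int (k - 2)" and 2: "k - 1 = Suc (k - 2)" using assms(3) by auto
    have "real k powi (int k - 2) = real k ^ (k - 2)" unfolding 1 by (rule power_int_of_nat)
    then show ?thesis using assms(3) 2 by (simp add: tree_number_def)
  qed (simp add: tree_number_def)
  then have rate: "limit_rate p k c = tree_number k / fact k * exp (- (real k * p * c)) * exp (- (real k * \<kappa>))"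
    by (simp add: limit_rate_def \<kappa>_def)
  have "tree_number k > 0" using assms(3) by (simp add: tree_number_def)
  then have pos: "limit_rate p k c > 0" by (simp add: rate)
  have mom: "(\<lambda>n. fmom (num_trees p n k (num_steps p n k c)) r) \<longlonglongrightarrow> limit_rate p k c ^ r / fact r" for r
    unfolding rate by (rule fmom_limit[OF assms(3)])
  show ?thesis
    using poisson_from_factorial_moments[OF pos finite_num_trees mom] by blast
qed

end
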